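(* In the setting below, the ring $H^*(\mathcal G(EIII))$ of GKM functions is generated as an $H^*(BT)$-algebra by the two GKM functions $\tau$ and $\omega$.
   Context: Identify the dual of the Lie algebra of a maximal torus $T$ of $E_6$ with $\{\sum_{i=1}^8x_ie_i\in\mathbb R^8: x_6=x_7=-x_8\}$ with the standard inner product; write $E=e_8-e_7-e_6$. Simple roots: $\alpha_1=\frac12(e_1-e_2-e_3-e_4-e_5-e_6-e_7+e_8)$, $\alpha_2=e_1+e_2$, $\alpha_i=e_{i-1}-e_{i-2}$ ($3\le i\le6$); $\Phi(E_6)=\{\pm(e_i\pm e_j)\ (1\le i<j\le5)\}\cup\{\pm\frac12(\sum_{k=1}^5\mu_ke_k+E):\mu_k=\pm1,\prod\mu_k=1\}$. $H^*(BT)=H^*(BT;\mathbb Z)$ is the symmetric algebra over $\mathbb Z$ on the lattice $H^2(BT)$ spanned by $t_0=\frac12\sum_{i=1}^5e_i-\frac16E$, $t_i=e_i+\frac13E$ ($1\le i\le5$), $x=\frac12(\sum_{i=1}^5e_i+E)$, graded with $H^2$ in degree 2. $W(D_5)\subset W(E_6)$ is generated by the reflections of $\alpha_2,\dots,\alpha_6$; $\bar t=\frac23E$ is fixed by $W(D_5)$; $\Lambda=W(E_6)\cdot\bar t$ consists of the 27 elements $\bar t$; $\frac12\sum_{i=1}^5\mu_ie_i+\frac16E$ with $\mu_i=\pm1$, $\prod\mu_i=-1$; and $\pm e_j-\frac13E$ ($1\le j\le5$). For $\lambda\in\Lambda$ fix $\rho_\lambda\in W(E_6)$ with $\rho_\lambda(\bar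 t)=\lambda$; the vertex $\rho_\lambda W(D_5)$ is written $\rho_\lambda$. The GKM graph $\mathcal G(EIII)$ has vertex set $W(E_6)/W(D_5)$ and for distinct vertices $vW(D_5)\ne wW(D_5)$ and each positive root $\alpha$ with $\sigma_\alpha vW(D_5)=wW(D_5)$ an edge labelled $(\alpha)$; $H^*(\mathcal G(EIII))$ is the ring of functions $f$ from the vertices to $H^*(BT)$ with $f(u)-f(v)\in(\alpha)$ for every edge labelled $(\alpha)$ between $u,v$. Define $\tau(\rho_\lambda)=\bar t-\lambda$, and define $\omega$ (of degree 8) by, with $\mathbf e=\{e_1,\dots,e_5\}$, $c_i$ the elementary symmetric polynomials, $S=\frac12\sum_{i=1}^5e_i$: $\omega(\rho_{\bar t})=0$; $\omega(\rho_\lambda)=0$ for $\lambda=-e_n+S+\frac16E$; $\omega(\rho_\lambda)=(e_l+e_m)(e_m+e_n)(e_n+e_l)(\bar t-\lambda)$ for $\lambda=-e_l-e_m-e_n+S+\frac16E$ ($l,m,n$ distinct); $\omega(\rho_\lambda)=(\bar t-\lambda)(c_1(\mathbf e)c_2(\mathbf e)-c_3(\mathbf e))$ for $\lambda=-S+\frac16E$; $\omega(\rho_\lambda)=\prod_{n\ne j}(-e_n+S+\frac16E-\lambda)$ for $\lambda=e_j-\frac13E$; and for $\lambda=-e_j-\frac13E$, $\omega(\rho_\lambda)=(S+\frac12E)\bigl\{\prod_{n\ne j,k}(-e_n-e_k+S+\frac12E)+(e_j+e_k)(\bar t-\lambda)(-e_k+S+\frac12E)\bigr\}$, where $k\in\{1,\dots,5\}$,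 $k\ne j$. (These $\tau,\omega$ are GKM functions on $\mathcal G(EIII)$.)
   Formalization: In ω(ρ_λ) for λ = −e_j − E/3 the last factor (−e_k + S + E/2) is corrected to (e_j − e_k + S + E/2); with the factor as printed the value depends on k and ω is not a GKM function. *)

theory Defs
  imports Complex_Main "HOL-Library.Function_Algebras" "HOL-Library.Poly_Mapping"
begin

section \<open>The ambient space: R^8 with coordinates 1..8 (vectors as nat => real)\<close>

type_synonym vec = "nat \<Rightarrow> real"

definition eb :: "nat \<Rightarrow> vec" where
  "eb i = (\<lambda>k. if k = i then 1 else 0)"

definition sc :: "real \<Rightarrow> vec \<Rightarrow> vec" where
  "sc c v = (\<lambda>k. c * v k)"

definition ip :: "vec \<Rightarrow> vec \<Rightarrow> real" where
  "ip v w = (\<Sum>k\<in>{1..8}. v k * w k)"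

definition EE :: vec where
  "EE = eb 8 - eb 7 - eb 6"

definition Svec :: vec where
  "Svec = sc (1/2) (\<Sum>i\<in>{1..5}. eb i)"

definition tbar :: vec where
  "tbar = sc (2/3) EE"

definition sroot :: "nat \<Rightarrow> vec" where
  "sroot i = (if i = 1 then sc (1/2) (eb 1 - eb 2 - eb 3 - eb 4 - eb 5 - eb 6 - eb 7 + eb 8)
              else if i = 2 then eb 1 + eb 2
              else eb (i - 1) - eb (i - 2))"

definition Phi :: "vec set" where
  "Phi = {v. \<exists>i j. 1 \<le> i \<and> i < j \<and> j \<le> 5 \<and>
                (v = eb i + eb j \<or> v = eb i - eb j \<or> v = - (eb i + eb j) \<or> v = - (eb i - eb j))}
       \<union> {v. \<exists>mu :: nat \<Rightarrow> real. (\<forall>k\<in>{1..5}. mu k = 1 \<or> mu k = -1) \<and> (\<Prod>k\<in>{1..5}. mu k) = 1 \<and>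
                (v = sc (1/2) ((\<Sum>k\<in>{1..5}. sc (mu k) (eb k)) + EE) \<or>
                 v = - sc (1/2) ((\<Sum>k\<in>{1..5}. sc (mu k) (eb k)) + EE))}"

definition PosRoots :: "vec set" where
  "PosRoots = {a \<in> Phi. \<exists>c :: nat \<Rightarrow> nat. a = (\<Sum>i\<in>{1..6}. sc (real (c i)) (sroot i))}"

definition wrefl :: "vec \<Rightarrow> vec \<Rightarrow> vec" where
  "wrefl a v = v - sc (2 * ip v a / ip a a) a"

inductive_set WE6 :: "(vec \<Rightarrow> vec) set" where
  id: "id \<in> WE6"
| step: "w \<in> WE6 \<Longrightarrow> i \<in> {1..6} \<Longrightarrow> wrefl (sroot i) \<circ> w \<in> WE6"

text \<open>Lambda = W(E6) . tbar; the vertex rho_lambda W(D5) of G(EIII) is identified with lambda\<close>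
definition Lambda :: "vec set" where
  "Lambda = (\<lambda>w. w tbar) ` WE6"

section \<open>H^*(BT) as a subring of the real polynomial ring in z_1..z_8\<close>

type_synonym pol = "(nat \<Rightarrow>\<^sub>0 nat) \<Rightarrow>\<^sub>0 real"

definition pvar :: "nat \<Rightarrow> pol" where
  "pvar k = Poly_Mapping.single (Poly_Mapping.single k 1) 1"

definition pconst :: "real \<Rightarrow> pol" where
  "pconst c = Poly_Mapping.single 0 c"

text \<open>a vector v (an element of H^2(BT) tensor R) as the linear form z |-> <v,z>\<close>
definition lin :: "vec \<Rightarrow> pol" where
  "lin v = (\<Sum>k\<in>{1..8}. pconst (v k) * pvar k)"

definition tgen :: "nat \<Rightarrow> vec" where
  "tgen i = (if i = 0 then Svec - sc (1/6) EE
             else if i \<le> 5 then eb i + sc (1/3) EE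
             else Svec + sc (1/2) EE)"

text \<open>the lattice H^2(BT) spanned by t_0, t_1..t_5, x (= tgen 6)\<close>
definition Lat :: "vec set" where
  "Lat = {v. \<exists>a :: nat \<Rightarrow> int. v = (\<Sum>i\<in>{0..6}. sc (of_int (a i)) (tgen i))}"

inductive_set HBT :: "pol set" where
  gen: "v \<in> Lat \<Longrightarrow> lin v \<in> HBT"
| const: "of_int n \<in> HBT"
| add: "p \<in> HBT \<Longrightarrow> q \<in> HBT \<Longrightarrow> p + q \<in> HBT"
| mult: "p \<in> HBT \<Longrightarrow> q \<in> HBT \<Longrightarrow> p * q \<in> HBT"

definition GKM :: "(vec \<Rightarrow> pol) \<Rightarrow> bool" where
  "GKM f \<longleftrightarrow> (\<forall>l\<in>Lambda. f l \<in> HBT) \<and>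
     (\<forall>l\<in>Lambda. \<forall>m\<in>Lambda. \<forall>a\<in>PosRoots. l \<noteq> m \<and> wrefl a l = m \<longrightarrow>
         (\<exists>g\<in>HBT. f l - f m = lin a * g))"

definition tau :: "vec \<Rightarrow> pol" where
  "tau l = lin (tbar - l)"

definition esym1 :: pol where
  "esym1 = (\<Sum>i\<in>{1..5}. lin (eb i))"

definition esym2 :: pol where
  "esym2 = (\<Sum>i\<in>{1..5}. \<Sum>j\<in>{i<..5}. lin (eb i) * lin (eb j))"

definition esym3 :: pol where
  "esym3 = (\<Sum>i\<in>{1..5}. \<Sum>j\<in>{i<..5}. \<Sum>k\<in>{j<..5}. lin (eb i) * lin (eb j) * lin (eb k))"

definition omega :: "vec \<Rightarrow> pol" where
  "omega l =
    (if l = tbar then 0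
     else if (\<exists>n\<in>{1..5}. l = - eb n + Svec + sc (1/6) EE) then 0
     else if (\<exists>a b c. distinct [a, b, c] \<and> {a, b, c} \<subseteq> {1..5} \<and>
                      l = - eb a - eb b - eb c + Svec + sc (1/6) EE) then
       (let (a, b, c) = (SOME (a, b, c). distinct [a, b, c] \<and> {a, b, c} \<subseteq> {1..5} \<and>
                              l = - eb a - eb b - eb c + Svec + sc (1/6) EE)
        in lin (eb a + eb b) * lin (eb b + eb c) * lin (eb c + eb a) * lin (tbar - l))
     else if l = - Svec + sc (1/6) EE then lin (tbar - l) * (esym1 * esym2 - esym3)
     else if (\<exists>j\<in>{1..5}. l = eb j - sc (1/3) EE) then
       (let j = (SOME j. j \<in> {1..5} \<and> l = eb j - sc (1/3) EE)
        in (\<Prod>n\<in>{1..5} - {j}. lin (- eb n + Svec + sc (1/6) EE - l)))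
     else if (\<exists>j\<in>{1..5}. l = - eb j - sc (1/3) EE) then
       (let j = (SOME j. j \<in> {1..5} \<and> l = - eb j - sc (1/3) EE);
            k = (SOME k. k \<in> {1..5} \<and> k \<noteq> j)
        in lin (Svec + sc (1/2) EE) *
           ((\<Prod>n\<in>{1..5} - {j, k}. lin (- eb n - eb k + Svec + sc (1/2) EE))
            + lin (eb j + eb k) * lin (tbar - l) * lin (eb j - eb k + Svec + sc (1/2) EE)))
     else 0)"

end

theory Submission
  imports Defs "HOL-Library.Multiset"
begin

text \<open>
  In double-six coordinates the 27 vertices are a_i = x - t_i, c_ij = t_i + t_j - x and b_i = -t_i, and omega
  vanishes at the a_i and equals the product of the four roots a_k - c_ij at c_ij.
  Order the vertices as a_0, ..., a_5, then the c_ij lexicographically, then b_0, ..., b_5.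
  A GKM function vanishing at all earlier vertices is divisible at the current vertex by the product of the
  roots leading to earlier neighbours, so it suffices to find, for every vertex, a polynomial in
  tau and omega that vanishes at all earlier vertices and takes exactly this product as value.
  For the a_i products of linear forms in tau work. At the c_ij one multiplies omega by
  flow-up classes of the Grassmannian Gr(2,6), which are polynomials in t_i + t_j and t_i t_j.
  For the b_i a single class of degree 11 vanishing at all a_i and c_ij is needed; its value at b_i is
  minus the product of the 11 roots leading to the a_j and c_jk, and products of linear forms in tau do the rest.
\<close>

section \<open>The double-six coordinates of the 27 vertices\<close>

text \<open>The obstacle is integrality. At c_pq polynomials in \<open>tau\<close> reach t_p + t_q,
  but t_p t_q is lifted only together with a factor omega. For omega * t_p t_q, compare omega with
  the product of all six forms a_k - l: at c_pq it has two extra factors, whose product is t_p t_q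
  plus a polynomial in x and t_p + t_q. For omega * (t_p t_q)^2, use that omega at c_pq is itself a
  monic quadratic in t_p t_q. The four indices besides p, q have vanishing fifth and sixth
  elementary symmetric polynomials. The sixth is, up to sign, a monic cubic in t_p t_q, so all
  higher powers reduce without division. The fifth produces the top class. Any GKM function
  vanishing at all a_j and c_jk is divisible at b_i by 11 linear forms. Lifting omega times the
  fifth relation has degree 9 in the linear forms, hence gives 0 at every b_i; one more factor t_p
  t_q reaches degree 11, where the value must be a constant times that product, and the constant
  turns out to be a unit.\<close>

lemma sc_simps [simp]: "sc c v k = c * v k" by (simp add: sc_def)

lemma sc_plus_left: "sc (c + d) v = sc c v + sc d v"
  and sc_uminus_left: "sc (- c) v = - sc c v"
  by (auto simp: fun_eq_iff algebra_simps)

lemma sc_0 [simp]: "sc 0 v = 0" and sc_1 [simp]: "sc 1 v = v"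
  and sc_zero [simp]: "sc c 0 = 0"
  by (auto simp: fun_eq_iff)

lemma ip_add_left: "ip (u + v) w = ip u w + ip v w"
  and ip_add_right: "ip w (u + v) = ip w u + ip w v"
  and ip_diff_left: "ip (u - v) w = ip u w - ip v w"
  and ip_diff_right: "ip w (u - v) = ip w u - ip w v"
  and ip_minus_left: "ip (- v) w = - ip v w"
  and ip_minus_right: "ip w (- v) = - ip w v"
  and ip_sc_left: "ip (sc c v) w = c * ip v w"
  and ip_sc_right: "ip w (sc c v) = c * ip w v"
  by (simp_all add: ip_def sum.distrib sum_subtractf sum_negf sum_distrib_left algebra_simps)

lemmas ip_bilinear = ip_add_left ip_add_right ip_diff_left ip_diff_right ip_minus_left
  ip_minus_right ip_sc_left ip_sc_right

lemma ip_commute: "ip v w = ip w v"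
  by (simp add: ip_def mult.commute)

lemma ip_sum_left: "ip (\<Sum>i\<in>A. f i) w = (\<Sum>i\<in>A. ip (f i) w)"
proof (induction A rule: infinite_finite_induct)
  case (insert x F)
  have "(\<Sum>i\<in>insert x F. f i) = f x + (\<Sum>i\<in>F. f i)"
    using insert.hyps by (rule sum.insert)
  then have "ip (\<Sum>i\<in>insert x F. f i) w = ip (f x) w + ip (\<Sum>i\<in>F. f i) w"
    by (simp only: ip_add_left)
  then show ?case unfolding insert.IH by (simp only: sum.insert[OF insert.hyps])
qed (simp_all add: ip_def)

lemma ip_expand:
  "ip v w = v 1 * w 1 + v 2 * w 2 + v 3 * w 3 + v 4 * w 4 + v 5 * w 5 + v 6 * w 6 + v 7 * w 7 + v 8 * w 8"
  by (simp add: ip_def eval_nat_numeral)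

lemma EE_apply: "EE k = (if k = 8 then 1 else if k = 7 \<or> k = 6 then -1 else 0)"
  by (simp add: EE_def eb_def)

lemma Svec_apply: "Svec k = (if k \<in> {1..5} then 1 / 2 else 0)"
proof -
  have "(\<Sum>i\<in>{1..5}. eb i) k = (\<Sum>i\<in>{1..5}. eb i k)"
    by (simp add: eval_nat_numeral)
  then show ?thesis by (simp add: Svec_def eb_def)
qed

lemma less_6_cases: "(i::nat) < 6 \<longleftrightarrow> i = 0 \<or> i = 1 \<or> i = 2 \<or> i = 3 \<or> i = 4 \<or> i = 5"
  by auto

lemma tgen_apply: "i < 6 \<Longrightarrow> tgen i k =
    (if i = 0 then Svec k - EE k / 6 else (if k = i then 1 else 0) + EE k / 3)"
  by (auto simp: tgen_def eb_def)

lemma tgen_6_apply: "tgen 6 k = Svec k + EE k / 2"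
  by (auto simp: tgen_def)

text \<open>With \<open>ip_tgen_6\<close> this is the Gram matrix of t_0, ..., t_5, x. Inner
  products of vertices are computed from it without going back to the eight coordinates.\<close>

lemma ip_tgen: "i < 6 \<Longrightarrow> j < 6 \<Longrightarrow> ip (tgen i) (tgen j) = (if i = j then 4/3 else 1/3)"
  by (auto simp: less_6_cases ip_expand tgen_apply EE_apply Svec_apply simp del: One_nat_def)

lemma ip_tgen_6: "i < 6 \<Longrightarrow> ip (tgen i) (tgen 6) = 1" "ip (tgen 6) (tgen 6) = 2"
  "i < 6 \<Longrightarrow> ip (tgen 6) (tgen i) = 1"
  by (auto simp: less_6_cases ip_expand tgen_apply tgen_6_apply EE_apply Svec_apply simp del: One_nat_def)

lemma tgen_relation: "tgen 0 + tgen 1 + tgen 2 + tgen 3 + tgen 4 + tgen 5 = sc 3 (tgen 6)"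
  by (rule ext) (auto simp: tgen_apply tgen_6_apply Svec_apply EE_apply)

text \<open>With t_0, ..., t_5 and x = tgen 6 one has 3x = t_0 + ... + t_5, and the
  weights become the 27 lines in Schlaefli's double-six notation: a_i, b_i and c_ij. Two vertices
  are joined by an edge iff their inner product is 1/3 (the lines are skew).\<close>

definition vA :: "nat \<Rightarrow> vec" where "vA i = tgen 6 - tgen i"
definition vB :: "nat \<Rightarrow> vec" where "vB i = - tgen i"
definition vC :: "nat \<Rightarrow> nat \<Rightarrow> vec" where "vC i j = tgen i + tgen j - tgen 6"

lemmas v_defs = vA_def vB_def vC_def

definition verts :: "vec set" where
  "verts = vA ` {..<6} \<union> {vC i j |i j. i < j \<and> j < 6} \<union> vB ` {..<6}"

lemma vC_commute: "vC i j = vC j i"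
  by (simp add: vC_def add.commute)

lemma vertsI: "i < 6 \<Longrightarrow> vA i \<in> verts" "i < 6 \<Longrightarrow> vB i \<in> verts"
  "i \<noteq> j \<Longrightarrow> i < 6 \<Longrightarrow> j < 6 \<Longrightarrow> vC i j \<in> verts"
  by (auto simp: verts_def) (metis linorder_neqE_nat vC_commute)

lemma vertsE:
  assumes "l \<in> verts"
  obtains i where "i < 6" "l = vA i" | i j where "i < j" "j < 6" "l = vC i j"
    | i where "i < 6" "l = vB i"
  using assms by (auto simp: verts_def)

lemma ip_verts:
  assumes "i < 6" "j < 6"
  shows "ip (vA i) (vA j) = (if i = j then 4/3 else 1/3)"
    "ip (vA i) (vB j) = (if i = j then 1/3 else -2/3)"
    "ip (vB j) (vA i) = (if i = j then 1/3 else -2/3)"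
    "ip (vB i) (vB j) = (if i = j then 4/3 else 1/3)"
  using assms by (auto simp: v_defs ip_bilinear ip_tgen ip_tgen_6)

lemma ip_vC:
  assumes "i < 6" "j < 6" "i \<noteq> j" "k < 6"
  shows "ip (vA k) (vC i j) = (if k = i \<or> k = j then -2/3 else 1/3)"
    "ip (vC i j) (vA k) = (if k = i \<or> k = j then -2/3 else 1/3)"
    "ip (vB k) (vC i j) = (if k = i \<or> k = j then -2/3 else 1/3)"
    "ip (vC i j) (vB k) = (if k = i \<or> k = j then -2/3 else 1/3)"
  using assms by (auto simp: v_defs ip_bilinear ip_tgen ip_tgen_6)

lemma ip_vC_vC:
  assumes "i < 6" "j < 6" "i \<noteq> j" "k < 6" "m < 6" "k \<noteq> m"
  shows "ip (vC i j) (vC k m) = (if {i, j} = {k, m} then 4/3 else if {i, j} \<inter> {k, m} = {} then -2/3 else 1/3)"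
  using assms by (auto simp: v_defs ip_bilinear ip_tgen ip_tgen_6 doubleton_eq_iff)

lemma ip_vert_self: "l \<in> verts \<Longrightarrow> ip l l = 4/3"
  by (erule vertsE) (auto simp: ip_verts ip_vC_vC)

lemma ip_vert_cases:
  assumes "l \<in> verts" "m \<in> verts" "l \<noteq> m"
  shows "ip l m = 1/3 \<or> ip l m = -2/3"
  using assms(1,2)
  by (elim vertsE) (use assms(3) in \<open>auto simp: ip_verts ip_vC ip_vC_vC doubleton_eq_iff\<close>)

section \<open>Integrality of the pairing of the lattice with differences of vertices\<close>

lemma ip_tgen_vert:
  assumes "l \<in> verts" "i < 6"
  obtains n :: int where "ip (tgen i) l = of_int n - 1/3"
proof -
  have "\<exists>n::int. ip (tgen i) l = of_int n - 1/3"
    using assms(1)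
  proof (cases rule: vertsE)
    case (1 j)
    then show ?thesis using assms
      by (intro exI[of _ "if i = j then 0 else 1"]) (auto simp: v_defs ip_bilinear ip_tgen ip_tgen_6)
  next
    case (2 j k)
    then show ?thesis using assms
      by (intro exI[of _ "if i = j \<or> i = k then 1 else 0"]) (auto simp: v_defs ip_bilinear ip_tgen ip_tgen_6)
  next
    case (3 j)
    then show ?thesis using assms
      by (intro exI[of _ "if i = j then -1 else 0"]) (auto simp: v_defs ip_bilinear ip_tgen ip_tgen_6)
  qed
  then show ?thesis using that by blast
qed

lemma ip_tgen_6_vert:
  assumes "l \<in> verts"
  obtains n :: int where "ip (tgen 6) l = of_int n"
proof -
  have "ip (tgen 6) l \<in> \<int>"
    using assms by (cases rule: vertsE) (auto simp: v_defs ip_bilinear ip_tgen ip_tgen_6)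
  then show ?thesis using that by (elim Ints_cases) auto
qed

lemma Lat_induct_ip:
  assumes "v \<in> Lat" "\<And>i. i \<le> 6 \<Longrightarrow> ip (tgen i) w \<in> \<int>"
  shows "ip v w \<in> \<int>"
  using assms by (auto simp: Lat_def ip_sum_left ip_sc_left intro!: Ints_sum Ints_mult)

text \<open>A single vertex pairs with t_i only in Z - 1/3; the fraction is the same for all
  vertices and cancels in a difference. This makes l - n an admissible vector w for the
  substitutions below.\<close>

lemma ip_Lat_vert_diff:
  assumes "v \<in> Lat" "l \<in> verts" "m \<in> verts"
  shows "ip v (l - m) \<in> \<int>"
proof (rule Lat_induct_ip[OF assms(1)])
  fix i :: nat assume "i \<le> 6"
  then consider "i < 6" | "i = 6" by linarith
  then show "ip (tgen i) (l - m) \<in> \<int>"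
  proof cases
    case 1
    obtain n n' :: int where "ip (tgen i) l = of_int n - 1/3" "ip (tgen i) m = of_int n' - 1/3"
      using ip_tgen_vert assms 1 by metis
    then have "ip (tgen i) (l - m) = of_int (n - n')" by (simp add: ip_diff_right)
    then show ?thesis by (metis Ints_of_int)
  next
    case 2
    obtain n n' :: int where "ip (tgen i) l = of_int n" "ip (tgen i) m = of_int n'"
      using ip_tgen_6_vert assms 2 by metis
    then have "ip (tgen i) (l - m) = of_int (n - n')" by (simp add: ip_diff_right)
    then show ?thesis by (metis Ints_of_int)
  qed
qed

lemma Lat_tgen: "i \<le> 6 \<Longrightarrow> tgen i \<in> Lat"
  unfolding Lat_def
  by (rule CollectI, rule exI[of _ "\<lambda>j. if j = i then 1 else 0"])
    (simp add: if_distrib[of "\<lambda>c. sc c _"] if_distrib[of of_int] cong: if_cong)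

lemma Lat_add: "v \<in> Lat \<Longrightarrow> w \<in> Lat \<Longrightarrow> v + w \<in> Lat"
  unfolding Lat_def
proof clarify
  fix a b :: "nat \<Rightarrow> int"
  show "\<exists>c. (\<Sum>i = 0..6. sc (of_int (a i)) (tgen i)) + (\<Sum>i = 0..6. sc (of_int (b i)) (tgen i))
      = (\<Sum>i = 0..6. sc (of_int (c i)) (tgen i))"
    by (rule exI[of _ "\<lambda>i. a i + b i"]) (simp add: sum.distrib sc_plus_left)
qed

lemma Lat_uminus: "v \<in> Lat \<Longrightarrow> - v \<in> Lat"
  unfolding Lat_def
proof clarify
  fix a :: "nat \<Rightarrow> int"
  show "\<exists>c. - (\<Sum>i = 0..6. sc (of_int (a i)) (tgen i)) = (\<Sum>i = 0..6. sc (of_int (c i)) (tgen i))"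
    by (rule exI[of _ "\<lambda>i. - a i"]) (simp add: sum_negf sc_uminus_left)
qed

lemma Lat_diff: "v \<in> Lat \<Longrightarrow> w \<in> Lat \<Longrightarrow> v - w \<in> Lat"
  using Lat_add[OF _ Lat_uminus, of v w] by simp

lemma verts_Lat: "l \<in> verts \<Longrightarrow> l \<in> Lat"
  by (erule vertsE) (auto simp: v_defs intro!: Lat_add Lat_diff Lat_uminus Lat_tgen)

lemma ex_index_notin:
  assumes "length xs < 6" shows "\<exists>m<6::nat. m \<notin> set xs"
proof (rule ccontr)
  assume "\<not> ?thesis"
  then have "{..<6} \<subseteq> set xs" by auto
  from card_mono[OF finite_set this] card_length[of xs] assms show False by simp
qed

text \<open>A common neighbour n gives (l - m, l - n) = 4/3 - 1/3 - 1/3 + 1/3 = 1, so w = l - n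
  serves for the substitution that kills l - m. It exists because l and m involve at most four of
  the six indices, and only one if they are a_i and b_i, so a vertex can be built from the free
  ones.\<close>

lemma common_neighbour:
  assumes "l \<in> verts" "m \<in> verts" "ip l m = 1/3"
  obtains n where "n \<in> verts" "ip n l = 1/3" "ip n m = 1/3"
proof -
  have *: "\<exists>n\<in>verts. ip n (vA i) = 1/3 \<and> ip n (vA j) = 1/3" if "i < 6" "j < 6" for i j
  proof -
    obtain k where "k < 6" "k \<notin> {i, j}"
      using ex_index_notin[of "[i, j]"] by auto
    then show ?thesis using that by (intro bexI[of _ "vA k"]) (auto simp: ip_verts vertsI)
  qed
  have **: "\<exists>n\<in>verts. ip n (vB i) = 1/3 \<and> ip n (vB j) = 1/3" if "i < 6" "j < 6" for i j
  proof -
    obtain k where "k < 6" "k \<notin> {i, j}"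
      using ex_index_notin[of "[i, j]"] by auto
    then show ?thesis using that by (intro bexI[of _ "vB k"]) (auto simp: ip_verts vertsI)
  qed
  have AC: "\<exists>n\<in>verts. ip n (vA k) = 1/3 \<and> ip n (vC i j) = 1/3"
    if "i < 6" "j < 6" "i \<noteq> j" "k < 6" for i j k
  proof -
    obtain m where "m < 6" "m \<notin> {i, j, k}"
      using ex_index_notin[of "[i, j, k]"] by auto
    then show ?thesis using that by (intro bexI[of _ "vA m"]) (auto simp: ip_verts ip_vC vertsI)
  qed
  have BC: "\<exists>n\<in>verts. ip n (vB k) = 1/3 \<and> ip n (vC i j) = 1/3"
    if "i < 6" "j < 6" "i \<noteq> j" "k < 6" for i j k
  proof -
    obtain m where "m < 6" "m \<notin> {i, j, k}"
      using ex_index_notin[of "[i, j, k]"] by auto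
    then show ?thesis using that by (intro bexI[of _ "vB m"]) (auto simp: ip_verts ip_vC vertsI)
  qed
  have CC: "\<exists>n\<in>verts. ip n (vC i j) = 1/3 \<and> ip n (vC k m) = 1/3"
    if "i < 6" "j < 6" "i \<noteq> j" "k < 6" "m < 6" "k \<noteq> m" for i j k m
  proof -
    obtain n where "n < 6" "n \<notin> {i, j, k, m}"
      using ex_index_notin[of "[i, j, k, m]"] by auto
    then show ?thesis using that by (intro bexI[of _ "vA n"]) (auto simp: ip_verts ip_vC vertsI)
  qed
  have AB: "\<exists>n\<in>verts. ip n (vA i) = 1/3 \<and> ip n (vB i) = 1/3" if "i < 6" for i
  proof -
    obtain j where j: "j < 6" "j \<notin> {i}"
      using ex_index_notin[of "[i]"] by auto
    obtain k where "k < 6" "k \<notin> {i, j}"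
      using ex_index_notin[of "[i, j]"] by auto
    then show ?thesis using that j by (intro bexI[of _ "vC j k"]) (auto simp: ip_verts ip_vC vertsI)
  qed
  have "\<exists>n\<in>verts. ip n l = 1/3 \<and> ip n m = 1/3"
    using assms(1)
  proof (cases rule: vertsE)
    case (1 i)
    from assms(2) show ?thesis
    proof (cases rule: vertsE)
      case (3 j)
      then have "i = j" using 1 assms(3) by (auto simp: ip_verts split: if_splits)
      then show ?thesis using 1 3 AB by simp
    qed (use 1 * AC in auto)
  next
    case (2 i j)
    from assms(2) show ?thesis
      by (cases rule: vertsE) (use 2 AC[of i j] BC[of i j] CC[of i j] in \<open>auto simp: conj_commute\<close>)
  next
    case (3 i)
    from assms(2) show ?thesis
    proof (cases rule: vertsE)
      case (1 j)
      then have "i = j" using 3 assms(3) by (auto simp: ip_verts split: if_splits)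
      then show ?thesis using 1 3 AB by auto
    qed (use 3 ** BC in auto)
  qed
  then show ?thesis using that by blast
qed

section \<open>Linear forms and divisibility in the ring of polynomials on the lattice\<close>

lemma pconst_simps: "pconst (a + b) = pconst a + pconst b" "pconst (a * b) = pconst a * pconst b"
  "pconst 0 = 0" "pconst 1 = 1" "pconst (- a) = - pconst a" "pconst (a - b) = pconst a - pconst b"
  "pconst (of_int n) = of_int n"
  by (simp_all add: pconst_def single_add mult_single single_uminus single_diff)

lemma lin_add: "lin (v + w) = lin v + lin w"
  and lin_diff: "lin (v - w) = lin v - lin w"
  and lin_uminus: "lin (- v) = - lin v"
  and lin_sc: "lin (sc c v) = pconst c * lin v"
  by (simp_all add: lin_def pconst_simps sum.distrib sum_subtractf sum_negf sum_distrib_left algebra_simps)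

text \<open>As simp rules these eta-expand sums of vectors and make linearity lemmas inapplicable.\<close>

declare minus_apply [simp del] plus_fun_apply [simp del] uminus_apply [simp del]

lemma lin_zero: "lin 0 = 0"
  by (simp add: lin_def pconst_simps)

lemmas lin_linear = lin_add lin_diff lin_uminus lin_sc lin_zero

lemma single_eqD: "Poly_Mapping.single i (Suc 0) = Poly_Mapping.single j (Suc 0) \<Longrightarrow> i = j"
  by (metis keys_single nat.simps(3) singleton_inject)

lemma lookup_lin:
  assumes "k \<in> {1..8}"
  shows "Poly_Mapping.lookup (lin v) (Poly_Mapping.single k 1) = v k"
proof -
  have "Poly_Mapping.lookup (lin v) (Poly_Mapping.single k 1) =
      (\<Sum>j\<in>{1..8}. if j = k then v j else 0)"
    unfolding lin_def lookup_sum
    by (intro sum.cong refl) (auto simp: pconst_def pvar_def mult_single lookup_single when_def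
      dest: single_eqD)
  then show ?thesis using assms by simp
qed

text \<open>Vectors are functions on all naturals while \<open>lin\<close> sees only coordinates 1
  to 8, so injectivity of \<open>lin\<close> is expressed through the pairing and not as v =
  0.\<close>

lemma ip_eq_0_if_lin_eq_0: "lin v = 0 \<Longrightarrow> ip v w = 0"
  using lookup_lin[of _ v] by (simp add: ip_def)

lemma HBT_0: "0 \<in> HBT" and HBT_1: "1 \<in> HBT" and HBT_numeral: "numeral n \<in> HBT"
  using HBT.const[of 0] HBT.const[of 1] HBT.const[of "numeral n"] by simp_all

lemma HBT_uminus: "p \<in> HBT \<Longrightarrow> - p \<in> HBT"
  using HBT.mult[OF HBT.const[of "-1"], of p] by simp

lemma HBT_diff: "p \<in> HBT \<Longrightarrow> q \<in> HBT \<Longrightarrow> p - q \<in> HBT"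
  using HBT.add[OF _ HBT_uminus, of p q] by simp

lemma HBT_power: "p \<in> HBT \<Longrightarrow> p ^ n \<in> HBT"
  by (induction n) (auto intro: HBT_1 HBT.mult)

lemma HBT_sum: "(\<And>i. i \<in> A \<Longrightarrow> f i \<in> HBT) \<Longrightarrow> sum f A \<in> HBT"
  by (induction A rule: infinite_finite_induct) (auto intro: HBT_0 HBT.add)

lemma HBT_prod: "(\<And>i. i \<in> A \<Longrightarrow> f i \<in> HBT) \<Longrightarrow> prod f A \<in> HBT"
  by (induction A rule: infinite_finite_induct) (auto intro: HBT_1 HBT.mult)

lemmas HBT_intros = HBT_0 HBT_1 HBT_numeral HBT_uminus HBT_diff HBT_power HBT.add HBT.mult
  HBT_sum HBT_prod

section \<open>Substitution homomorphisms of the real polynomial ring\<close>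

definition monom_subst :: "(nat \<Rightarrow> pol) \<Rightarrow> (nat \<Rightarrow>\<^sub>0 nat) \<Rightarrow> pol" where
  "monom_subst s m = (\<Prod>k\<in>Poly_Mapping.keys m. s k ^ Poly_Mapping.lookup m k)"

definition psubst :: "(nat \<Rightarrow> pol) \<Rightarrow> pol \<Rightarrow> pol" where
  "psubst s p = (\<Sum>m\<in>Poly_Mapping.keys p. pconst (Poly_Mapping.lookup p m) * monom_subst s m)"

lemma monom_subst_superset:
  "finite A \<Longrightarrow> Poly_Mapping.keys m \<subseteq> A \<Longrightarrow> monom_subst s m = (\<Prod>k\<in>A. s k ^ Poly_Mapping.lookup m k)"
  unfolding monom_subst_def by (rule prod.mono_neutral_left) (auto simp: in_keys_iff)

lemma psubst_superset:
  "finite A \<Longrightarrow> Poly_Mapping.keys p \<subseteq> A \<Longrightarrow>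
    psubst s p = (\<Sum>m\<in>A. pconst (Poly_Mapping.lookup p m) * monom_subst s m)"
  unfolding psubst_def by (rule sum.mono_neutral_left) (auto simp: in_keys_iff pconst_simps)

lemma monom_subst_add: "monom_subst s (m + n) = monom_subst s m * monom_subst s n"
proof -
  let ?A = "Poly_Mapping.keys m \<union> Poly_Mapping.keys n"
  have "Poly_Mapping.keys (m + n) \<subseteq> ?A" by (rule Poly_Mapping.keys_add)
  then show ?thesis
    by (simp add: monom_subst_superset[of ?A] lookup_add power_add prod.distrib)
qed

lemma psubst_add: "psubst s (p + q) = psubst s p + psubst s q"
proof -
  let ?A = "Poly_Mapping.keys p \<union> Poly_Mapping.keys q"
  have "Poly_Mapping.keys (p + q) \<subseteq> ?A" by (rule Poly_Mapping.keys_add)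
  then show ?thesis
    by (simp add: psubst_superset[of ?A] lookup_add pconst_simps distrib_right sum.distrib)
qed

lemma psubst_zero: "psubst s 0 = 0"
  by (simp add: psubst_def)

lemma psubst_sum: "psubst s (sum f A) = (\<Sum>i\<in>A. psubst s (f i))"
  by (induction A rule: infinite_finite_induct) (simp_all add: psubst_add psubst_zero)

lemma psubst_single: "psubst s (Poly_Mapping.single m c) = pconst c * monom_subst s m"
  by (simp add: psubst_def pconst_simps)

lemma pol_expand: "p = (\<Sum>m\<in>Poly_Mapping.keys p. Poly_Mapping.single m (Poly_Mapping.lookup p m))"
  for p :: pol
  by (rule poly_mapping_eqI) (simp add: lookup_sum lookup_single when_def in_keys_iff)

lemma psubst_mult: "psubst s (p * q) = psubst s p * psubst s q"
proof -
  have "psubst s (p * q) = (\<Sum>m\<in>Poly_Mapping.keys p. \<Sum>n\<in>Poly_Mapping.keys q.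
      pconst (Poly_Mapping.lookup p m * Poly_Mapping.lookup q n) * monom_subst s (m + n))"
    by (subst pol_expand[of p], subst pol_expand[of q])
      (simp add: sum_product mult_single psubst_sum psubst_single)
  also have "\<dots> = psubst s p * psubst s q"
    by (simp add: psubst_def sum_product pconst_simps monom_subst_add mult_ac)
  finally show ?thesis .
qed

lemma psubst_const: "psubst s (pconst c) = pconst c"
  by (simp add: pconst_def[of c] psubst_single monom_subst_def)

lemma psubst_pvar: "psubst s (pvar k) = s k"
  by (simp add: pvar_def psubst_single monom_subst_def pconst_simps)

lemma psubst_lin: "psubst s (lin v) = (\<Sum>k\<in>{1..8}. pconst (v k) * s k)"
  by (simp add: lin_def psubst_sum psubst_mult psubst_const psubst_pvar)

text \<open>The substitution v \<mapsto> v - (v, w) a. If w pairs integrally with the lattice and (a, w) = 1, it is an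
  endomorphism of HBT with kernel (a); this replaces unique factorisation.\<close>

definition proj :: "vec \<Rightarrow> vec \<Rightarrow> pol \<Rightarrow> pol" where
  "proj a w = psubst (\<lambda>k. pvar k - pconst (w k) * lin a)"

lemma proj_add: "proj a w (p + q) = proj a w p + proj a w q"
  and proj_mult: "proj a w (p * q) = proj a w p * proj a w q"
  by (simp_all add: proj_def psubst_add psubst_mult)

lemma proj_of_int: "proj a w (of_int n) = of_int n"
  unfolding proj_def by (metis pconst_simps(7) psubst_const)

lemma proj_lin: "proj a w (lin v) = lin v - pconst (ip v w) * lin a"
proof -
  have *: "pconst (ip v w) = (\<Sum>k\<in>{1..8}. pconst (v k) * pconst (w k))"
    unfolding ip_def pconst_simps(2)[symmetric]
    by (simp add: pconst_simps(1) eval_nat_numeral)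
  show ?thesis
    unfolding proj_def psubst_lin * by (simp add: lin_def[of v] algebra_simps sum_subtractf sum_distrib_left)
qed

text \<open>Induction over \<open>HBT\<close>: a generator changes by an integer multiple of
  \<open>lin a\<close> since w is integral on the lattice, and a product by p q - p' q' = (p - p') q
  + p' (q - q'). Hence an element of \<open>HBT\<close> killed by \<open>proj a w\<close> is
  \<open>lin a\<close> times an element of \<open>HBT\<close>, not merely times a real
  polynomial.\<close>

lemma HBT_minus_proj:
  assumes "a \<in> Lat" "\<And>v. v \<in> Lat \<Longrightarrow> ip v w \<in> \<int>" "p \<in> HBT"
  shows "proj a w p \<in> HBT \<and> (\<exists>q\<in>HBT. p - proj a w p = lin a * q)"
  using assms(3)
proof induction
  case (gen v)
  obtain n :: int where n: "ip v w = of_int n" using assms(2)[OF gen] by (elim Ints_cases)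
  then have "proj a w (lin v) = lin v - of_int n * lin a" by (simp add: proj_lin pconst_simps)
  then show ?case using gen assms(1)
    by (auto intro!: HBT_intros HBT.gen HBT.const bexI[of _ "of_int n"] simp: mult.commute)
next
  case (const n)
  then show ?case by (auto simp: proj_of_int intro!: HBT.const bexI[of _ 0] HBT_0)
next
  case (add p q)
  then obtain p' q' where "p' \<in> HBT" "q' \<in> HBT" "p - proj a w p = lin a * p'" "q - proj a w q = lin a * q'"
    by blast
  then have "(p + q) - proj a w (p + q) = lin a * (p' + q')"
    unfolding proj_add by (simp add: algebra_simps)
  then show ?case using add \<open>p' \<in> HBT\<close> \<open>q' \<in> HBT\<close> unfolding proj_add by (auto intro!: HBT_intros)
next
  case (mult p q)
  then obtain p' q' where *: "p' \<in> HBT" "q' \<in> HBT" "p - proj a w p = lin a * p'" "q - proj a w q = lin a * q'"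
    by blast
  have "(p * q) - proj a w (p * q) = (p - proj a w p) * q + proj a w p * (q - proj a w q)"
    unfolding proj_mult by (simp add: algebra_simps)
  also have "\<dots> = lin a * (p' * q + proj a w p * q')"
    unfolding * by (simp add: algebra_simps)
  finally show ?case using mult * unfolding proj_mult by (auto intro!: HBT_intros)
qed

lemma proj_lin_mult: "ip a w = 1 \<Longrightarrow> proj a w (lin a * g) = 0"
  by (simp add: proj_mult proj_lin pconst_simps)

text \<open>Applying \<open>proj a w\<close> kills the right-hand side, while the image of
  \<open>lin b\<close> is nonzero because b is not proportional to a; the ring being a domain, h is
  killed. Here g is an arbitrary real polynomial, yet the quotient q is integral.\<close>

lemma HBT_dvd_cancel:
  assumes "a \<in> Lat" "\<And>v. v \<in> Lat \<Longrightarrow> ip v w \<in> \<int>" "ip a w = 1"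
    and "h \<in> HBT" "lin b * h = lin a * g" and "\<And>c. lin b \<noteq> pconst c * lin a"
  obtains q where "q \<in> HBT" "h = lin a * q"
proof -
  have "proj a w (lin b) * proj a w h = 0"
    using arg_cong[OF assms(5), of "proj a w"]
    by (simp add: proj_lin_mult[OF assms(3)] proj_mult[of a w "lin b"])
  moreover have "proj a w (lin b) \<noteq> 0" using assms(6) by (simp add: proj_lin)
  ultimately have "proj a w h = 0" by simp
  then show ?thesis using HBT_minus_proj[OF assms(1,2,4)] that by auto
qed

text \<open>The roots l - m are pairwise non-proportional primes in effect: if p is already
  divisible by the product over D and also by \<open>lin (l - m)\<close>, the factors of D can be
  cancelled one by one against \<open>lin (l - m)\<close>.\<close>

lemma neighbour_prod_dvd:
  assumes "l \<in> verts" "finite D" "D \<subseteq> verts" "\<And>m. m \<in> D \<Longrightarrow> ip l m = 1/3"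
    and "p \<in> HBT" "\<And>m. m \<in> D \<Longrightarrow> \<exists>g\<in>HBT. p = lin (l - m) * g"
  shows "\<exists>q\<in>HBT. p = (\<Prod>m\<in>D. lin (l - m)) * q"
  using assms(2,3,4,6)
proof (induction D)
  case empty
  then show ?case using assms(5) by auto
next
  case (insert m D)
  have m: "m \<in> verts" "ip l m = 1/3" using insert.prems by auto
  obtain n where n: "n \<in> verts" "ip n l = 1/3" "ip n m = 1/3"
    using common_neighbour[OF assms(1) m] by blast
  have w1: "ip (l - m) (l - n) = 1"
    using m n assms(1) ip_vert_self[of l] ip_commute[of l n] ip_commute[of m n] ip_commute[of l m]
    by (simp add: ip_bilinear)
  have wZ: "ip v (l - n) \<in> \<int>" if "v \<in> Lat" for v
    using ip_Lat_vert_diff that assms(1) n by blast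
  have aL: "l - m \<in> Lat" using assms(1) m verts_Lat Lat_diff by blast
  \<comment> \<open>Stated for subsets D' of D and arbitrary h, so that an inner induction strips
    one factor at a time.\<close>
  have cancel: "\<exists>q\<in>HBT. h = lin (l - m) * q"
    if "finite D'" "D' \<subseteq> D" "h \<in> HBT" "(\<Prod>k\<in>D'. lin (l - k)) * h = lin (l - m) * g" for D' h g
    using that
  proof (induction D' arbitrary: h)
    case empty
    then have "h = lin (l - m) * g" by (simp only: prod.empty mult_1_left)
    then have "proj (l - m) (l - n) h = 0" using proj_lin_mult[OF w1] by (simp only:)
    then show ?case using HBT_minus_proj[OF aL wZ \<open>h \<in> HBT\<close>] by auto
  next
    case (insert k D')
    have k: "k \<in> verts" "ip l k = 1/3" "k \<noteq> m"
      using insert.prems \<open>m \<notin> D\<close> \<open>insert m D \<subseteq> verts\<close> \<open>\<And>k. k \<in> insert m D \<Longrightarrow> ip l k = 1/3\<close> by auto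
    \<comment> \<open>Both differences have norm 2, so proportionality forces c = 1 or c = -1, that
      is (k, m) = 4/3 or -8/3; distinct vertices only allow 1/3 and -2/3.\<close>
    have np: "lin (l - k) \<noteq> pconst c * lin (l - m)" for c
    proof
      assume "lin (l - k) = pconst c * lin (l - m)"
      then have z: "lin (l - k - sc c (l - m)) = 0" by (simp only: lin_diff[of "l - k"] lin_sc) simp
      have km: "ip k m = 1/3 \<or> ip k m = -2/3" using k m by (intro ip_vert_cases) auto
      have e: "ip (l - k) (l - m) = 2/3 + ip k m" "ip (l - m) (l - m) = 2" "ip (l - k) (l - k) = 2"
        using k m assms(1) ip_vert_self[of k] ip_vert_self[of l] ip_vert_self[of m] ip_commute[of l m] ip_commute[of l k] ip_commute[of k m]
        by (auto simp: ip_bilinear)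
      have "ip (l - k) (l - m) = c * 2" "ip (l - k) (l - k) = c * ip (l - k) (l - m)"
        using ip_eq_0_if_lin_eq_0[OF z, of "l - m"] ip_eq_0_if_lin_eq_0[OF z, of "l - k"] e(2)
          ip_commute[of "l - m" "l - k"]
        by (simp_all add: ip_diff_left[of "l - k"] ip_sc_left)
      then have "c = 1 \<or> c = -1" "ip k m = 2 * c - 2/3"
        using e by (simp_all, algebra)
      then show False using km by auto
    qed
    have kL: "l - k \<in> Lat" using assms(1) k verts_Lat Lat_diff by blast
    have "\<exists>q\<in>HBT. lin (l - k) * h = lin (l - m) * q"
      by (rule insert.IH) (use insert HBT.gen[OF kL] in \<open>auto intro: HBT.mult simp: mult_ac\<close>)
    then obtain q where "lin (l - k) * h = lin (l - m) * q" by blast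
    then show ?case
      using HBT_dvd_cancel[OF aL wZ w1 _ _ np] insert.prems by blast
  qed
  obtain q where q: "q \<in> HBT" "p = (\<Prod>m\<in>D. lin (l - m)) * q"
    using insert by auto
  obtain g where g: "p = lin (l - m) * g" using insert.prems by auto
  obtain q' where "q' \<in> HBT" "q = lin (l - m) * q'"
    using cancel[of D q g] q g insert.hyps by auto
  then show ?case using q insert.hyps by (auto simp: mult_ac)
qed

section \<open>Vertices and edges of the graph\<close>

lemma tbar_eq: "tbar = vA 0"
  by (rule ext) (simp add: tbar_def vA_def minus_apply tgen_apply tgen_6_apply)

text \<open>All simple roots but alpha_2 form the A_5 chain of the differences t_{j+1} - t_j, so
  their reflections permute the six indices. Only the branch node alpha_2 mixes the families a, b,
  c.\<close>

lemma sroot_eq: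
  "sroot 1 = tgen 1 - tgen 0" "sroot 3 = tgen 2 - tgen 1" "sroot 4 = tgen 3 - tgen 2"
  "sroot 5 = tgen 4 - tgen 3" "sroot 6 = tgen 5 - tgen 4" "sroot 2 = tgen 0 + tgen 1 + tgen 2 - tgen 6"
  by (rule ext; auto simp: sroot_def minus_apply plus_fun_apply tgen_apply tgen_6_apply eb_def Svec_apply
      EE_apply)+

lemma Lambda_step:
  assumes "l \<in> Lambda" "i \<in> {1..6}"
  shows "wrefl (sroot i) l \<in> Lambda"
proof -
  obtain w where "w \<in> WE6" "l = w tbar" using assms(1) unfolding Lambda_def by (elim imageE)
  then have "wrefl (sroot i) l = (wrefl (sroot i) \<circ> w) tbar" "wrefl (sroot i) \<circ> w \<in> WE6"
    using assms(2) by (simp_all only: o_apply WE6.step)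
  then show ?thesis unfolding Lambda_def by (rule image_eqI)
qed

lemma tbar_Lambda: "tbar \<in> Lambda"
  unfolding Lambda_def by (rule image_eqI[where x = id]) (simp_all add: WE6.id)

lemma Lambda_subset:
  assumes "tbar \<in> A" "\<And>l i. l \<in> A \<Longrightarrow> i \<in> {1..6} \<Longrightarrow> wrefl (sroot i) l \<in> A"
  shows "Lambda \<subseteq> A"
proof -
  have "w tbar \<in> A" if "w \<in> WE6" for w
    using that by induction (simp_all add: assms)
  then show ?thesis by (auto simp: Lambda_def)
qed

definition swap_index :: "nat \<Rightarrow> nat \<Rightarrow> nat \<Rightarrow> nat" where
  "swap_index p q i = (if i = p then q else if i = q then p else i)"

lemma wrefl_add: "wrefl a (u + v) = wrefl a u + wrefl a v"
  by (simp add: fun_eq_iff wrefl_def ip_add_left plus_fun_apply minus_apply add_divide_distrib distrib_right distrib_left)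

lemma wrefl_uminus: "wrefl a (- v) = - wrefl a v"
  by (simp add: fun_eq_iff wrefl_def ip_minus_left uminus_apply minus_apply)

lemma wrefl_diff: "wrefl a (u - v) = wrefl a u - wrefl a v"
  using wrefl_add[of a u "- v"] by (simp add: wrefl_uminus)

lemma wrefl_tgen_diff:
  assumes "p < 6" "q < 6" "p \<noteq> q"
  shows "wrefl (tgen q - tgen p) (tgen 6) = tgen 6"
    and "i < 6 \<Longrightarrow> wrefl (tgen q - tgen p) (tgen i) = tgen (swap_index p q i)"
proof -
  have n: "ip (tgen q - tgen p) (tgen q - tgen p) = 2"
    using assms by (simp add: ip_bilinear ip_tgen)
  have w: "wrefl (tgen q - tgen p) v = v - sc (ip v (tgen q) - ip v (tgen p)) (tgen q - tgen p)" for v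
    unfolding wrefl_def n ip_diff_right[of v] by (simp only: nonzero_mult_div_cancel_left)
  show "wrefl (tgen q - tgen p) (tgen 6) = tgen 6"
    using assms unfolding w by (simp add: ip_tgen_6)
  show "wrefl (tgen q - tgen p) (tgen i) = tgen (swap_index p q i)" if "i < 6"
    using assms that unfolding w by (simp add: ip_tgen swap_index_def sc_uminus_left)
qed

lemma wrefl_swap:
  assumes "p < 6" "q < 6" "p \<noteq> q"
  shows "i < 6 \<Longrightarrow> wrefl (tgen q - tgen p) (vA i) = vA (swap_index p q i)"
    and "i < 6 \<Longrightarrow> wrefl (tgen q - tgen p) (vB i) = vB (swap_index p q i)"
    and "i < 6 \<Longrightarrow> j < 6 \<Longrightarrow> wrefl (tgen q - tgen p) (vC i j) = vC (swap_index p q i) (swap_index p q j)"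
  by (simp_all only: v_defs wrefl_add[of "tgen q - tgen p"] wrefl_diff[of "tgen q - tgen p"]
      wrefl_uminus[of "tgen q - tgen p"] wrefl_tgen_diff[OF assms])

lemma swap_index_less: "p < 6 \<Longrightarrow> q < 6 \<Longrightarrow> i < 6 \<Longrightarrow> swap_index p q i < 6"
  and swap_index_eq_iff: "swap_index p q i = swap_index p q j \<longleftrightarrow> i = j"
  by (auto simp: swap_index_def)

lemma wrefl_swap_verts:
  assumes "p < 6" "q < 6" "p \<noteq> q" "l \<in> verts"
  shows "wrefl (tgen q - tgen p) l \<in> verts"
  using assms(4)
proof (cases rule: vertsE)
  case (1 i)
  then show ?thesis using assms(1-3) by (simp add: wrefl_swap vertsI swap_index_less)
next
  case (2 i j)
  then have "i \<noteq> j" "i < 6" "j < 6" by auto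
  then show ?thesis unfolding \<open>l = vC i j\<close> using assms(1-3)
    by (simp add: wrefl_swap vertsI swap_index_less swap_index_eq_iff)
next
  case (3 i)
  then show ?thesis using assms(1-3) by (simp add: wrefl_swap vertsI swap_index_less)
qed

text \<open>The A_5 chain skips alpha_2 in the numbering: position 0 is alpha_1, position j >= 1 is
  alpha_{j+2}.\<close>

lemma sroot_tgen_Suc:
  assumes "j < 5"
  shows "sroot (if j = 0 then 1 else j + 2) = tgen (Suc j) - tgen j"
proof (cases "j = 0")
  case True
  then show ?thesis using sroot_eq(1) by (simp only: One_nat_def if_True refl)
next
  case False
  then have "sroot (j + 2) k = (tgen (Suc j) - tgen j) k" for k
    using assms by (simp add: sroot_def tgen_apply minus_apply eb_def)
  then show ?thesis using False by auto
qed

lemma tgen_6_triple: "tgen 6 + tgen 6 + tgen 6 = tgen 0 + tgen 1 + tgen 2 + tgen 3 + tgen 4 + tgen 5"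
  unfolding tgen_relation by (rule ext) (simp add: plus_fun_apply)

lemma tgen_5_eq: "tgen 5 = tgen 6 + tgen 6 + tgen 6 - tgen 0 - tgen 1 - tgen 2 - tgen 3 - tgen 4"
  unfolding tgen_6_triple by simp

text \<open>The root a = t_0 + t_1 + t_2 - x splits the indices into two triples: its reflection
  subtracts a from x, t_0, t_1, t_2 and fixes t_3, t_4, t_5.\<close>

lemma wrefl_sroot_2:
  "wrefl (sroot 2) (vA 0) = vA 0" "wrefl (sroot 2) (vA 1) = vA 1" "wrefl (sroot 2) (vA 2) = vA 2"
  "wrefl (sroot 2) (vA 3) = vC 4 5" "wrefl (sroot 2) (vA 4) = vC 3 5" "wrefl (sroot 2) (vA 5) = vC 3 4"
  "wrefl (sroot 2) (vB 0) = vC 1 2" "wrefl (sroot 2) (vB 1) = vC 0 2" "wrefl (sroot 2) (vB 2) = vC 0 1"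
  "wrefl (sroot 2) (vB 3) = vB 3" "wrefl (sroot 2) (vB 4) = vB 4" "wrefl (sroot 2) (vB 5) = vB 5"
  "wrefl (sroot 2) (vC 1 2) = vB 0" "wrefl (sroot 2) (vC 0 2) = vB 1" "wrefl (sroot 2) (vC 0 1) = vB 2"
  "wrefl (sroot 2) (vC 4 5) = vA 3" "wrefl (sroot 2) (vC 3 5) = vA 4" "wrefl (sroot 2) (vC 3 4) = vA 5"
  "i < 3 \<Longrightarrow> 3 \<le> j \<Longrightarrow> j < 6 \<Longrightarrow> wrefl (sroot 2) (vC i j) = vC i j"
proof -
  let ?a = "tgen 0 + tgen 1 + tgen 2 - tgen 6"
  have t: "ip (tgen i) ?a = (if i < 3 then 1 else 0)" if "i < 6" for i
    using that by (auto simp: ip_bilinear ip_tgen ip_tgen_6 less_6_cases)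
  have x: "ip (tgen 6) ?a = 1" by (simp add: ip_bilinear ip_tgen ip_tgen_6)
  have n: "ip ?a ?a = 2" by (simp only: ip_diff_left[of _ _ ?a] ip_add_left[of _ _ ?a] t x) simp
  have wt: "wrefl ?a (tgen i) = (if i < 3 then tgen i - ?a else tgen i)" if "i < 6" for i
    unfolding wrefl_def n t[OF that] by simp
  have wx: "wrefl ?a (tgen 6) = tgen 6 - ?a"
    unfolding wrefl_def n x by simp
  note w = sroot_eq(6) v_defs wrefl_add[of ?a] wrefl_diff[of ?a] wrefl_uminus[of ?a] wx
  show "wrefl (sroot 2) (vA 0) = vA 0" "wrefl (sroot 2) (vA 1) = vA 1" "wrefl (sroot 2) (vA 2) = vA 2"
    "wrefl (sroot 2) (vB 3) = vB 3" "wrefl (sroot 2) (vB 4) = vB 4" "wrefl (sroot 2) (vB 5) = vB 5"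
    "i < 3 \<Longrightarrow> 3 \<le> j \<Longrightarrow> j < 6 \<Longrightarrow> wrefl (sroot 2) (vC i j) = vC i j"
    unfolding w by (simp_all add: wt del: One_nat_def)
  show "wrefl (sroot 2) (vB 0) = vC 1 2" "wrefl (sroot 2) (vB 1) = vC 0 2" "wrefl (sroot 2) (vB 2) = vC 0 1"
    "wrefl (sroot 2) (vC 1 2) = vB 0" "wrefl (sroot 2) (vC 0 2) = vB 1" "wrefl (sroot 2) (vC 0 1) = vB 2"
    unfolding w by (simp_all add: wt del: One_nat_def)
  \<comment> \<open>These cases leave an expression in the wrong triple of indices; eliminating t_5
    by 3x = t_0 + ... + t_5 identifies both sides.\<close>
  show "wrefl (sroot 2) (vA 3) = vC 4 5" "wrefl (sroot 2) (vA 4) = vC 3 5" "wrefl (sroot 2) (vA 5) = vC 3 4"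
    "wrefl (sroot 2) (vC 4 5) = vA 3" "wrefl (sroot 2) (vC 3 5) = vA 4" "wrefl (sroot 2) (vC 3 4) = vA 5"
    unfolding w by (simp_all add: wt del: One_nat_def) (simp_all add: tgen_5_eq del: One_nat_def)
qed

text \<open>The simple reflections map \<open>verts\<close> into itself. Conversely the A_5
  reflections carry a_0 to every a_i, alpha_2 sends a_3 to c_45, lowering indices reaches every
  c_ij, alpha_2 sends c_12 to b_0, and raising the index gives every b_i.\<close>

lemma Lambda_eq: "Lambda = verts"
proof
  show "Lambda \<subseteq> verts"
  proof (rule Lambda_subset)
    show "tbar \<in> verts" by (simp add: tbar_eq vertsI)
    fix l i assume l: "l \<in> verts" and "i \<in> {1..6::nat}"
    then have "i = 1 \<or> i = 2 \<or> i = 3 \<or> i = 4 \<or> i = 5 \<or> i = 6" by auto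
    moreover have "wrefl (sroot 2) l \<in> verts" using l
    proof (cases rule: vertsE)
      case (2 i j)
      then have "(i < 3 \<and> 3 \<le> j) \<or> i = 0 \<and> j = 1 \<or> i = 0 \<and> j = 2 \<or> i = 1 \<and> j = 2 \<or> i = 3 \<and> j = 4
        \<or> i = 3 \<and> j = 5 \<or> i = 4 \<and> j = 5" by auto
      then show ?thesis using 2
        by (elim disjE conjE) (simp_all add: wrefl_sroot_2 vertsI del: One_nat_def)
    next
      case (1 i)
      then show ?thesis unfolding less_6_cases
        by (elim disjE) (simp_all add: wrefl_sroot_2 vertsI del: One_nat_def)
    next
      case (3 i)
      then show ?thesis unfolding less_6_cases
        by (elim disjE) (simp_all add: wrefl_sroot_2 vertsI del: One_nat_def)
    qed
    ultimately show "wrefl (sroot i) l \<in> verts"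
      by (elim disjE) (simp_all add: sroot_eq wrefl_swap_verts l del: One_nat_def)
  qed
next
  have up: "wrefl (tgen (Suc i) - tgen i) l \<in> Lambda" if "l \<in> Lambda" "i < 5" for l i
  proof -
    have "(if i = 0 then 1 else i + 2) \<in> {1..6}" using that by auto
    from Lambda_step[OF that(1) this] show ?thesis unfolding sroot_tgen_Suc[OF that(2)] .
  qed
  have A: "vA i \<in> Lambda" if "i < 6" for i
    using that
  proof (induction i)
    case 0
    then show ?case using tbar_Lambda by (simp add: tbar_eq)
  next
    case (Suc i)
    then show ?case using up[of "vA i" i] by (simp add: wrefl_swap swap_index_def)
  qed
  have B0: "vB 0 \<in> Lambda" if "vC 1 2 \<in> Lambda"
    using Lambda_step[OF that, of 2] by (simp add: wrefl_sroot_2 del: One_nat_def)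
  have B: "vB i \<in> Lambda" if "i < 6" "vB 0 \<in> Lambda" for i
    using that
  proof (induction i)
    case (Suc i)
    then show ?case using up[of "vB i" i] by (simp add: wrefl_swap swap_index_def)
  qed
  have C45: "vC 4 5 \<in> Lambda"
    using Lambda_step[OF A[of 3], of 2] by (simp add: wrefl_sroot_2)
  have C5: "vC i 5 \<in> Lambda" if "i < 5" for i
    using that
  proof (induction "4 - i" arbitrary: i)
    case 0
    then have "i = 4" by simp
    then show ?case using C45 by simp
  next
    case (Suc n)
    then have "i < 4" "n = 4 - Suc i" by auto
    then show ?case using Suc(1)[of "Suc i"] up[of "vC (Suc i) 5" i] by (simp add: wrefl_swap swap_index_def)
  qed
  have C: "vC i j \<in> Lambda" if "i < j" "j < 6" for i j
    using that
  proof (induction "5 - j" arbitrary: j)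
    case 0
    then have "j = 5" by simp
    then show ?case using C5 0 by simp
  next
    case (Suc n)
    then have "j < 5" "n = 5 - Suc j" by auto
    then show ?case using Suc up[of "vC i (Suc j)" j] by (simp add: wrefl_swap swap_index_def)
  qed
  show "verts \<subseteq> Lambda"
    using A B B0 C by (auto elim!: vertsE)
qed

section \<open>Positive roots and the edges of the graph\<close>

text \<open>The positivity half of \<open>PosRoots\<close>, separated from membership in
  \<open>Phi\<close> because it is closed under addition.\<close>

definition pcone :: "vec set" where
  "pcone = {a. \<exists>c :: nat \<Rightarrow> nat. a = (\<Sum>i\<in>{1..6}. sc (real (c i)) (sroot i))}"

lemma pcone_add: "v \<in> pcone \<Longrightarrow> w \<in> pcone \<Longrightarrow> v + w \<in> pcone"
  unfolding pcone_def
proof clarify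
  fix a b :: "nat \<Rightarrow> nat"
  show "\<exists>c. (\<Sum>i = 1..6. sc (real (a i)) (sroot i)) + (\<Sum>i = 1..6. sc (real (b i)) (sroot i))
      = (\<Sum>i = 1..6. sc (real (c i)) (sroot i))"
    by (rule exI[of _ "\<lambda>i. a i + b i"]) (simp add: sum.distrib sc_plus_left)
qed

lemma pcone_0: "0 \<in> pcone"
  unfolding pcone_def by (rule CollectI, rule exI[of _ "\<lambda>_. 0"]) simp

lemma pcone_sroot: "i \<in> {1..6} \<Longrightarrow> sroot i \<in> pcone"
  unfolding pcone_def
  by (rule CollectI, rule exI[of _ "\<lambda>j. if j = i then 1 else 0"])
    (simp add: if_distrib[of "\<lambda>c. sc c _"] if_distrib[of real] cong: if_cong)

lemma pcone_tgen_diff: "i \<le> j \<Longrightarrow> j < 6 \<Longrightarrow> tgen j - tgen i \<in> pcone"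
proof (induction j)
  case (Suc j)
  show ?case
  proof (cases "i = Suc j")
    case False
    have j: "j < 5" "(if j = 0 then 1 else j + 2) \<in> {1..6}" using Suc by auto
    have "tgen (Suc j) - tgen j \<in> pcone"
      using pcone_sroot[OF j(2)] unfolding sroot_tgen_Suc[OF j(1)] .
    from pcone_add[OF this Suc.IH] Suc False show ?thesis by simp
  qed (use pcone_0 in \<open>simp add: zero_fun_def\<close>)
qed (use pcone_0 in \<open>simp add: zero_fun_def\<close>)

text \<open>From i < j < k follow i >= 0, j >= 1 and k >= 2, so the vector is alpha_2 plus the
  differences t_i - t_0, t_j - t_1, t_k - t_2.\<close>

lemma pcone_triple:
  assumes "i < j" "j < k" "k < 6"
  shows "tgen i + tgen j + tgen k - tgen 6 \<in> pcone"
proof -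
  have "tgen i + tgen j + tgen k - tgen 6 =
      ((sroot 2 + (tgen i - tgen 0)) + (tgen j - tgen 1)) + (tgen k - tgen 2)"
    by (simp add: sroot_eq(6) algebra_simps)
  moreover have "\<dots> \<in> pcone" using assms
    by (intro pcone_add pcone_tgen_diff pcone_sroot) auto
  ultimately show ?thesis by (simp only:)
qed

lemma pcone_tgen_6: "tgen 6 \<in> pcone"
proof -
  have "tgen 6 = (tgen 0 + tgen 1 + tgen 2 - tgen 6) + (tgen 3 + tgen 4 + tgen 5 - tgen 6)"
    by (simp add: tgen_5_eq algebra_simps)
  moreover have "\<dots> \<in> pcone" by (intro pcone_add pcone_triple) auto
  ultimately show ?thesis by (simp only:)
qed

lemma sum_mu: "(\<Sum>k\<in>{1..5}. sc (mu k) (eb k)) = 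
   sc (mu 1) (eb 1) + sc (mu 2) (eb 2) + sc (mu 3) (eb 3) + sc (mu 4) (eb 4) + sc (mu 5) (eb 5)"
  by (simp add: eval_nat_numeral)

lemma Phi_half:
  fixes mu :: "nat \<Rightarrow> real"
  assumes "\<And>k. k \<in> {1..5} \<Longrightarrow> mu k = 1 \<or> mu k = -1" "mu 1 * mu 2 * mu 3 * mu 4 * mu 5 = 1"
    "\<And>k. v k = (if k \<in> {1..5} then mu k / 2 else EE k / 2)"
  shows "v \<in> Phi"
proof -
  have "(\<Prod>k\<in>{1..5}. mu k) = 1" using assms(2) by (simp add: eval_nat_numeral)
  moreover have "v = sc (1/2) ((\<Sum>k\<in>{1..5}. sc (mu k) (eb k)) + EE)"
  proof
    fix k :: nat
    have "k \<in> {1..5} \<longleftrightarrow> k = 1 \<or> k = 2 \<or> k = 3 \<or> k = 4 \<or> k = 5" by auto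
    then show "v k = sc (1/2) ((\<Sum>k\<in>{1..5}. sc (mu k) (eb k)) + EE) k"
      unfolding sum_mu assms(3) by (auto simp: plus_fun_apply eb_def EE_apply)
  qed
  ultimately show ?thesis unfolding Phi_def using assms(1) by blast
qed

lemma Phi_tgen_diff: "i < j \<Longrightarrow> j < 6 \<Longrightarrow> tgen j - tgen i \<in> Phi"
proof (cases "i = 0")
  case False
  assume ij: "i < j" "j < 6"
  have "tgen j - tgen i = - (eb i - eb j)"
    by (rule ext) (use ij False in \<open>auto simp: minus_apply uminus_apply tgen_apply eb_def\<close>)
  then show ?thesis unfolding Phi_def using ij False
    by (intro UnI1 CollectI exI[of _ i] exI[of _ j]) auto
next
  case True
  assume ij: "i < j" "j < 6"
  then have j: "j = 1 \<or> j = 2 \<or> j = 3 \<or> j = 4 \<or> j = 5" by auto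
  \<comment> \<open>t_j - t_0 is the half-integral root with one plus sign, at j, and four minus
    signs.\<close>
  show ?thesis unfolding True
  proof (rule Phi_half[of "\<lambda>k. if k = j then 1 else -1"])
    show "(tgen j - tgen 0) k = (if k \<in> {1..5} then (if k = j then 1 else - 1) / 2 else EE k / 2)" for k
      using ij by (simp add: minus_apply tgen_apply Svec_apply EE_apply)
  qed (use j in auto)
qed

lemma Phi_tgen_6: "tgen 6 \<in> Phi"
  by (intro Phi_half[of "\<lambda>k. 1"])
    (simp_all add: tgen_6_apply Svec_apply EE_apply)

text \<open>For i = 0 the vector is e_j + e_k; otherwise it is the half-integral root with plus
  signs at i, j, k and two minus signs.\<close>

lemma Phi_triple:
  assumes "i < j" "j < k" "k < 6"
  shows "tgen i + tgen j + tgen k - tgen 6 \<in> Phi"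
proof (cases "i = 0")
  case True
  have "tgen i + tgen j + tgen k - tgen 6 = eb j + eb k"
    by (rule ext) (use assms True in \<open>auto simp: minus_apply plus_fun_apply tgen_apply tgen_6_apply eb_def\<close>)
  then show ?thesis unfolding Phi_def using assms True
    by (intro UnI1 CollectI exI[of _ j] exI[of _ k]) auto
next
  case False
  then have "i = 1 \<or> i = 2 \<or> i = 3" "j = 2 \<or> j = 3 \<or> j = 4" "k = 3 \<or> k = 4 \<or> k = 5"
    using assms by auto
  then show ?thesis
  proof (intro Phi_half[of "\<lambda>m. if m = i \<or> m = j \<or> m = k then 1 else -1"])
    show "(tgen i + tgen j + tgen k - tgen 6) m =
        (if m \<in> {1..5} then (if m = i \<or> m = j \<or> m = k then 1 else - 1) / 2 else EE m / 2)" for m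
      using assms False by (simp add: minus_apply plus_fun_apply tgen_apply tgen_6_apply Svec_apply EE_apply)
  qed (use assms in \<open>auto\<close>)
qed

lemma ip_eb: "i \<in> {1..8} \<Longrightarrow> ip (eb i) v = v i"
  by (simp add: ip_def eb_def if_distrib[of "\<lambda>x. x * _"] cong: if_cong)

lemma ip_Phi_self:
  assumes "a \<in> Phi" shows "ip a a = 2"
proof -
  have m: "ip (- v) (- v) = ip v v" for v by (simp add: ip_minus_left ip_minus_right)
  have e: "ip (eb i + eb j) (eb i + eb j) = 2" "ip (eb i - eb j) (eb i - eb j) = 2"
    if "1 \<le> i" "i < j" "j \<le> 5" for i j
    using that by (simp_all add: ip_add_left ip_diff_left ip_eb plus_fun_apply minus_apply, simp_all add: eb_def)
  have h: "ip (sc (1/2) ((\<Sum>k\<in>{1..5}. sc (mu k) (eb k)) + EE)) (sc (1/2) ((\<Sum>k\<in>{1..5}. sc (mu k) (eb k)) + EE)) = 2"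
    if "\<forall>k\<in>{1..5}. mu k = 1 \<or> mu k = -1" for mu :: "nat \<Rightarrow> real"
  proof -
    have "mu k * mu k = 1" if "k \<in> {1..5}" for k
      using \<open>\<forall>k\<in>{1..5}. mu k = 1 \<or> mu k = -1\<close> that by fastforce
    from this[of 1] this[of 2] this[of 3] this[of 4] this[of 5] show ?thesis
      unfolding sum_mu ip_expand
      by (simp add: eb_def plus_fun_apply EE_apply del: One_nat_def)
  qed
  from assms show ?thesis unfolding Phi_def
  proof
    assume "a \<in> {v. \<exists>i j. 1 \<le> i \<and> i < j \<and> j \<le> 5 \<and>
      (v = eb i + eb j \<or> v = eb i - eb j \<or> v = - (eb i + eb j) \<or> v = - (eb i - eb j))}"
    then obtain i j where ij: "1 \<le> i" "i < j" "j \<le> 5"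
      and "a = eb i + eb j \<or> a = eb i - eb j \<or> a = - (eb i + eb j) \<or> a = - (eb i - eb j)" by blast
    then show ?thesis using e[OF ij] m by (elim disjE) (simp_all only:)
  next
    assume "a \<in> {v. \<exists>mu :: nat \<Rightarrow> real. (\<forall>k\<in>{1..5}. mu k = 1 \<or> mu k = -1) \<and> (\<Prod>k\<in>{1..5}. mu k) = 1 \<and>
                (v = sc (1/2) ((\<Sum>k\<in>{1..5}. sc (mu k) (eb k)) + EE) \<or>
                 v = - sc (1/2) ((\<Sum>k\<in>{1..5}. sc (mu k) (eb k)) + EE))}"
    then obtain mu :: "nat \<Rightarrow> real" where mu: "\<forall>k\<in>{1..5}. mu k = 1 \<or> mu k = -1"
      and "a = sc (1/2) ((\<Sum>k\<in>{1..5}. sc (mu k) (eb k)) + EE) \<or>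
           a = - sc (1/2) ((\<Sum>k\<in>{1..5}. sc (mu k) (eb k)) + EE)" by blast
    then show ?thesis using h[OF mu] m by (elim disjE) (simp_all only:)
  qed
qed

lemma PosRoots_ip_int:
  assumes "a \<in> PosRoots" "v \<in> Lat"
  shows "ip v a \<in> \<int>"
proof -
  obtain c :: "nat \<Rightarrow> nat" where c: "a = (\<Sum>i\<in>{1..6}. sc (real (c i)) (sroot i))"
    using assms by (auto simp: PosRoots_def)
  have "ip v (sroot i) \<in> \<int>" if "i \<in> {1..6}" for i
  proof (rule Lat_induct_ip[OF assms(2)])
    fix j :: nat assume "j \<le> 6"
    moreover have "i = 1 \<or> i = 2 \<or> i = 3 \<or> i = 4 \<or> i = 5 \<or> i = 6" using that by auto
    ultimately show "ip (tgen j) (sroot i) \<in> \<int>"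
      by (cases "j = 6"; elim disjE)
        (simp_all add: sroot_eq ip_bilinear ip_tgen ip_tgen_6 del: One_nat_def)
  qed
  then have "ip (sroot i) v \<in> \<int>" if "i \<in> {1..6}" for i
    using that ip_commute by metis
  then have "ip a v \<in> \<int>" unfolding c ip_sum_left ip_sc_left
    by (intro Ints_sum Ints_mult) auto
  then show ?thesis using ip_commute by metis
qed

text \<open>With n = (l, a), an integer, m = l - n a and (l, m) = 4/3 - n^2. The possible inner
  products leave n^2 = 1 or n^2 = 2, and 2 is not a square.\<close>

lemma edge_imp_diff:
  assumes "l \<in> verts" "m \<in> verts" "a \<in> PosRoots" "l \<noteq> m" "wrefl a l = m"
  shows "ip l m = 1/3 \<and> (a = l - m \<or> a = m - l)"
proof -
  have aa: "ip a a = 2" using assms by (auto simp: PosRoots_def intro: ip_Phi_self)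
  obtain n :: int where n: "ip l a = of_int n"
    using PosRoots_ip_int[OF assms(3) verts_Lat[OF assms(1)]] by (elim Ints_cases)
  have m: "m = l - sc (of_int n) a" using assms(5) by (simp add: wrefl_def aa n)
  have "ip l m = 4/3 - of_int (n\<^sup>2)"
    unfolding m by (simp add: ip_bilinear ip_vert_self[OF assms(1)] n power2_eq_square)
  then have "of_int (n\<^sup>2) = (1::real) \<or> of_int (n\<^sup>2) = (2::real)"
    using ip_vert_cases[OF assms(1,2,4)] by linarith
  then have "n\<^sup>2 = 1 \<or> n\<^sup>2 = 2" by linarith
  moreover have "n\<^sup>2 \<noteq> 2"
  proof
    assume n2: "n\<^sup>2 = 2"
    have "\<bar>n\<bar> \<le> 1 \<or> \<bar>n\<bar> \<ge> 2" by linarith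
    then have "n\<^sup>2 \<le> 1 \<or> n\<^sup>2 \<ge> 4"
      using abs_le_square_iff[of n 1] abs_le_square_iff[of 2 n] by auto
    then show False using n2 by linarith
  qed
  ultimately have n1: "n\<^sup>2 = 1" by simp
  then have "n = 1 \<or> n = -1" by (simp add: power2_eq_1_iff)
  then have "a = l - m \<or> a = m - l" unfolding m by (auto simp: sc_uminus_left)
  then show ?thesis using n1 \<open>ip l m = 4/3 - of_int (n\<^sup>2)\<close> by simp
qed

lemma six_indices:
  assumes "distinct xs" "set xs \<subseteq> {..<6::nat}"
  obtains ys where "length ys = 6 - length xs" "distinct (xs @ ys)" "set (xs @ ys) = {..<6}"
proof -
  obtain ys where ys: "set ys = {..<6} - set xs" "distinct ys"
    using finite_distinct_list[of "{..<6} - set xs"] by auto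
  have "length ys = card ({..<6} - set xs)" using ys distinct_card by metis
  also have "\<dots> = 6 - length xs" using assms by (simp add: card_Diff_subset distinct_card)
  finally show ?thesis using that[of ys] ys assms by auto
qed

lemma sum_tgen: "(\<Sum>i<6. tgen i) = sc 3 (tgen 6)"
  using tgen_relation by (simp add: eval_nat_numeral)

lemma PosRoots_triple:
  assumes "i < 6" "j < 6" "k < 6" "distinct [i, j, k]"
  shows "tgen i + tgen j + tgen k - tgen 6 \<in> PosRoots"
proof -
  have *: "tgen i + tgen j + tgen k - tgen 6 \<in> PosRoots" if "i < j" "j < k" "k < 6" for i j k
    using Phi_triple[OF that] pcone_triple[OF that] by (simp add: PosRoots_def pcone_def)
  consider "i < j" "j < k" | "i < k" "k < j" | "j < i" "i < k" | "j < k" "k < i" | "k < i" "i < j" | "k < j" "j < i"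
    using assms by fastforce
  then show ?thesis
    using *[of i j k] *[of i k j] *[of j i k] *[of j k i] *[of k i j] *[of k j i] assms
    by cases (simp_all add: ac_simps)
qed

lemma PosRoots_tgen_6: "tgen 6 \<in> PosRoots"
  using Phi_tgen_6 pcone_tgen_6 by (simp add: PosRoots_def pcone_def)

lemma PosRoots_tgen_diff: "i < 6 \<Longrightarrow> j < 6 \<Longrightarrow> i \<noteq> j \<Longrightarrow> tgen i - tgen j \<in> PosRoots \<or> tgen j - tgen i \<in> PosRoots"
  using Phi_tgen_diff[of i j] pcone_tgen_diff[of i j] Phi_tgen_diff[of j i] pcone_tgen_diff[of j i]
  by (cases "i < j") (auto simp: PosRoots_def pcone_def)

text \<open>Since the six t_i sum to 3x, the root 2x - t_i - t_j - t_k of an edge from a_k to c_ij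
  is again of the form triple sum minus x, for the complementary triple.\<close>

lemma complement_triple:
  assumes "i < 6" "j < 6" "k < 6" "distinct [i, j, k]"
  obtains p q r where "p < 6" "q < 6" "r < 6" "distinct [i, j, k, p, q, r]" "{i, j, k, p, q, r} = {..<6}"
    "tgen 6 + tgen 6 - tgen i - tgen j - tgen k = tgen p + tgen q + tgen r - tgen 6"
proof -
  obtain ys where ys: "length ys = 6 - length [i, j, k]" "distinct ([i, j, k] @ ys)" "set ([i, j, k] @ ys) = {..<6}"
    using six_indices[of "[i, j, k]"] assms by auto
  then obtain p q r where pqr: "ys = [p, q, r]"
    by (auto simp: length_Suc_conv numeral_3_eq_3 eval_nat_numeral)
  have "sum tgen (set [i, j, k, p, q, r]) = sc 3 (tgen 6)"
    using ys pqr sum_tgen by simp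
  then have "tgen i + (tgen j + (tgen k + (tgen p + (tgen q + tgen r)))) = sc 3 (tgen 6)"
    using ys pqr by (subst (asm) sum.distinct_set_conv_list) auto
  also have "\<dots> = tgen 6 + tgen 6 + tgen 6" by (simp add: fun_eq_iff plus_fun_apply)
  finally have "tgen 6 + tgen 6 - tgen i - tgen j - tgen k = tgen p + tgen q + tgen r - tgen 6"
    by (simp add: algebra_simps)
  then show ?thesis using that[of p q r] ys pqr by auto
qed

text \<open>Up to sign the difference is t_i - t_j inside one family, x between a_i and b_i, a
  triple sum minus x between b and c, and the complementary triple form between a and c. All of
  these are roots, with one sign positive.\<close>

lemma edge_if_neighbour:
  assumes "l \<in> verts" "m \<in> verts" "ip l m = 1/3"
  obtains a where "a \<in> PosRoots" "wrefl a l = m" "a = l - m \<or> a = m - l"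
proof -
  have tri: "tgen i + tgen j + tgen k - tgen 6 \<in> PosRoots" 
    "tgen 6 + tgen 6 - tgen i - tgen j - tgen k \<in> PosRoots"
    if t: "i < 6" "j < 6" "k < 6" "distinct [i, j, k]" for i j k
  proof -
    show "tgen i + tgen j + tgen k - tgen 6 \<in> PosRoots" using PosRoots_triple[OF t] .
    obtain p q r where "p < 6" "q < 6" "r < 6" "distinct [i, j, k, p, q, r]"
      and e: "tgen 6 + tgen 6 - tgen i - tgen j - tgen k = tgen p + tgen q + tgen r - tgen 6"
      using complement_triple[OF t] by metis
    then show "tgen 6 + tgen 6 - tgen i - tgen j - tgen k \<in> PosRoots"
      unfolding e by (intro PosRoots_triple) auto
  qed
  have root: "l - m \<in> PosRoots \<or> m - l \<in> PosRoots"
    using assms(1)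
  proof (cases rule: vertsE)
    case (1 i)
    from assms(2) show ?thesis
    proof (cases rule: vertsE)
      case (1 j)
      then show ?thesis using \<open>i < 6\<close> \<open>l = vA i\<close> assms(3) PosRoots_tgen_diff[of i j]
        by (simp add: ip_verts split: if_splits) (simp add: v_defs, blast?)
    next
      case (2 j k)
      then show ?thesis using \<open>i < 6\<close> \<open>l = vA i\<close> assms(3) tri(2)[of j k i]
        by (simp add: ip_vC split: if_splits) (simp add: v_defs algebra_simps)
    next
      case (3 j)
      then show ?thesis using \<open>i < 6\<close> \<open>l = vA i\<close> assms(3) PosRoots_tgen_6
        by (simp add: ip_verts split: if_splits) (simp add: v_defs, blast?)
    qed
  next
    case ij: (2 i j)
    from assms(2) show ?thesis
    proof (cases rule: vertsE)
      case (1 k)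
      then show ?thesis using ij assms(3) tri(2)[of i j k]
        by (simp add: ip_vC split: if_splits) (simp add: v_defs algebra_simps)
    next
      case (2 k n)
      have "{i, j} \<noteq> {k, n}" "{i, j} \<inter> {k, n} \<noteq> {}"
        using ij 2 assms(3) by (auto simp: ip_vC_vC split: if_splits)
      then consider "i = k" "j \<noteq> n" | "i = n" "j \<noteq> k" | "j = k" "i \<noteq> n" | "j = n" "i \<noteq> k" by blast
      then show ?thesis using ij 2 PosRoots_tgen_diff
        by cases (auto simp: v_defs)
    next
      case (3 k)
      then show ?thesis using ij assms(3) tri(1)[of i j k]
        by (simp add: ip_vC split: if_splits) (simp add: v_defs algebra_simps)
    qed
  next
    case i: (3 i)
    from assms(2) show ?thesis
    proof (cases rule: vertsE)
      case (1 j)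
      then show ?thesis using i assms(3) PosRoots_tgen_6
        by (simp add: ip_verts split: if_splits) (simp add: v_defs, blast?)
    next
      case (2 j k)
      then show ?thesis using i assms(3) tri(1)[of j k i]
        by (simp add: ip_vC split: if_splits) (simp add: v_defs algebra_simps)
    next
      case (3 j)
      then show ?thesis using i assms(3) PosRoots_tgen_diff[of i j]
        by (simp add: ip_verts split: if_splits) (simp add: v_defs, blast?)
    qed
  qed
  \<comment> \<open>A root of norm 2 pairing to 1 with l reflects l to l - (l - m) = m.\<close>
  have "ip l (l - m) = 1" "ip (l - m) (l - m) = 2"
    using assms ip_vert_self[of l] ip_vert_self[of m] ip_commute[of l m] by (auto simp: ip_bilinear)
  then have "wrefl (l - m) l = m" "wrefl (m - l) l = m"
    using ip_minus_right[of l "l - m"] ip_minus_right[of "m - l" "l - m"] ip_minus_left[of "l - m" "l - m"]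
    by (simp_all add: wrefl_def sc_uminus_left)
  then show ?thesis using root that by blast
qed

text \<open>With \<open>GKM_intro\<close> this replaces the roots and reflections in the definition
  of \<open>GKM\<close> by the condition (l, m) = 1/3; the sign of the positive root is absorbed
  into g.\<close>

lemma GKM_neighbour:
  assumes "GKM f" "l \<in> verts" "m \<in> verts" "ip l m = 1/3"
  obtains g where "g \<in> HBT" "f l - f m = lin (l - m) * g"
proof -
  obtain a where a: "a \<in> PosRoots" "wrefl a l = m" "a = l - m \<or> a = m - l"
    using edge_if_neighbour[OF assms(2-4)] .
  have "l \<noteq> m" using assms ip_vert_self by force
  then obtain g where g: "g \<in> HBT" "f l - f m = lin a * g"
    using assms(1-3) a unfolding GKM_def Lambda_eq by blast
  have "lin (m - l) = - lin (l - m)" by (simp add: lin_diff)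
  then show ?thesis using a(3) g that[of g] that[of "- g"] HBT_uminus by auto
qed

lemma GKM_intro:
  assumes "\<And>l. l \<in> verts \<Longrightarrow> f l \<in> HBT"
    "\<And>l m. l \<in> verts \<Longrightarrow> m \<in> verts \<Longrightarrow> ip l m = 1/3 \<Longrightarrow> \<exists>g\<in>HBT. f l - f m = lin (l - m) * g"
  shows "GKM f"
  unfolding GKM_def Lambda_eq
proof (intro conjI ballI impI)
  fix l m a assume *: "l \<in> verts" "m \<in> verts" "a \<in> PosRoots" "l \<noteq> m \<and> wrefl a l = m"
  then have e: "ip l m = 1/3" "a = l - m \<or> a = m - l" using edge_imp_diff by blast+
  obtain g where g: "g \<in> HBT" "f l - f m = lin (l - m) * g" using assms(2)[OF *(1,2) e(1)] by blast
  have "lin (m - l) = - lin (l - m)" by (simp add: lin_diff)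
  then show "\<exists>g\<in>HBT. f l - f m = lin a * g"
    using e(2) g HBT_uminus[OF g(1)] by (auto intro: bexI[of _ "- g"])
qed (use assms in auto)

section \<open>Values of omega\<close>

text \<open>Recursion over a list: invariance under permutation allows any enumeration of the six
  indices to be used, and unfolding yields explicit polynomials for the identities below.\<close>

fun esym_list :: "nat \<Rightarrow> 'a::comm_ring_1 list \<Rightarrow> 'a" where
  "esym_list 0 xs = 1"
| "esym_list (Suc n) [] = 0"
| "esym_list (Suc n) (a # xs) = esym_list (Suc n) xs + a * esym_list n xs"

lemma esym_list_move: "esym_list n (us @ a # vs) = esym_list n (a # us @ vs)"
proof (induction us arbitrary: n)
  case (Cons b us)
  show ?case
  proof (cases n)
    case (Suc m)
    then show ?thesis using Cons by (cases m) (simp_all add: algebra_simps)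
  qed simp
qed simp

lemma esym_list_mset_cong: "mset xs = mset ys \<Longrightarrow> esym_list n xs = esym_list n ys"
proof (induction xs arbitrary: ys n)
  case (Cons a xs)
  then have "a \<in> set ys" by (metis list.set_intros(1) set_mset_mset)
  then obtain us vs where ys: "ys = us @ a # vs" by (meson split_list)
  then have "mset xs = mset (us @ vs)" using Cons.prems by simp
  then have IH: "esym_list n xs = esym_list n (us @ vs)" for n by (rule Cons.IH)
  show ?case unfolding ys esym_list_move by (cases n) (simp_all add: IH)
qed simp

abbreviation TT :: "nat \<Rightarrow> pol" where "TT i \<equiv> lin (tgen i)"
abbreviation XX :: pol where "XX \<equiv> lin (tgen 6)"

definition esym_t :: "nat \<Rightarrow> pol" where "esym_t n = esym_list n (map TT [0..<6])"

lemma esym_t_eq: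
  assumes "distinct ps" "set ps = {..<6}"
  shows "esym_t n = esym_list n (map TT ps)"
proof -
  have "mset ps = mset [0..<6]"
    using set_eq_iff_mset_eq_distinct[of ps "[0..<6]"] assms by (simp only: distinct_upt set_upt lessThan_atLeast0 simp_thms)
  then have "mset (map TT [0..<6]) = mset (map TT ps)" by (simp only: mset_map)
  then show ?thesis unfolding esym_t_def by (rule esym_list_mset_cong)
qed

lemma sum_TT:
  assumes "distinct ps" "set ps = {..<6}"
  shows "3 * XX = sum_list (map TT ps)"
proof -
  have "lin (sum tgen A) = (\<Sum>i\<in>A. TT i)" if "finite A" for A
    using that
  proof induction
    case (insert i A)
    then show ?case using sum.insert[of A i tgen] sum.insert[of A i TT] by (simp only: lin_add not_False_eq_True)
  qed (simp only: sum.empty lin_zero)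
  then have "lin (\<Sum>i<6. tgen i) = (\<Sum>i<6. TT i)" by blast
  then have "3 * XX = (\<Sum>i<6. TT i)"
    unfolding sum_tgen lin_sc using pconst_simps(7)[of 3] by simp
  then show ?thesis using sum.distinct_set_conv_list[OF assms(1), of TT] assms(2) by simp
qed

lemma HBT_TT: "i < 6 \<Longrightarrow> TT i \<in> HBT" and HBT_XX: "XX \<in> HBT"
  by (auto intro!: HBT.gen Lat_tgen)

lemma HBT_esym_list: "set xs \<subseteq> HBT \<Longrightarrow> esym_list n xs \<in> HBT"
  by (induction n xs rule: esym_list.induct) (auto intro!: HBT_intros)

lemma HBT_esym_t: "esym_t n \<in> HBT"
  unfolding esym_t_def by (intro HBT_esym_list) (auto intro!: HBT_TT)

section \<open>Distinctness of the vertices and translation of the branches of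
  \<open>omega\<close>\<close>

text \<open>Distinctness is read off from inner products: a vertex has norm 4/3, whereas the
  pairings in question are 1/3 or -2/3.\<close>

lemma vA_neq_vB: "i < 6 \<Longrightarrow> j < 6 \<Longrightarrow> vA i \<noteq> vB j"
  using ip_verts(1)[of i i] ip_verts(2)[of i j] by (auto split: if_splits)

lemma vA_neq_vC: "i < 6 \<Longrightarrow> j < 6 \<Longrightarrow> k < 6 \<Longrightarrow> j \<noteq> k \<Longrightarrow> vA i \<noteq> vC j k"
  using ip_verts(1)[of i i] ip_vC(1)[of j k i] by (auto split: if_splits)

lemma vB_neq_vC: "i < 6 \<Longrightarrow> j < 6 \<Longrightarrow> k < 6 \<Longrightarrow> j \<noteq> k \<Longrightarrow> vB i \<noteq> vC j k"
  using ip_verts(4)[of i i] ip_vC(3)[of j k i] by (auto split: if_splits)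

lemma vA_eq_iff: "i < 6 \<Longrightarrow> j < 6 \<Longrightarrow> vA i = vA j \<longleftrightarrow> i = j"
  using ip_verts(1)[of i j] ip_verts(1)[of i i] by (auto split: if_splits)

lemma vB_eq_iff: "i < 6 \<Longrightarrow> j < 6 \<Longrightarrow> vB i = vB j \<longleftrightarrow> i = j"
  using ip_verts(4)[of i j] ip_verts(4)[of i i] by (auto split: if_splits)

lemma vC_eq_iff: 
  assumes "i < 6" "j < 6" "i \<noteq> j" "k < 6" "m < 6" "k \<noteq> m"
  shows "vC i j = vC k m \<longleftrightarrow> {i, j} = {k, m}"
proof
  assume "vC i j = vC k m"
  then have "ip (vC i j) (vC k m) = 4/3" using ip_vC_vC[of i j i j] assms by simp
  then show "{i, j} = {k, m}" using ip_vC_vC[OF assms] by (simp split: if_splits)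
qed (auto simp: doubleton_eq_iff vC_commute)

lemma Svec_EE: "Svec + sc (1/2) EE = tgen 6"
  by (simp add: tgen_def)

text \<open>This and the next lemmas are the dictionary from the weights in the definition of
  \<open>omega\<close> to the double-six. The weight with minus signs at a, b, c belongs to c_pq
  with p, q the other two indices of 1, ..., 5.\<close>

lemma spin_eq_vA: "n \<in> {1..5} \<Longrightarrow> - eb n + Svec + sc (1/6) EE = vA n"
  by (rule ext) (auto simp: vA_def plus_fun_apply minus_apply uminus_apply tgen_apply tgen_6_apply eb_def)

lemma spin_eq_vB_0: "- Svec + sc (1/6) EE = vB 0"
  by (rule ext) (auto simp: vB_def plus_fun_apply minus_apply uminus_apply tgen_apply)

lemma vector_eq_vC_0: "j \<in> {1..5} \<Longrightarrow> eb j - sc (1/3) EE = vC 0 j"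
  by (rule ext) (auto simp: vC_def plus_fun_apply minus_apply uminus_apply tgen_apply tgen_6_apply eb_def)

lemma vector_eq_vB: "j \<in> {1..5} \<Longrightarrow> - eb j - sc (1/3) EE = vB j"
  by (rule ext) (auto simp: vB_def plus_fun_apply minus_apply uminus_apply tgen_apply eb_def)

lemma spin_eq_vC:
  assumes "distinct [a, b, c, p, q]" "{a, b, c, p, q} = {1..5}"
  shows "- eb a - eb b - eb c + Svec + sc (1/6) EE = vC p q"
proof
  fix k
  have "p \<in> {1..5}" "q \<in> {1..5}" using assms(2) by blast+
  then have pq: "p < 6" "p \<noteq> 0" "q < 6" "q \<noteq> 0" by auto
  have "(\<Sum>i\<in>{1..5}. eb i) = eb a + (eb b + (eb c + (eb p + eb q)))"
    using sum.distinct_set_conv_list[OF assms(1), of eb] assms(2) by simp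
  then have S: "Svec k = (eb a k + (eb b k + (eb c k + (eb p k + eb q k)))) / 2"
    unfolding Svec_def by (simp add: plus_fun_apply)
  have "tgen p k = eb p k + EE k / 3" "tgen q k = eb q k + EE k / 3"
    using pq by (simp_all add: tgen_apply eb_def)
  then show "(- eb a - eb b - eb c + Svec + sc (1/6) EE) k = vC p q k"
    by (simp add: vC_def plus_fun_apply minus_apply uminus_apply tgen_6_apply S field_simps)
qed

lemma triple_complement:
  assumes "distinct [a, b, c]" "{a, b, c} \<subseteq> {1..5::nat}"
  obtains p q where "distinct [a, b, c, p, q]" "{a, b, c, p, q} = {1..5}"
proof -
  have "card {a, b, c} = 3" using assms(1) by simp
  then have "card ({1..5} - {a, b, c}) = 2" using assms(2) by (subst card_Diff_subset) auto
  then obtain p q where pq: "{1..5} - {a, b, c} = {p, q}" "p \<noteq> q" by (auto simp: card_2_iff)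
  then have "{a, b, c, p, q} = {1..5}" using assms(2) by blast
  moreover have "p \<notin> {a, b, c}" "q \<notin> {a, b, c}" using pq by blast+
  then have "distinct [a, b, c, p, q]" using assms(1) pq(2) by auto
  ultimately show ?thesis using that by blast
qed

lemma pair_complement:
  assumes "p \<noteq> q" "{p, q} \<subseteq> {1..5::nat}"
  obtains a b c where "distinct [a, b, c, p, q]" "{a, b, c, p, q} = {1..5}"
proof -
  have "card {p, q} = 2" using assms(1) by simp
  then have "card ({1..5} - {p, q}) = 3" using assms(2) by (subst card_Diff_subset) auto
  then obtain a b c where abc: "{1..5} - {p, q} = {a, b, c}" "a \<noteq> b" "b \<noteq> c" "a \<noteq> c"
    by (auto simp: card_3_iff)
  then have "{a, b, c, p, q} = {1..5}" using assms(2) by blast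
  moreover have "a \<notin> {p, q}" "b \<notin> {p, q}" "c \<notin> {p, q}" using abc by blast+
  then have "distinct [a, b, c, p, q]" using assms(1) abc(2-4) by auto
  ultimately show ?thesis using that by blast
qed

abbreviation triple_at :: "vec \<Rightarrow> nat \<Rightarrow> nat \<Rightarrow> nat \<Rightarrow> bool" where
  "triple_at l a b c \<equiv> distinct [a, b, c] \<and> {a, b, c} \<subseteq> {1..5} \<and>
     l = - eb a - eb b - eb c + Svec + sc (1/6) EE"

lemma triple_atE:
  assumes "triple_at l a b c"
  obtains p q where "distinct [a, b, c, p, q]" "{a, b, c, p, q} = {1..5}" "l = vC p q"
proof -
  obtain p q where "distinct [a, b, c, p, q]" "{a, b, c, p, q} = {1..5}"
    using triple_complement[of a b c] assms by blast
  then show ?thesis using that spin_eq_vC assms by metis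
qed

text \<open>The triple branch of \<open>omega\<close> only covers c_pq with p, q >= 1; this excludes
  it at every other vertex.\<close>

lemma not_triple:
  assumes "(\<exists>i<6. l = vA i) \<or> (\<exists>i<6. l = vB i) \<or> (\<exists>j. 0 < j \<and> j < 6 \<and> l = vC 0 j)"
  shows "\<not> triple_at l a b c"
proof
  assume "triple_at l a b c"
  then obtain p q where *: "distinct [a, b, c, p, q]" "{a, b, c, p, q} = {1..5}" "l = vC p q"
    by (rule triple_atE)
  have "p \<in> {1..5}" "q \<in> {1..5}" using *(2) by blast+
  then have pq: "p < 6" "q < 6" "p \<noteq> q" "p \<noteq> 0" "q \<noteq> 0" using *(1) by auto
  from assms show False
  proof (elim disjE exE conjE)
    fix j assume "0 < j" "j < 6" "l = vC 0 j"
    then have "{0, j} = {p, q}" using vC_eq_iff[of 0 j p q] pq *(3) by simp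
    then show False using pq by (simp add: doubleton_eq_iff)
  qed (use vA_neq_vC vB_neq_vC pq *(3) in metis)+
qed

lemma not_spin_vA:
  assumes "(\<exists>i<6. l = vB i) \<or> (\<exists>i j. i < 6 \<and> j < 6 \<and> i \<noteq> j \<and> l = vC i j)"
  shows "l \<noteq> tbar" "\<not> (\<exists>n\<in>{1..5}. l = - eb n + Svec + sc (1/6) EE)"
proof -
  show "l \<noteq> tbar" using assms vA_neq_vB[of 0] vA_neq_vC[of 0] unfolding tbar_eq by (metis zero_less_numeral)
  show "\<not> (\<exists>n\<in>{1..5}. l = - eb n + Svec + sc (1/6) EE)"
  proof
    assume "\<exists>n\<in>{1..5}. l = - eb n + Svec + sc (1/6) EE"
    then obtain n where n: "n \<in> {1..5}" "l = vA n" using spin_eq_vA by metis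
    then have "n < 6" by auto
    then show False using assms vA_neq_vB[of n] vA_neq_vC[of n] n(2) by metis
  qed
qed

lemma omega_vA: 
  assumes "i < 6" shows "omega (vA i) = 0"
proof (cases "i = 0")
  case True
  then show ?thesis by (simp add: omega_def tbar_eq)
next
  case False
  then have "i \<in> {1..5}" using assms by auto
  then have "\<exists>n\<in>{1..5}. vA i = - eb n + Svec + sc (1/6) EE"
    using spin_eq_vA[of i] by metis
  then show ?thesis unfolding omega_def by (simp only: if_True if_cancel)
qed

lemma lin_vA_minus_vC: "lin (vA k - vC i j) = 2 * XX - TT i - TT j - TT k"
  unfolding v_defs lin_linear by simp

text \<open>Two separate branches of \<open>omega\<close>, for c_ij with i, j >= 1 and for c_0j,
  become one formula once 0 is treated like the other indices.\<close>

lemma omega_vC: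
  assumes "i < 6" "j < 6" "i \<noteq> j"
  shows "omega (vC i j) = (\<Prod>k\<in>{..<6} - {i, j}. 2 * XX - TT i - TT j - TT k)"
proof -
  have gen: "omega (vC i j) = (\<Prod>k\<in>{..<6} - {i, j}. 2 * XX - TT i - TT j - TT k)"
    if ij: "i \<in> {1..5}" "j \<in> {1..5}" "i \<noteq> j" for i j
  proof -
    have lt: "i < 6" "j < 6" using ij by auto
    have ns: "vC i j \<noteq> tbar" "\<not> (\<exists>n\<in>{1..5}. vC i j = - eb n + Svec + sc (1/6) EE)"
      by (rule not_spin_vA; use lt ij(3) in metis)+
    obtain a b c where abc: "distinct [a, b, c, i, j]" "{a, b, c, i, j} = {1..5}"
      using pair_complement[of i j] ij by auto
    have at: "triple_at (vC i j) a b c"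
    proof (intro conjI)
      show "distinct [a, b, c]" using abc(1) by simp
      show "{a, b, c} \<subseteq> {1..5}" using abc(2) by blast
      show "vC i j = - eb a - eb b - eb c + Svec + sc (1/6) EE" using spin_eq_vC[OF abc] by (rule sym)
    qed
    then have ex: "\<exists>a b c. triple_at (vC i j) a b c" by blast
    \<comment> \<open>The chosen triple is determined only up to order; the product it enters is
      symmetric, so its underlying set, the complement of i, j, suffices.\<close>
    define t where "t = (SOME (a, b, c). triple_at (vC i j) a b c)"
    have "case t of (a, b, c) \<Rightarrow> triple_at (vC i j) a b c"
      unfolding t_def by (rule someI[of _ "(a, b, c)"]) (simp only: at split_conv simp_thms)
    moreover obtain a b c where t: "t = (a, b, c)" by (cases t)
    ultimately have abc: "triple_at (vC i j) a b c" by (simp only: split_conv)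
    then obtain p q where pq: "distinct [a, b, c, p, q]" "{a, b, c, p, q} = {1..5}" "vC i j = vC p q"
      by (rule triple_atE)
    have "p \<in> {1..5}" "q \<in> {1..5}" using pq(2) by blast+
    then have "p < 6" "q < 6" "p \<noteq> q" using pq(1) by auto
    then have "{i, j} = {p, q}" using vC_eq_iff[of i j p q] lt ij pq(3) by blast
    moreover have "{a, b, c} = {1..5} - {p, q}" using pq(1) unfolding pq(2)[symmetric] by auto
    moreover have "{..<6} - {i, j} = insert 0 ({1..5} - {i, j})" using ij by auto
    ultimately have S: "{..<6} - {i, j} = {0, a, b, c}" by simp
    have abc': "a \<in> {1..5}" "b \<in> {1..5}" "c \<in> {1..5}" "distinct [a, b, c]" using abc by blast+
    then have z: "0 \<notin> {a, b, c}" by auto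
    have l: "vC i j = - eb a - eb b - eb c + Svec + sc (1/6) EE" using abc by blast
    \<comment> \<open>Each factor e_a + e_b is the root from c_ij to the a-vertex of the third
      index, and the factor \<open>tbar - l\<close> is the one to a_0.\<close>
    have e: "eb a + eb b = vA c - vC i j" "eb b + eb c = vA a - vC i j" "eb c + eb a = vA b - vC i j"
      unfolding l spin_eq_vA[OF abc'(1), symmetric] spin_eq_vA[OF abc'(2), symmetric]
        spin_eq_vA[OF abc'(3), symmetric] by simp_all
    have "omega (vC i j) = lin (eb a + eb b) * lin (eb b + eb c) * lin (eb c + eb a) * lin (tbar - vC i j)"
      unfolding omega_def using ns ex t unfolding t_def
      by (simp only: if_False if_True Let_def split_conv)
    also have "\<dots> = (\<Prod>k\<in>{0, a, b, c}. 2 * XX - TT i - TT j - TT k)"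
      unfolding e tbar_eq lin_vA_minus_vC using z abc'(4) by (simp add: mult_ac)
    finally show ?thesis unfolding S .
  qed
  have zero: "omega (vC 0 j) = (\<Prod>k\<in>{..<6} - {0, j}. 2 * XX - TT 0 - TT j - TT k)"
    if j: "j \<in> {1..5}" for j
  proof -
    have lt: "j < 6" "0 < j" using j by auto
    have ex: "\<exists>j'\<in>{1..5}. vC 0 j = eb j' - sc (1/3) EE"
      using vector_eq_vC_0[OF j] j by metis
    have un: "(SOME j'. j' \<in> {1..5} \<and> vC 0 j = eb j' - sc (1/3) EE) = j"
    proof (rule some_equality)
      show "j \<in> {1..5} \<and> vC 0 j = eb j - sc (1/3) EE" using vector_eq_vC_0[OF j] j by simp
      fix k assume "k \<in> {1..5} \<and> vC 0 j = eb k - sc (1/3) EE"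
      then have k: "k \<in> {1..5}" "vC 0 j = vC 0 k" using vector_eq_vC_0[of k] by simp_all
      then have "k < 6" "0 < k" by auto
      then have "{0, j} = {0, k}" using vC_eq_iff[of 0 j 0 k] lt k(2) by simp
      then show "k = j" by (auto simp: doubleton_eq_iff)
    qed
    have nt: "\<not> (\<exists>a b c. triple_at (vC 0 j) a b c)" using not_triple[of "vC 0 j"] lt by blast
    have nb: "vC 0 j \<noteq> - Svec + sc (1/6) EE"
      unfolding spin_eq_vB_0 using vB_neq_vC[of 0 0 j] lt by simp
    have ns: "vC 0 j \<noteq> tbar" "\<not> (\<exists>n\<in>{1..5}. vC 0 j = - eb n + Svec + sc (1/6) EE)"
      by (rule not_spin_vA; use lt in \<open>metis less_not_refl zero_less_numeral\<close>)+
    have "omega (vC 0 j) = (\<Prod>n\<in>{1..5} - {j}. lin (- eb n + Svec + sc (1/6) EE - vC 0 j))"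
      unfolding omega_def using ns nt nb ex un by (simp only: if_False if_True Let_def)
    also have "\<dots> = (\<Prod>n\<in>{1..5} - {j}. 2 * XX - TT 0 - TT j - TT n)"
      by (intro prod.cong refl) (simp only: spin_eq_vA lin_vA_minus_vC Diff_iff)
    also have "{1..5} - {j} = {..<6} - {0, j}" by auto
    finally show ?thesis .
  qed
  consider "i = 0" "j \<in> {1..5}" | "j = 0" "i \<in> {1..5}" | "i \<in> {1..5}" "j \<in> {1..5}"
    using assms by (cases "i = 0"; cases "j = 0") auto
  then show ?thesis
  proof cases
    case 1 then show ?thesis using zero by simp
  next
    case 2
    have "(\<Prod>k\<in>{..<6} - {0, i}. 2 * XX - TT 0 - TT i - TT k) = (\<Prod>k\<in>{..<6} - {i, 0}. 2 * XX - TT i - TT 0 - TT k)"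
      by (intro prod.cong) (auto simp: algebra_simps)
    then show ?thesis using zero[OF 2(2)] 2(1) vC_commute[of i 0] by simp
  qed (use gen assms in blast)
qed

section \<open>Polynomial identities for \<open>omega\<close> at b_i and along the edges\<close>

lemma esym_list_numeral:
  "esym_list 1 (a # xs) = esym_list 1 xs + a" "esym_list 2 (a # xs) = esym_list 2 xs + a * esym_list 1 xs" "esym_list 3 (a # xs) = esym_list 3 xs + a * esym_list 2 xs"
  "esym_list 4 (a # xs) = esym_list 4 xs + a * esym_list 3 xs" "esym_list 5 (a # xs) = esym_list 5 xs + a * esym_list 4 xs"
  "esym_list 6 (a # xs) = esym_list 6 xs + a * esym_list 5 xs"
  "esym_list 1 [] = 0" "esym_list 2 [] = 0" "esym_list 3 [] = 0" "esym_list 4 [] = 0" "esym_list 5 [] = 0" "esym_list 6 [] = 0"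
  by (simp_all add: eval_nat_numeral)

text \<open>The value of omega at b_i, in a form symmetric in the remaining five indices.\<close>

definition omegaB :: "'a::comm_ring_1 \<Rightarrow> 'a \<Rightarrow> 'a \<Rightarrow> 'a \<Rightarrow> 'a" where
  "omegaB x t e2 e3 = x * ((2 * x + t) * e2 - e3 - 5 * x ^ 3 - 3 * x ^ 2 * t + 2 * t ^ 3)"

text \<open>Here h is the form of E/3, so that e_i = t_i - h and t_0 = x - 2h; the last t_i is
  eliminated by 3x = t_0 + ... + t_5. The left side is the branch of \<open>omega\<close> at
  b_0.\<close>

lemma omegaB_identity_0:
  fixes x :: "'a::idom"
  assumes "t0 = x - 2 * h" "e = 2 * x + 2 * h - a - b - c - d"
    and "f1 = (a - h) + (b - h) + (c - h) + (d - h) + (e - h)"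
    and "f2 = esym_list 2 [a - h, b - h, c - h, d - h, e - h]"
    and "f3 = esym_list 3 [a - h, b - h, c - h, d - h, e - h]"
  shows "x * (f1 * f2 - f3) = omegaB x t0 (esym_list 2 [t0, a, b, c, d, e]) (esym_list 3 [t0, a, b, c, d, e])"
  unfolding assms omegaB_def esym_list_numeral by algebra

text \<open>The branch of \<open>omega\<close> at b_j with t = t_j and u = t_k; the factor x + t - u
  is the form of e_j - e_k + S + E/2 = a_k - b_j. The right side is symmetric in the indices other
  than j, so the choice of the auxiliary index k is immaterial.\<close>

lemma omegaB_identity:
  fixes t :: "'a::idom"
  assumes "c = 3 * x - t0 - t - u - a - b"
  shows "x * ((2 * x - t0 - a - u) * ((2 * x - t0 - b - u) * (2 * x - t0 - c - u))
      + (t + u - x + t0) * (x - t0 + t) * (x + t - u)) =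
    omegaB x t (esym_list 2 [t0, t, u, a, b, c]) (esym_list 3 [t0, t, u, a, b, c])"
  unfolding assms omegaB_def esym_list_numeral by algebra

text \<open>With u = 2x - t_i, y = t_j, z = t_k this is omega(c_ij) - omega(c_ik). The factor u - y
  - z is common, and what remains is the divided difference of the cubic (u - a - s)(u - b - s)(u -
  c - s) in s.\<close>

lemma omC_diff_identity:
  fixes u :: "'a::idom"
  shows "(u - y - z) * ((u - y - a) * ((u - y - b) * (u - y - c)))
    - (u - z - y) * ((u - z - a) * ((u - z - b) * (u - z - c)))
    = (y - z) * ((u - y - z) * ((u - a + u - b + u - c) * (y + z)
      - ((u - a) * (u - b) + (u - b) * (u - c) + (u - c) * (u - a)) - (y ^ 2 + y * z + z ^ 2)))"
  by algebra

text \<open>As 2x - j - k = y - d, the product is (x - d) f(y - d) with f(s) = (s - p)(s - q)(s -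
  r). The three parts of the cofactor come from x (f(y - d) - f(y)), from - d f(y - d), and from x
  f(y) minus the value at b_i, which is also a multiple of d.\<close>

lemma omC_omegaB_identity:
  fixes x :: "'a::idom"
  assumes "r = 3 * x - t - j - k - p - q" "d = t + j + k - x" "y = x + t"
  shows "(2 * x - j - k - t) * ((2 * x - j - k - p) * ((2 * x - j - k - q) * (2 * x - j - k - r)))
     - omegaB x t (esym_list 2 [t, j, k, p, q, r]) (esym_list 3 [t, j, k, p, q, r])
   = d * (x * ((y - p + y - q + y - r) * d - ((y - p) * (y - q) + (y - q) * (y - r) + (y - r) * (y - p)) - d ^ 2)
      - (y - d - p) * (y - d - q) * (y - d - r) - x * (x ^ 2 - t ^ 2 - 2 * x * d + j * k - (p * q + q * r + r * p)))"
  unfolding assms omegaB_def esym_list_numeral by algebra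

lemma atLeast1_5: "{1..5::nat} = {1, 2, 3, 4, 5}" by auto

lemma esym_eq:
  "esym1 = lin (eb 1) + lin (eb 2) + lin (eb 3) + lin (eb 4) + lin (eb 5)"
  "esym2 = esym_list 2 [lin (eb 1), lin (eb 2), lin (eb 3), lin (eb 4), lin (eb 5)]"
  "esym3 = esym_list 3 [lin (eb 1), lin (eb 2), lin (eb 3), lin (eb 4), lin (eb 5)]"
proof -
  have s: "{1<..5::nat} = {2, 3, 4, 5}" "{2<..5::nat} = {3, 4, 5}" "{3<..5::nat} = {4, 5}"
    "{4<..5::nat} = {5}" "{5<..5::nat} = {}" by auto
  show "esym1 = lin (eb 1) + lin (eb 2) + lin (eb 3) + lin (eb 4) + lin (eb 5)"
    unfolding esym1_def atLeast1_5 by (simp add: algebra_simps)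
  have sum: "(\<Sum>i\<in>{1,2,3,4,5::nat}. f i) = f 1 + f 2 + f 3 + f 4 + f 5"
    "(\<Sum>i\<in>{2,3,4,5::nat}. f i) = f 2 + f 3 + f 4 + f 5"
    "(\<Sum>i\<in>{3,4,5::nat}. f i) = f 3 + f 4 + f 5"
    "(\<Sum>i\<in>{4,5::nat}. f i) = f 4 + f 5" "(\<Sum>i\<in>{5::nat}. f i) = f 5" for f :: "nat \<Rightarrow> pol"
    by (simp_all add: algebra_simps)
  show "esym2 = esym_list 2 [lin (eb 1), lin (eb 2), lin (eb 3), lin (eb 4), lin (eb 5)]"
    unfolding esym2_def atLeast1_5 sum s sum sum.empty esym_list_numeral by (simp add: algebra_simps del: One_nat_def)
  show "esym3 = esym_list 3 [lin (eb 1), lin (eb 2), lin (eb 3), lin (eb 4), lin (eb 5)]"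
    unfolding esym3_def atLeast1_5 sum s sum sum.empty esym_list_numeral s sum by (simp add: algebra_simps del: One_nat_def)
qed

lemma omega_vB_0: "omega (vB 0) = omegaB XX (TT 0) (esym_t 2) (esym_t 3)"
proof -
  define h where "h = lin (sc (1/3) EE)"
  have ns: "vB 0 \<noteq> tbar" "\<not> (\<exists>n\<in>{1..5}. vB 0 = - eb n + Svec + sc (1/6) EE)"
    by (rule not_spin_vA; use zero_less_numeral in metis)+
  have nt: "\<not> (\<exists>a b c. triple_at (vB 0) a b c)" using not_triple[of "vB 0"] by (metis zero_less_numeral)
  have "omega (vB 0) = lin (tbar - vB 0) * (esym1 * esym2 - esym3)"
    unfolding omega_def using ns nt spin_eq_vB_0 by (simp only: if_False if_True refl)
  also have "lin (tbar - vB 0) = XX" unfolding tbar_eq v_defs by simp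
  finally have *: "omega (vB 0) = XX * (esym1 * esym2 - esym3)" .
  have e: "lin (eb i) = TT i - h" if "i \<in> {1..5}" for i
  proof -
    have "eb i = tgen i - sc (1/3) EE"
      by (rule ext) (use that in \<open>auto simp: tgen_apply minus_apply eb_def\<close>)
    then show ?thesis unfolding h_def by (simp only: lin_diff)
  qed
  have "sc (1/3) EE + sc (1/3) EE = tgen 6 - tgen 0"
    by (rule ext) (simp add: tgen_apply tgen_6_apply minus_apply plus_fun_apply)
  then have "lin (sc (1/3) EE) + lin (sc (1/3) EE) = XX - TT 0" by (simp only: flip: lin_add lin_diff)
  then have h: "TT 0 = XX - 2 * h" unfolding h_def by (simp add: algebra_simps)
  have d: "distinct [0::nat, 1, 2, 3, 4, 5]" "set [0::nat, 1, 2, 3, 4, 5] = {..<6}" by auto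
  have "TT 5 = 2 * XX + 2 * h - TT 1 - TT 2 - TT 3 - TT 4"
    using sum_TT[OF d] h by (simp add: algebra_simps)
  note id = omegaB_identity_0[OF h this refl refl refl]
  show ?thesis
    unfolding * esym_eq esym_t_eq[OF d] list.map id[symmetric] by (simp add: e del: One_nat_def)
qed

lemma omega_vB_pos:
  assumes "j \<in> {1..5}"
  shows "omega (vB j) = omegaB XX (TT j) (esym_t 2) (esym_t 3)"
proof -
  have lt: "j < 6" "0 < j" using assms by auto
  have ns: "vB j \<noteq> tbar" "\<not> (\<exists>n\<in>{1..5}. vB j = - eb n + Svec + sc (1/6) EE)"
    by (rule not_spin_vA; use lt in metis)+
  have nt: "\<not> (\<exists>a b c. triple_at (vB j) a b c)" using not_triple[of "vB j"] lt by metis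
  have n0: "vB j \<noteq> - Svec + sc (1/6) EE" unfolding spin_eq_vB_0 using vB_eq_iff[of j 0] lt by simp
  have nv: "\<not> (\<exists>k\<in>{1..5}. vB j = eb k - sc (1/3) EE)"
  proof
    assume "\<exists>k\<in>{1..5}. vB j = eb k - sc (1/3) EE"
    then obtain k where k: "k \<in> {1..5}" "vB j = vC 0 k" using vector_eq_vC_0 by metis
    then have "k < 6" "0 \<noteq> k" by auto
    then show False using vB_neq_vC[of j 0 k] lt k(2) by simp
  qed
  have ex: "\<exists>k\<in>{1..5}. vB j = - eb k - sc (1/3) EE" using vector_eq_vB assms by metis
  have un: "(SOME k. k \<in> {1..5} \<and> vB j = - eb k - sc (1/3) EE) = j"
  proof (rule some_equality)
    show "j \<in> {1..5} \<and> vB j = - eb j - sc (1/3) EE" using vector_eq_vB assms by simp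
    fix k assume "k \<in> {1..5} \<and> vB j = - eb k - sc (1/3) EE"
    then have k: "k \<in> {1..5}" "vB j = vB k" using vector_eq_vB[of k] by simp_all
    then have "k < 6" by auto
    then show "k = j" using vB_eq_iff[of j k] lt k(2) by simp
  qed
  \<comment> \<open>Nothing beyond k in 1, ..., 5 and k different from j is used; the witness 1 or 2
    only shows that such an index exists.\<close>
  define k where "k = (SOME k. k \<in> {1..5} \<and> k \<noteq> j)"
  have "(if j = 1 then 2 else 1 :: nat) \<in> {1..5} \<and> (if j = 1 then 2 else 1) \<noteq> j" by auto
  then have k: "k \<in> {1..5} \<and> k \<noteq> j" unfolding k_def by (rule someI)
  have *: "omega (vB j) = lin (Svec + sc (1/2) EE) *
           ((\<Prod>n\<in>{1..5} - {j, k}. lin (- eb n - eb k + Svec + sc (1/2) EE))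
            + lin (eb j + eb k) * lin (tbar - vB j) * lin (eb j - eb k + Svec + sc (1/2) EE))"
    unfolding omega_def k_def using ns nt n0 nv ex un by (simp only: if_False if_True Let_def)
  \<comment> \<open>E/3 is half of a_0 = \<open>tbar\<close>, so combinations involving two of these
    halves need only x - t_0 and no fraction.\<close>
  have eb: "eb i = tgen i - sc (1/2) (vA 0)" if "i \<in> {1..5}" for i
    by (rule ext) (use that in \<open>auto simp: tgen_apply tgen_6_apply vA_def minus_apply eb_def\<close>)
  have half: "sc (1/2) v + sc (1/2) v = v" for v by (rule ext) (simp add: plus_fun_apply)
  have l: "lin (- eb n - eb k + Svec + sc (1/2) EE) = 2 * XX - TT 0 - TT n - TT k" if "n \<in> {1..5}" for n
  proof -
    have "- eb n - eb k + Svec + sc (1/2) EE = tgen 6 - tgen n - tgen k + (sc (1/2) (vA 0) + sc (1/2) (vA 0))"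
      unfolding eb[OF that] eb[OF conjunct1[OF k]] using Svec_EE by (simp add: algebra_simps)
    then show ?thesis unfolding half vA_def by (simp only: lin_linear) simp
  qed
  have l2: "lin (eb j + eb k) = TT j + TT k - XX + TT 0"
  proof -
    have "eb j + eb k = tgen j + tgen k - (sc (1/2) (vA 0) + sc (1/2) (vA 0))"
      unfolding eb[OF assms] eb[OF conjunct1[OF k]] by (simp add: algebra_simps)
    then show ?thesis unfolding half vA_def by (simp only: lin_linear) simp
  qed
  have l3: "lin (tbar - vB j) = XX - TT 0 + TT j"
    unfolding tbar_eq v_defs lin_linear by simp
  have l4: "lin (eb j - eb k + Svec + sc (1/2) EE) = XX + TT j - TT k"
  proof -
    have "eb j - eb k + Svec + sc (1/2) EE = tgen j - tgen k + tgen 6"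
      unfolding eb[OF assms] eb[OF conjunct1[OF k]] Svec_EE[symmetric] by (simp add: algebra_simps)
    then show ?thesis by (simp only: lin_linear) simp
  qed
  have "distinct [0, j, k]" "set [0, j, k] \<subseteq> {..<6}" using k lt by auto
  then obtain ys where ys: "length ys = 6 - length [0, j, k]" "distinct ([0, j, k] @ ys)" "set ([0, j, k] @ ys) = {..<6}"
    by (rule six_indices)
  then obtain a b c where abc: "ys = [a, b, c]"
    by (auto simp: length_Suc_conv eval_nat_numeral)
  have d: "distinct [0, j, k, a, b, c]" "set [0, j, k, a, b, c] = {..<6}" using ys abc by simp_all
  have "{1..5} - {j, k} = {..<6} - {0, j, k}" by auto
  also have "\<dots> = {a, b, c}" using d(1) unfolding d(2)[symmetric] by auto
  finally have S: "{1..5} - {j, k} = {a, b, c}" .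
  have "(\<Prod>n\<in>{1..5} - {j, k}. lin (- eb n - eb k + Svec + sc (1/2) EE)) =
      (\<Prod>n\<in>{1..5} - {j, k}. 2 * XX - TT 0 - TT n - TT k)"
    by (intro prod.cong refl l) simp
  also have "\<dots> = (2 * XX - TT 0 - TT a - TT k) * ((2 * XX - TT 0 - TT b - TT k) * (2 * XX - TT 0 - TT c - TT k))"
    unfolding S using d(1) by simp
  finally have P: "(\<Prod>n\<in>{1..5} - {j, k}. lin (- eb n - eb k + Svec + sc (1/2) EE)) = \<dots>" .
  have "TT c = 3 * XX - TT 0 - TT j - TT k - TT a - TT b" using sum_TT[OF d] by simp
  from omegaB_identity[OF this] show ?thesis
    unfolding * P l2 l3 l4 Svec_EE esym_t_eq[OF d] list.map .
qed

lemma omega_vB: "i < 6 \<Longrightarrow> omega (vB i) = omegaB XX (TT i) (esym_t 2) (esym_t 3)"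
  using omega_vB_0 omega_vB_pos[of i] by (cases "i = 0") auto

section \<open>The edge conditions for \<open>tau\<close> and \<open>omega\<close>\<close>

lemma GKM_tau: "GKM tau"
proof (rule GKM_intro)
  fix l m assume lm: "l \<in> verts" "m \<in> verts"
  show "tau l \<in> HBT" unfolding tau_def tbar_eq
    by (intro HBT.gen Lat_diff verts_Lat vertsI lm) simp
  have "tau l - tau m = lin (l - m) * (- 1)" unfolding tau_def lin_diff by simp
  then show "\<exists>g\<in>HBT. tau l - tau m = lin (l - m) * g" by (intro bexI[of _ "- 1"] HBT_uminus HBT_1)
qed

lemma HBT_omegaB: "a \<in> HBT \<Longrightarrow> b \<in> HBT \<Longrightarrow> c \<in> HBT \<Longrightarrow> d \<in> HBT \<Longrightarrow> omegaB a b c d \<in> HBT"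
  unfolding omegaB_def by (intro HBT_intros)

lemma omega_HBT: "l \<in> verts \<Longrightarrow> omega l \<in> HBT"
  by (erule vertsE)
    (auto simp: omega_vA omega_vB omega_vC intro!: HBT_omegaB HBT_esym_t HBT_TT HBT_XX HBT_intros)

text \<open>An explicit cofactor in \<open>HBT\<close> for every edge type. Along a-c edges the root
  is a factor of the product; between a_i and b_i it is x, the outer factor of
  \<open>omegaB\<close>; b-b, c-c and c-b edges are divided differences.\<close>

lemma GKM_omega: "GKM omega"
proof -
  define D where "D l m \<longleftrightarrow> (\<exists>g\<in>HBT. omega l - omega m = lin (l - m) * g)" for l m
  have DI: "D l m" if "omega l - omega m = lin (l - m) * g" "g \<in> HBT" for l m g
    using that unfolding D_def by blast
  have sym: "D m l" if "D l m" for l m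
  proof -
    obtain g where "g \<in> HBT" "omega l - omega m = lin (l - m) * g" using \<open>D l m\<close> unfolding D_def by blast
    then show ?thesis by (intro DI[of m l g]) (simp_all add: lin_diff algebra_simps)
  qed
  note H = HBT_omegaB HBT_esym_t HBT_XX HBT_TT HBT_intros
  have AA: "D (vA i) (vA j)" if "i < 6" "j < 6" for i j
    using that by (intro DI[of _ _ 0] HBT_0) (simp add: omega_vA)
  have AC: "D (vA k) (vC i j)" if "i < 6" "j < 6" "i \<noteq> j" "k < 6" "k \<noteq> i" "k \<noteq> j" for i j k
  proof (rule DI)
    show "omega (vA k) - omega (vC i j) = lin (vA k - vC i j) *
        (- (\<Prod>n\<in>{..<6} - {i, j} - {k}. 2 * XX - TT i - TT j - TT n))"
      using that unfolding omega_vA[OF that(4)] omega_vC[OF that(1-3)] lin_vA_minus_vC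
      by (subst prod.remove[of _ k]) auto
    show "- (\<Prod>n\<in>{..<6} - {i, j} - {k}. 2 * XX - TT i - TT j - TT n) \<in> HBT"
      using that by (auto intro!: H)
  qed
  have AB: "D (vA i) (vB i)" if "i < 6" for i
  proof (rule DI)
    have x: "lin (vA i - vB i) = XX" unfolding v_defs lin_linear by simp
    show "omega (vA i) - omega (vB i) = lin (vA i - vB i) * 
       (- ((2 * XX + TT i) * esym_t 2 - esym_t 3 - 5 * XX ^ 3 - 3 * XX ^ 2 * TT i + 2 * TT i ^ 3))"
      unfolding omega_vA[OF that] omega_vB[OF that] x omegaB_def mult_minus_right by simp
  qed (use that in \<open>intro H\<close>)
  have BB: "D (vB i) (vB j)" if "i < 6" "j < 6" for i j
  proof (rule DI)
    have x: "lin (vB i - vB j) = TT j - TT i" unfolding v_defs lin_linear by simp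
    \<comment> \<open>As \<open>esym_t 2\<close> and \<open>esym_t 3\<close> do not depend on i,
      only the terms in t_i contribute; 2 t^3 gives the complete quadratic in t_i, t_j.\<close>
    show "omega (vB i) - omega (vB j) = lin (vB i - vB j) *
       (- (XX * (esym_t 2 - 3 * XX ^ 2 + 2 * (TT i ^ 2 + TT i * TT j + TT j ^ 2))))"
      unfolding omega_vB[OF that(1)] omega_vB[OF that(2)] x omegaB_def by algebra
  qed (use that in \<open>intro H\<close>)
  have omC: "omega (vC i j) = (2 * XX - TT i - TT j - TT k) * ((2 * XX - TT i - TT j - TT p) *
      ((2 * XX - TT i - TT j - TT q) * (2 * XX - TT i - TT j - TT r)))"
    if "distinct [i, j, k, p, q, r]" "set [i, j, k, p, q, r] = {..<6}" for i j k p q r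
  proof -
    have "i \<in> {..<6}" "j \<in> {..<6}" unfolding that(2)[symmetric] by auto
    moreover have "{..<6} - {i, j} = {k, p, q, r}" using that(1) unfolding that(2)[symmetric] by auto
    ultimately show ?thesis using that(1) by (simp add: omega_vC)
  qed
  have CC: "D (vC i j) (vC i k)" if ijk: "i < 6" "j < 6" "k < 6" "distinct [i, j, k]" for i j k
  proof -
    obtain p q r where pqr: "p < 6" "q < 6" "r < 6" "distinct [i, j, k, p, q, r]" "{i, j, k, p, q, r} = {..<6}"
      using complement_triple[OF ijk] by metis
    have 1: "distinct [i, j, k, p, q, r]" "set [i, j, k, p, q, r] = {..<6}" using pqr by simp_all
    have 2: "distinct [i, k, j, p, q, r]" "set [i, k, j, p, q, r] = {..<6}" using pqr by auto
    have x: "lin (vC i j - vC i k) = TT j - TT k" unfolding v_defs lin_linear by simp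
    show ?thesis
      by (rule DI, unfold omC[OF 1] omC[OF 2] x, rule omC_diff_identity[of "2 * XX - TT i"])
        (use ijk pqr in \<open>intro H\<close>)
  qed
  have CB: "D (vC j k) (vB i)" if ijk: "i < 6" "j < 6" "k < 6" "distinct [i, j, k]" for i j k
  proof -
    obtain p q r where pqr: "p < 6" "q < 6" "r < 6" "distinct [i, j, k, p, q, r]" "{i, j, k, p, q, r} = {..<6}"
      using complement_triple[OF ijk] by metis
    have 1: "distinct [j, k, i, p, q, r]" "set [j, k, i, p, q, r] = {..<6}" using pqr by auto
    have 2: "distinct [i, j, k, p, q, r]" "set [i, j, k, p, q, r] = {..<6}" using pqr by auto
    have x: "lin (vC j k - vB i) = TT i + TT j + TT k - XX" unfolding v_defs lin_linear by simp
    have r: "TT r = 3 * XX - TT i - TT j - TT k - TT p - TT q" using sum_TT[OF 2] by simp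
    show ?thesis
      by (rule DI, unfold omC[OF 1] omega_vB[OF ijk(1)] x esym_t_eq[OF 2] list.map,
          rule omC_omegaB_identity[OF r refl refl])
        (use ijk pqr in \<open>intro H\<close>)
  qed
  show ?thesis
  proof (rule GKM_intro)
    fix l m assume lm: "l \<in> verts" "m \<in> verts" "ip l m = 1/3"
    have "D l m"
      using lm(1)
    proof (cases rule: vertsE)
      case i: (1 i)
      from lm(2) show ?thesis
      proof (cases rule: vertsE)
        case (1 j)
        then show ?thesis using i AA by simp
      next
        case (2 j k)
        then have "i \<noteq> j" "i \<noteq> k" using i lm(3) by (auto simp: ip_vC split: if_splits)
        then show ?thesis using i 2 AC[of j k i] by simp
      next
        case (3 j)
        then have "i = j" using i lm(3) by (auto simp: ip_verts split: if_splits)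
        then show ?thesis using i 3 AB by simp
      qed
    next
      case ij: (2 i j)
      from lm(2) show ?thesis
      proof (cases rule: vertsE)
        case (1 k)
        then have "i \<noteq> k" "j \<noteq> k" using ij lm(3) by (auto simp: ip_vC split: if_splits)
        then show ?thesis using ij 1 sym[OF AC[of i j k]] by simp
      next
        case (2 k n)
        have "{i, j} \<noteq> {k, n}" "{i, j} \<inter> {k, n} \<noteq> {}"
          using ij 2 lm(3) by (auto simp: ip_vC_vC split: if_splits)
        then consider "i = k" "j \<noteq> n" | "i = n" "j \<noteq> k" | "j = k" "i \<noteq> n" | "j = n" "i \<noteq> k" by blast
        then show ?thesis
        proof cases
          case 1
          then show ?thesis using ij 2 CC[of i j n] by simp
        next
          case c: 2
          then have "D (vC i j) (vC n k)" using ij 2 CC[of i j k] by simp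
          then show ?thesis unfolding ij 2 by (subst vC_commute[of k])
        next
          case 3
          then have "D (vC j i) (vC k n)" using ij 2 CC[of j i n] by simp
          then show ?thesis unfolding ij 2 by (subst vC_commute[of i])
        next
          case 4
          then have "D (vC j i) (vC n k)" using ij 2 CC[of j i k] by simp
          then show ?thesis unfolding ij 2 by (subst vC_commute[of i], subst vC_commute[of k])
        qed
      next
        case (3 k)
        then have "i \<noteq> k" "j \<noteq> k" using ij lm(3) by (auto simp: ip_vC split: if_splits)
        then show ?thesis using ij 3 CB[of k i j] by simp
      qed
    next
      case i: (3 i)
      from lm(2) show ?thesis
      proof (cases rule: vertsE)
        case (1 j)
        then have "i = j" using i lm(3) by (auto simp: ip_verts split: if_splits)
        then show ?thesis using i 1 sym[OF AB] by simp
      next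
        case (2 j k)
        then have "i \<noteq> j" "i \<noteq> k" using i lm(3) by (auto simp: ip_vC split: if_splits)
        then show ?thesis using i 2 sym[OF CB[of i j k]] by simp
      next
        case (3 j)
        then show ?thesis using i BB by simp
      qed
    qed
    then show "\<exists>g\<in>HBT. omega l - omega m = lin (l - m) * g" unfolding D_def .
  qed (rule omega_HBT)
qed

section \<open>Polynomial identities\<close>

text \<open>With c = X + Y, the product of z - t over the four other roots t of the sextic with roots
  X, Y, ... is the quotient of the sextic by z^2 - c z + XY; as a polynomial in XY it is
  (XY)^2 + quad_lin * XY + quad_const. The remainder of the division vanishes, which gives a
  quadratic relation rel5 and a cubic relation rel6 for XY.\<close>

definition quad_lin :: "'a::comm_ring_1 \<Rightarrow> 'a \<Rightarrow> 'a \<Rightarrow> 'a \<Rightarrow> 'a" where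
  "quad_lin c z e1 e2 = - (z ^ 2) + z * (e1 - 2 * c) - 3 * c ^ 2 + 2 * e1 * c - e2"

definition quad_const :: "'a::comm_ring_1 \<Rightarrow> 'a \<Rightarrow> 'a \<Rightarrow> 'a \<Rightarrow> 'a \<Rightarrow> 'a \<Rightarrow> 'a" where
  "quad_const c z e1 e2 e3 e4 = z ^ 4 + (c - e1) * z ^ 3 + (c ^ 2 - e1 * c + e2) * z ^ 2
    + (c ^ 3 - e1 * c ^ 2 + e2 * c - e3) * z + (c ^ 4 - e1 * c ^ 3 + e2 * c ^ 2 - e3 * c + e4)"

definition rel5_sq :: "'a::comm_ring_1 \<Rightarrow> 'a \<Rightarrow> 'a" where
  "rel5_sq c e1 = 3 * c - e1"
definition rel5_lin :: "'a::comm_ring_1 \<Rightarrow> 'a \<Rightarrow> 'a \<Rightarrow> 'a \<Rightarrow> 'a" where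
  "rel5_lin c e1 e2 e3 = - 4 * c ^ 3 + 3 * e1 * c ^ 2 - 2 * e2 * c + e3"
definition rel5_const :: "'a::comm_ring_1 \<Rightarrow> 'a \<Rightarrow> 'a \<Rightarrow> 'a \<Rightarrow> 'a \<Rightarrow> 'a \<Rightarrow> 'a" where
  "rel5_const c e1 e2 e3 e4 e5 = c ^ 5 - e1 * c ^ 4 + e2 * c ^ 3 - e3 * c ^ 2 + e4 * c - e5"

definition rel6_sq :: "'a::comm_ring_1 \<Rightarrow> 'a \<Rightarrow> 'a \<Rightarrow> 'a" where
  "rel6_sq c e1 e2 = 6 * c ^ 2 - 3 * e1 * c + e2"
definition rel6_lin :: "'a::comm_ring_1 \<Rightarrow> 'a \<Rightarrow> 'a \<Rightarrow> 'a \<Rightarrow> 'a \<Rightarrow> 'a" where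
  "rel6_lin c e1 e2 e3 e4 = - 5 * c ^ 4 + 4 * e1 * c ^ 3 - 3 * e2 * c ^ 2 + 2 * e3 * c - e4"
definition rel6_const :: "'a::comm_ring_1 \<Rightarrow> 'a \<Rightarrow> 'a \<Rightarrow> 'a \<Rightarrow> 'a \<Rightarrow> 'a \<Rightarrow> 'a \<Rightarrow> 'a" where
  "rel6_const c e1 e2 e3 e4 e5 e6 = c ^ 6 - e1 * c ^ 5 + e2 * c ^ 4 - e3 * c ^ 3 + e4 * c ^ 2 - e5 * c + e6"

text \<open>Coefficients of the product of 1 + (X + Y) s + XY s^2 with the generating polynomial of
  the four remaining roots.\<close>

lemma esym_list_two_four:
  fixes X :: "'a::idom"
  assumes "L = [a, b, c, d]"
  shows "esym_list 1 (X # Y # L) = X + Y + esym_list 1 L"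
    "esym_list 2 (X # Y # L) = X * Y + (X + Y) * esym_list 1 L + esym_list 2 L"
    "esym_list 3 (X # Y # L) = X * Y * esym_list 1 L + (X + Y) * esym_list 2 L + esym_list 3 L"
    "esym_list 4 (X # Y # L) = X * Y * esym_list 2 L + (X + Y) * esym_list 3 L + esym_list 4 L"
    "esym_list 5 (X # Y # L) = X * Y * esym_list 3 L + (X + Y) * esym_list 4 L"
    "esym_list 6 (X # Y # L) = X * Y * esym_list 4 L"
  unfolding assms by (simp_all only: esym_list_numeral) (simp_all add: algebra_simps)

lemma quad_identity:
  fixes X :: "'a::idom"
  shows "(z - a) * ((z - b) * ((z - c) * (z - d))) =
    (X * Y) ^ 2 + quad_lin (X + Y) z (esym_list 1 [X, Y, a, b, c, d]) (esym_list 2 [X, Y, a, b, c, d]) * (X * Y) +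
    quad_const (X + Y) z (esym_list 1 [X, Y, a, b, c, d]) (esym_list 2 [X, Y, a, b, c, d]) (esym_list 3 [X, Y, a, b, c, d]) (esym_list 4 [X, Y, a, b, c, d])"
proof -
  have "(z - a) * ((z - b) * ((z - c) * (z - d))) =
     z ^ 4 - esym_list 1 [a, b, c, d] * z ^ 3 + esym_list 2 [a, b, c, d] * z ^ 2 - esym_list 3 [a, b, c, d] * z + esym_list 4 [a, b, c, d]"
    unfolding esym_list_numeral by algebra
  then show ?thesis unfolding esym_list_two_four[OF refl] quad_lin_def quad_const_def by algebra
qed

text \<open>Dividing the product of the six factors 1 - t s by 1 - c s + XY s^2 leaves the product
  over the other four roots, so the coefficients of s^5 and s^6 in the quotient series vanish. The
  one at s^5 is this relation, the one at s^6 is \<open>rel6_identity\<close>.\<close>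

lemma rel5_identity:
  fixes X :: "'a::idom"
  assumes "L = [X, Y, a, b, c, d]"
  shows "rel5_sq (X + Y) (esym_list 1 L) * (X * Y) ^ 2 + rel5_lin (X + Y) (esym_list 1 L) (esym_list 2 L) (esym_list 3 L) * (X * Y) +
    rel5_const (X + Y) (esym_list 1 L) (esym_list 2 L) (esym_list 3 L) (esym_list 4 L) (esym_list 5 L) = 0"
  unfolding assms esym_list_two_four[OF refl] rel5_sq_def rel5_lin_def rel5_const_def by algebra

text \<open>In contrast to \<open>rel5_identity\<close>, whose leading coefficient is 3c - e1, this
  relation is monic in XY and therefore reduces powers of XY over the integers.\<close>

lemma rel6_identity:
  fixes X :: "'a::idom"
  assumes "L = [X, Y, a, b, c, d]"
  shows "(X * Y) ^ 3 = rel6_sq (X + Y) (esym_list 1 L) (esym_list 2 L) * (X * Y) ^ 2 +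
    rel6_lin (X + Y) (esym_list 1 L) (esym_list 2 L) (esym_list 3 L) (esym_list 4 L) * (X * Y) +
    rel6_const (X + Y) (esym_list 1 L) (esym_list 2 L) (esym_list 3 L) (esym_list 4 L) (esym_list 5 L) (esym_list 6 L)"
  unfolding assms esym_list_two_four[OF refl] rel6_sq_def rel6_lin_def rel6_const_def by algebra

text \<open>The lift of omega * XY times the relation rel5, which vanishes at all a_i and c_ij.\<close>

definition top_poly :: "'a::comm_ring_1 \<Rightarrow> 'a \<Rightarrow> 'a \<Rightarrow> 'a \<Rightarrow> 'a \<Rightarrow> 'a \<Rightarrow> 'a \<Rightarrow> 'a \<Rightarrow> 'a \<Rightarrow> 'a \<Rightarrow> 'a" where
  "top_poly c e1 e2 e3 e4 e5 e6 w th ps =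
    rel5_sq c e1 * (rel6_sq c e1 e2 * ps + rel6_lin c e1 e2 e3 e4 * th + rel6_const c e1 e2 e3 e4 e5 e6 * w) +
    rel5_lin c e1 e2 e3 * ps + rel5_const c e1 e2 e3 e4 e5 * th"

text \<open>Complementary pair sums multiply to (D + a + b)(D + c + d) = Z - (ab + cd). The product
  of all three is the resolvent cubic of the quartic with roots a, b, c, d, evaluated at Z.\<close>

lemma pair_sums_four:
  fixes D :: "'a::idom"
  assumes "Z = D ^ 2 + D * g1 + g2" "g1 = esym_list 1 [a, b, c, d]" "g2 = esym_list 2 [a, b, c, d]"
    "g3 = esym_list 3 [a, b, c, d]" "g4 = esym_list 4 [a, b, c, d]"
  shows "(D + a + b) * (D + c + d) * ((D + a + c) * (D + b + d)) * ((D + a + d) * (D + b + c)) =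
    Z ^ 3 - g2 * Z ^ 2 + (g1 * g3 - 4 * g4) * Z - (g1 ^ 2 * g4 - 4 * g2 * g4 + g3 ^ 2)"
proof -
  define w1 w2 w3 where "w1 = a * b + c * d" and "w2 = a * c + b * d" and "w3 = a * d + b * c"
  have 1: "(D + a + b) * (D + c + d) = Z - w1" "(D + a + c) * (D + b + d) = Z - w2"
    "(D + a + d) * (D + b + c) = Z - w3"
    unfolding assms esym_list_numeral w1_def w2_def w3_def by algebra+
  have 2: "w1 + w2 + w3 = g2" "w1 * w2 + w2 * w3 + w3 * w1 = g1 * g3 - 4 * g4"
    "w1 * w2 * w3 = g1 ^ 2 * g4 - 4 * g2 * g4 + g3 ^ 2"
    unfolding assms esym_list_numeral w1_def w2_def w3_def by algebra+
  have "(Z - w1) * (Z - w2) * (Z - w3) =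
     Z ^ 3 - (w1 + w2 + w3) * Z ^ 2 + (w1 * w2 + w2 * w3 + w3 * w1) * Z - w1 * w2 * w3" by algebra
  then show ?thesis unfolding 1 2 .
qed

text \<open>c = x - t and z = x + t are the values of \<open>pair_sum\<close> and 2x -
  \<open>pair_sum\<close> at b_i, where t = t_i, and y is one further root. The ten roots to the
  c_jk split into four involving y (the quartic in V) and six not involving it (the resolvent cubic
  in Z). Using the elementary symmetric g_n of the last four roots keeps the expansion
  small.\<close>

lemma top_poly_identity:
  fixes x :: "'a::idom"
  assumes "g1 = 3 * x - t - y"
    and "e1 = 3 * x" "e2 = t * y + (t + y) * g1 + g2" "e3 = t * y * g1 + (t + y) * g2 + g3"
    and "e4 = t * y * g2 + (t + y) * g3 + g4" "e5 = t * y * g3 + (t + y) * g4" "e6 = t * y * g4"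
    and "c = x - t" "z = x + t" "w = omegaB x t e2 e3"
    and "P = x * ((z - y) * (z ^ 4 - g1 * z ^ 3 + g2 * z ^ 2 - g3 * z + g4))"
    and "th = P - w * (4 * x ^ 2 - 6 * x * c + 2 * c ^ 2)"
    and "ps = w ^ 2 - quad_lin c z e1 e2 * th - quad_const c z e1 e2 e3 e4 * w"
    and "D = t - x" "V = D + y" "Z = D ^ 2 + D * g1 + g2"
  shows "top_poly c e1 e2 e3 e4 e5 e6 w th ps =
    - (x * ((Z ^ 3 - g2 * Z ^ 2 + (g1 * g3 - 4 * g4) * Z - (g1 ^ 2 * g4 - 4 * g2 * g4 + g3 ^ 2)) *
      (V ^ 4 + g1 * V ^ 3 + g2 * V ^ 2 + g3 * V + g4)))"
  unfolding assms top_poly_def rel5_sq_def rel5_lin_def rel5_const_def rel6_sq_def rel6_lin_def rel6_const_def quad_lin_def quad_const_def omegaB_def by algebra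

section \<open>The algebra generated by tau and omega\<close>

lemma top_poly_list_identity:
  fixes x :: "'a::idom"
  assumes d: "d = 3 * x - t - y - a - b - c" and L: "L = [t, y, a, b, c, d]"
    and "w = omegaB x t (esym_list 2 L) (esym_list 3 L)"
    and P: "P = (x + t - t) * ((x + t - y) * ((x + t - a) * ((x + t - b) * ((x + t - c) * (x + t - d)))))"
    and "th = P - w * (4 * x ^ 2 - 6 * x * (x - t) + 2 * (x - t) ^ 2)"
    and "ps = w ^ 2 - quad_lin (x - t) (x + t) (esym_list 1 L) (esym_list 2 L) * th
      - quad_const (x - t) (x + t) (esym_list 1 L) (esym_list 2 L) (esym_list 3 L) (esym_list 4 L) * w"
  shows "top_poly (x - t) (esym_list 1 L) (esym_list 2 L) (esym_list 3 L) (esym_list 4 L) (esym_list 5 L) (esym_list 6 L) w th ps =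
    - (x * prod_list [x - t - y - a, x - t - y - b, x - t - y - c, x - t - y - d, x - t - a - b,
      x - t - a - c, x - t - a - d, x - t - b - c, x - t - b - d, x - t - c - d])"
proof -
  define g1 g2 g3 g4 where "g1 = esym_list 1 [a, b, c, d]" and "g2 = esym_list 2 [a, b, c, d]"
    and "g3 = esym_list 3 [a, b, c, d]" and "g4 = esym_list 4 [a, b, c, d]"
  define D V Z where "D = t - x" and "V = D + y" and "Z = D ^ 2 + D * g1 + g2"
  have g1: "g1 = 3 * x - t - y" unfolding g1_def d esym_list_numeral by simp
  have e: "esym_list 1 L = 3 * x" "esym_list 2 L = t * y + (t + y) * g1 + g2" "esym_list 3 L = t * y * g1 + (t + y) * g2 + g3"
    "esym_list 4 L = t * y * g2 + (t + y) * g3 + g4" "esym_list 5 L = t * y * g3 + (t + y) * g4" "esym_list 6 L = t * y * g4"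
    unfolding L esym_list_two_four[OF refl] g1_def[symmetric] g2_def[symmetric] g3_def[symmetric] g4_def[symmetric]
    by (simp_all add: g1)
  have P': "P = x * ((x + t - y) * ((x + t) ^ 4 - g1 * (x + t) ^ 3 + g2 * (x + t) ^ 2 - g3 * (x + t) + g4))"
    unfolding P g1_def g2_def g3_def g4_def esym_list_numeral by algebra
  have V: "(V + a) * (V + b) * ((V + c) * (V + d)) = V ^ 4 + g1 * V ^ 3 + g2 * V ^ 2 + g3 * V + g4"
    unfolding g1_def g2_def g3_def g4_def esym_list_numeral by algebra
  have six: "(D + a + b) * (D + c + d) * ((D + a + c) * (D + b + d)) * ((D + a + d) * (D + b + c)) =
      Z ^ 3 - g2 * Z ^ 2 + (g1 * g3 - 4 * g4) * Z - (g1 ^ 2 * g4 - 4 * g2 * g4 + g3 ^ 2)"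
    by (rule pair_sums_four[OF Z_def g1_def g2_def g3_def g4_def])
  have "top_poly (x - t) (esym_list 1 L) (esym_list 2 L) (esym_list 3 L) (esym_list 4 L) (esym_list 5 L) (esym_list 6 L) w th ps =
    - (x * ((D + a + b) * (D + c + d) * ((D + a + c) * (D + b + d)) * ((D + a + d) * (D + b + c)) *
      ((V + a) * (V + b) * ((V + c) * (V + d)))))"
    unfolding six V by (rule top_poly_identity[OF g1 e refl refl assms(3) P' assms(5,6) D_def V_def Z_def])
  \<comment> \<open>All ten factors change sign, so the product does not.\<close>
  also have "(D + a + b) * (D + c + d) * ((D + a + c) * (D + b + d)) * ((D + a + d) * (D + b + c)) *
      ((V + a) * (V + b) * ((V + c) * (V + d))) = 
    (- (D + a + b)) * (- (D + c + d)) * ((- (D + a + c)) * (- (D + b + d))) * ((- (D + a + d)) * (- (D + b + c))) *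
      ((- (V + a)) * (- (V + b)) * ((- (V + c)) * (- (V + d))))"
    by (simp only: minus_mult_minus)
  also have "\<dots> = prod_list [x - t - y - a, x - t - y - b, x - t - y - c, x - t - y - d, x - t - a - b,
      x - t - a - c, x - t - a - d, x - t - b - c, x - t - b - d, x - t - c - d]"
  proof -
    have "- (D + a + b) = x - t - a - b" "- (D + c + d) = x - t - c - d" "- (D + a + c) = x - t - a - c"
      "- (D + b + d) = x - t - b - d" "- (D + a + d) = x - t - a - d" "- (D + b + c) = x - t - b - c"
      "- (V + a) = x - t - y - a" "- (V + b) = x - t - y - b" "- (V + c) = x - t - y - c" "- (V + d) = x - t - y - d"
      unfolding V_def D_def by simp_all
    then show ?thesis by (simp only: prod_list.Cons prod_list.Nil mult_1_right mult_1_left mult_ac)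
  qed
  finally show ?thesis .
qed

section \<open>Ring structure on GKM functions and the subalgebra of \<open>tau\<close> and
  \<open>omega\<close>\<close>

lemma GKM_const: "c \<in> HBT \<Longrightarrow> GKM (\<lambda>l. c)"
  by (rule GKM_intro) (auto intro!: bexI[of _ 0] HBT_0)

lemma GKM_add:
  assumes "GKM f" "GKM g"
  shows "GKM (\<lambda>l. f l + g l)"
proof (rule GKM_intro)
  fix l m assume lm: "l \<in> verts" "m \<in> verts"
  show "f l + g l \<in> HBT" using assms lm unfolding GKM_def Lambda_eq by (intro HBT.add) auto
  assume "ip l m = 1/3"
  then obtain p q where "p \<in> HBT" "q \<in> HBT" "f l - f m = lin (l - m) * p" "g l - g m = lin (l - m) * q"
    using GKM_neighbour assms lm by metis
  moreover have "(f l + g l) - (f m + g m) = (f l - f m) + (g l - g m)" by simp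
  ultimately have "(f l + g l) - (f m + g m) = lin (l - m) * (p + q)" by (simp only: distrib_left)
  then show "\<exists>h\<in>HBT. (f l + g l) - (f m + g m) = lin (l - m) * h"
    using \<open>p \<in> HBT\<close> \<open>q \<in> HBT\<close> HBT.add by blast
qed

lemma GKM_mult:
  assumes "GKM f" "GKM g"
  shows "GKM (\<lambda>l. f l * g l)"
proof (rule GKM_intro)
  fix l m assume lm: "l \<in> verts" "m \<in> verts"
  have H: "f l \<in> HBT" "f m \<in> HBT" "g l \<in> HBT" "g m \<in> HBT"
    using assms lm unfolding GKM_def Lambda_eq by auto
  then show "f l * g l \<in> HBT" by (intro HBT.mult)
  assume "ip l m = 1/3"
  then obtain p q where pq: "p \<in> HBT" "q \<in> HBT" "f l - f m = lin (l - m) * p" "g l - g m = lin (l - m) * q"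
    using GKM_neighbour assms lm by metis
  have "f l * g l - f m * g m = (f l - f m) * g l + f m * (g l - g m)" by (simp add: algebra_simps)
  then have "f l * g l - f m * g m = lin (l - m) * (p * g l + f m * q)"
    unfolding pq by (simp only: distrib_left mult_ac)
  then show "\<exists>h\<in>HBT. f l * g l - f m * g m = lin (l - m) * h"
    using pq H by (intro bexI[of _ "p * g l + f m * q"] HBT.add HBT.mult)
qed

text \<open>Products are introduced only with a factor \<open>tau\<close> or \<open>omega\<close>,
  so extracting coefficients is an index shift; closure under all products follows in
  \<open>gen_alg_mult\<close>.\<close>

inductive_set gen_alg :: "(vec \<Rightarrow> pol) set" where
  const: "c \<in> HBT \<Longrightarrow> (\<lambda>l. c) \<in> gen_alg"
| add: "f \<in> gen_alg \<Longrightarrow> g \<in> gen_alg \<Longrightarrow> (\<lambda>l. f l + g l) \<in> gen_alg"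
| tau: "f \<in> gen_alg \<Longrightarrow> (\<lambda>l. tau l * f l) \<in> gen_alg"
| omega: "f \<in> gen_alg \<Longrightarrow> (\<lambda>l. omega l * f l) \<in> gen_alg"

lemma gen_alg_GKM: "f \<in> gen_alg \<Longrightarrow> GKM f"
  by (induction rule: gen_alg.induct) (auto intro: GKM_const GKM_add GKM_mult GKM_tau GKM_omega)

lemma gen_alg_scale:
  assumes "c \<in> HBT" "f \<in> gen_alg"
  shows "(\<lambda>l. c * f l) \<in> gen_alg"
  using assms(2)
proof induction
  case (const d)
  then show ?case using assms(1) by (intro gen_alg.const HBT.mult)
next
  case (add f g)
  then show ?case using gen_alg.add by (simp add: distrib_left)
next
  case (tau f)
  then show ?case using gen_alg.tau[OF tau.IH] by (simp add: mult_ac)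
next
  case (omega f)
  then show ?case using gen_alg.omega[OF omega.IH] by (simp add: mult_ac)
qed

lemma gen_alg_mult:
  assumes "f \<in> gen_alg" "g \<in> gen_alg"
  shows "(\<lambda>l. f l * g l) \<in> gen_alg"
  using assms(1)
proof induction
  case (const d)
  then show ?case using gen_alg_scale assms(2) by blast
next
  case (add f h)
  then show ?case using gen_alg.add[OF add.IH] by (simp add: distrib_right)
next
  case (tau f)
  then show ?case using gen_alg.tau[OF tau.IH] by (simp add: mult_ac)
next
  case (omega f)
  then show ?case using gen_alg.omega[OF omega.IH] by (simp add: mult_ac)
qed

lemma gen_alg_uminus: "f \<in> gen_alg \<Longrightarrow> (\<lambda>l. - f l) \<in> gen_alg"
  using gen_alg_scale[of "- 1" f] HBT_uminus[OF HBT_1] by simp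

lemma gen_alg_diff: "f \<in> gen_alg \<Longrightarrow> g \<in> gen_alg \<Longrightarrow> (\<lambda>l. f l - g l) \<in> gen_alg"
  using gen_alg.add[OF _ gen_alg_uminus, of f g] by simp

lemma gen_alg_power: "f \<in> gen_alg \<Longrightarrow> (\<lambda>l. f l ^ n) \<in> gen_alg"
  by (induction n) (auto intro: gen_alg_mult gen_alg.const HBT_1)

lemma gen_alg_prod: "(\<And>i. i \<in> I \<Longrightarrow> f i \<in> gen_alg) \<Longrightarrow> (\<lambda>l. \<Prod>i\<in>I. f i l) \<in> gen_alg"
  by (induction I rule: infinite_finite_induct) (auto intro: gen_alg_mult gen_alg.const HBT_1)

lemma gen_alg_tau: "tau \<in> gen_alg" and gen_alg_omega: "omega \<in> gen_alg"
  using gen_alg.tau[OF gen_alg.const[OF HBT_1]] gen_alg.omega[OF gen_alg.const[OF HBT_1]] by simp_all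

text \<open>Up to sign and the constant \<open>lin tbar\<close>, \<open>tau\<close> is the
  tautological function sending a vertex to its own linear form.\<close>

lemma gen_alg_lin: "lin \<in> gen_alg"
proof -
  have "(\<lambda>l. lin tbar - tau l) \<in> gen_alg"
    unfolding tbar_eq by (intro gen_alg_diff gen_alg.const gen_alg_tau HBT.gen verts_Lat vertsI) simp
  then show ?thesis unfolding tau_def lin_diff by simp
qed

text \<open>The formula is required for every M >= N, with coefficients vanishing from N on, so that
  two representations can be added over a common range and index shifts do not lose terms.\<close>

lemma gen_alg_representation:
  assumes "f \<in> gen_alg"
  shows "\<exists>N (c :: nat \<Rightarrow> nat \<Rightarrow> pol). (\<forall>i j. c i j \<in> HBT) \<and> (\<forall>i j. N \<le> i \<or> N \<le> j \<longrightarrow> c i j = 0) \<and>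
    (\<forall>l. \<forall>M\<ge>N. f l = (\<Sum>i<M. \<Sum>j<M. c i j * tau l ^ i * omega l ^ j))"
  using assms
proof induction
  case (const d)
  have "d = (\<Sum>i<M. \<Sum>j<M. (if i = 0 \<and> j = 0 then d else 0) * tau l ^ i * omega l ^ j)" if "1 \<le> M" for M l
  proof -
    obtain K where M: "M = Suc K" using \<open>1 \<le> M\<close> by (cases M) auto
    show ?thesis unfolding M sum.lessThan_Suc_shift by simp
  qed
  moreover have "(if i = 0 \<and> j = 0 then d else 0) \<in> HBT" for i j :: nat using const by (simp add: HBT_0)
  moreover have "(if i = 0 \<and> j = 0 then d else 0) = 0" if "1 \<le> i \<or> 1 \<le> j" for i j :: nat
    using that by auto
  ultimately show ?case
    by (intro exI[of _ 1] exI[of _ "\<lambda>i j. if i = 0 \<and> j = 0 then d else 0"]) blast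
next
  case (add f g)
  from add.IH obtain N c N' c' where
    c: "\<And>i j. c i j \<in> HBT" "\<And>i j. N \<le> i \<or> N \<le> j \<Longrightarrow> c i j = 0"
      "\<And>l M. N \<le> M \<Longrightarrow> f l = (\<Sum>i<M. \<Sum>j<M. c i j * tau l ^ i * omega l ^ j)"
    and c': "\<And>i j. c' i j \<in> HBT" "\<And>i j. N' \<le> i \<or> N' \<le> j \<Longrightarrow> c' i j = 0"
      "\<And>l M. N' \<le> M \<Longrightarrow> g l = (\<Sum>i<M. \<Sum>j<M. c' i j * tau l ^ i * omega l ^ j)"
    by blast
  have "f l + g l = (\<Sum>i<M. \<Sum>j<M. (c i j + c' i j) * tau l ^ i * omega l ^ j)" if "max N N' \<le> M" for l M
    using c(3)[of M l] c'(3)[of M l] that by (simp add: distrib_right sum.distrib)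
  moreover have "c i j + c' i j \<in> HBT" for i j using c(1) c'(1) by (rule HBT.add)
  moreover have "c i j + c' i j = 0" if "max N N' \<le> i \<or> max N N' \<le> j" for i j
    using that by (auto simp: c(2) c'(2))
  ultimately show ?case
    by (intro exI[of _ "max N N'"] exI[of _ "\<lambda>i j. c i j + c' i j"]) blast
next
  case (tau f)
  from tau.IH obtain N c where
    c: "\<And>i j. c i j \<in> HBT" "\<And>i j. N \<le> i \<or> N \<le> j \<Longrightarrow> c i j = 0"
      "\<And>l M. N \<le> M \<Longrightarrow> f l = (\<Sum>i<M. \<Sum>j<M. c i j * tau l ^ i * omega l ^ j)"
    by blast
  \<comment> \<open>Multiplication by \<open>tau\<close> raises the first index by one; the row 0
    becomes empty.\<close>
  define d where "d i j = (case i of 0 \<Rightarrow> 0 | Suc k \<Rightarrow> c k j)" for i j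
  have "tau l * f l = (\<Sum>i<M. \<Sum>j<M. d i j * tau l ^ i * omega l ^ j)" if "Suc N \<le> M" for l M
  proof -
    obtain K where M: "M = Suc K" and K: "N \<le> K" using \<open>Suc N \<le> M\<close> by (cases M) auto
    define F where "F i = (\<Sum>j<M. d i j * tau l ^ i * omega l ^ j)" for i
    have "F 0 = 0" by (simp add: F_def d_def)
    moreover have "F (Suc i) = (\<Sum>j<K. tau l * (c i j * tau l ^ i * omega l ^ j))" for i
      unfolding F_def M using K by (simp add: d_def c(2) mult_ac)
    ultimately have "(\<Sum>i<M. F i) = (\<Sum>i<K. \<Sum>j<K. tau l * (c i j * tau l ^ i * omega l ^ j))"
      unfolding M sum.lessThan_Suc_shift by simp
    then have "(\<Sum>i<M. \<Sum>j<M. d i j * tau l ^ i * omega l ^ j) =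
        (\<Sum>i<K. \<Sum>j<K. tau l * (c i j * tau l ^ i * omega l ^ j))" unfolding F_def .
    then show ?thesis using c(3)[OF K, of l] by (simp add: sum_distrib_left)
  qed
  moreover have "d i j \<in> HBT" for i j by (cases i) (auto simp: d_def HBT_0 c)
  moreover have "d i j = 0" if "Suc N \<le> i \<or> Suc N \<le> j" for i j
    using that by (cases i) (auto simp: d_def c(2))
  ultimately show ?case by (intro exI[of _ "Suc N"] exI[of _ d]) blast
next
  case (omega f)
  from omega.IH obtain N c where
    c: "\<And>i j. c i j \<in> HBT" "\<And>i j. N \<le> i \<or> N \<le> j \<Longrightarrow> c i j = 0"
      "\<And>l M. N \<le> M \<Longrightarrow> f l = (\<Sum>i<M. \<Sum>j<M. c i j * tau l ^ i * omega l ^ j)"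
    by blast
  define d where "d i j = (case j of 0 \<Rightarrow> 0 | Suc k \<Rightarrow> c i k)" for i j
  have "omega l * f l = (\<Sum>i<M. \<Sum>j<M. d i j * tau l ^ i * omega l ^ j)" if "Suc N \<le> M" for l M
  proof -
    obtain K where M: "M = Suc K" and K: "N \<le> K" using \<open>Suc N \<le> M\<close> by (cases M) auto
    have "(\<Sum>j<M. d i j * tau l ^ i * omega l ^ j) = (\<Sum>j<K. omega l * (c i j * tau l ^ i * omega l ^ j))" for i
      unfolding M sum.lessThan_Suc_shift by (simp add: d_def mult_ac)
    then have "(\<Sum>i<M. \<Sum>j<M. d i j * tau l ^ i * omega l ^ j) =
        (\<Sum>i<Suc K. \<Sum>j<K. omega l * (c i j * tau l ^ i * omega l ^ j))"
      by (simp only: M)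
    also have "\<dots> = (\<Sum>i<K. \<Sum>j<K. omega l * (c i j * tau l ^ i * omega l ^ j))"
      using K by (simp add: c(2))
    finally have "(\<Sum>i<M. \<Sum>j<M. d i j * tau l ^ i * omega l ^ j) = \<dots>" .
    then show ?thesis using c(3)[OF K, of l] by (simp add: sum_distrib_left)
  qed
  moreover have "d i j \<in> HBT" for i j by (cases j) (auto simp: d_def HBT_0 c)
  moreover have "d i j = 0" if "Suc N \<le> i \<or> Suc N \<le> j" for i j
    using that by (cases j) (auto simp: d_def c(2))
  ultimately show ?case by (intro exI[of _ "Suc N"] exI[of _ d]) blast
qed

section \<open>Descending induction over the vanishing conditions\<close>

text \<open>The condition weakens as S grows: it is trivial for S = \<open>verts\<close>, and for
  the empty set it is the generation statement. Equality is asked on \<open>verts\<close> only,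
  since functions are defined on all vectors.\<close>

definition spans :: "vec set \<Rightarrow> bool" where
  "spans S \<longleftrightarrow> (\<forall>f. GKM f \<longrightarrow> (\<forall>m\<in>S. f m = 0) \<longrightarrow> (\<exists>g\<in>gen_alg. \<forall>l\<in>verts. f l = g l))"

lemma spans_verts: "spans verts"
  unfolding spans_def using gen_alg.const[OF HBT_0] by (intro allI impI bexI[of _ "\<lambda>l. 0"]) auto

text \<open>If q in \<open>HBT\<close> is the quotient of f(l) by the root product, f - q G vanishes
  at l as well as on S, so it falls under the hypothesis for \<open>insert l S\<close>.\<close>

lemma spans_step:
  assumes "spans (insert l S)" "l \<in> verts" "S \<subseteq> verts" "G \<in> gen_alg" "\<And>m. m \<in> S \<Longrightarrow> G m = 0"
    and "finite D" "D \<subseteq> S" "\<And>m. m \<in> D \<Longrightarrow> ip l m = 1/3" "G l = (\<Prod>m\<in>D. lin (l - m))"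
  shows "spans S"
  unfolding spans_def
proof (intro allI impI)
  fix f assume f: "GKM f" "\<forall>m\<in>S. f m = 0"
  have "\<exists>q\<in>HBT. f l = (\<Prod>m\<in>D. lin (l - m)) * q"
  proof (rule neighbour_prod_dvd)
    show "f l \<in> HBT" using f(1) assms(2) unfolding GKM_def Lambda_eq by blast
    fix m assume m: "m \<in> D"
    then have "m \<in> verts" "f m = 0" using assms f by auto
    then show "\<exists>g\<in>HBT. f l = lin (l - m) * g"
      using GKM_neighbour[OF f(1) assms(2) _ assms(8)[OF m]] by (metis diff_zero)
  qed (use assms in auto)
  then obtain q where q: "q \<in> HBT" "f l = G l * q" using assms(9) by auto
  have "(\<lambda>m. - q * G m) \<in> gen_alg" using gen_alg_scale[OF HBT_uminus[OF q(1)] assms(4)] .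
  then have "GKM (\<lambda>m. f m + - q * G m)" using gen_alg_GKM GKM_add[OF f(1)] by blast
  moreover have "\<forall>m\<in>insert l S. f m + - q * G m = 0" using f(2) assms(5) q(2) by (auto simp: mult.commute)
  ultimately obtain g where g: "g \<in> gen_alg" "\<forall>l\<in>verts. f l + - q * G l = g l"
    using assms(1) unfolding spans_def by blast
  have "(\<lambda>l. g l + q * G l) \<in> gen_alg" by (intro gen_alg.add gen_alg_scale g q assms(4))
  moreover have "\<forall>l\<in>verts. f l = g l + q * G l" using g(2) by (auto simp: algebra_simps)
  ultimately show "\<exists>g\<in>gen_alg. \<forall>l\<in>verts. f l = g l" by (intro bexI[of _ "\<lambda>l. g l + q * G l"])
qed

section \<open>Classes of the flow-up basis\<close>

text \<open>The tautological function shifted by x, so that its value at c_pq is t_p + t_q.\<close>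

definition pair_sum :: "vec \<Rightarrow> pol" where "pair_sum l = lin l + XX"

text \<open>The product of the forms a_k - l over all six k. It vanishes at every a_i, and at c_pq
  it is omega times the two factors z - t_p and z - t_q, with z = 2x - t_p - t_q.\<close>

definition prodA :: "vec \<Rightarrow> pol" where "prodA l = (\<Prod>k<6. 2 * XX - pair_sum l - TT k)"

text \<open>With c = t_p + t_q and z = 2x - c, the two extra factors of \<open>prodA\<close> at c_pq
  multiply to z^2 - c z + t_p t_q = 4 x^2 - 6 x c + 2 c^2 + t_p t_q. The subtraction leaves omega *
  t_p t_q.\<close>

definition lift_c2 :: "vec \<Rightarrow> pol" where
  "lift_c2 l = prodA l - omega l * (4 * XX ^ 2 - 6 * XX * pair_sum l + 2 * pair_sum l ^ 2)"

text \<open>At c_pq omega equals (t_p t_q)^2 + \<open>quad_lin\<close> t_p t_q +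
  \<open>quad_const\<close>. Multiplying by omega and solving for omega * (t_p t_q)^2 gives this
  expression, in which \<open>lift_c2\<close> stands for omega * t_p t_q.\<close>

definition lift_c2_sq :: "vec \<Rightarrow> pol" where
  "lift_c2_sq l = omega l ^ 2 - quad_lin (pair_sum l) (2 * XX - pair_sum l) (esym_t 1) (esym_t 2) * lift_c2 l
    - quad_const (pair_sum l) (2 * XX - pair_sum l) (esym_t 1) (esym_t 2) (esym_t 3) (esym_t 4) * omega l"

definition top_class :: "vec \<Rightarrow> pol" where
  "top_class l = top_poly (pair_sum l) (esym_t 1) (esym_t 2) (esym_t 3) (esym_t 4) (esym_t 5) (esym_t 6) (omega l) (lift_c2 l) (lift_c2_sq l)"

lemma gen_alg_pair_sum: "pair_sum \<in> gen_alg"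
proof -
  have "(\<lambda>l. lin l + XX) \<in> gen_alg" by (intro gen_alg.add gen_alg_lin gen_alg.const HBT_XX)
  then show ?thesis unfolding pair_sum_def by simp
qed

lemma gen_alg_prodA: "prodA \<in> gen_alg"
proof -
  have "(\<lambda>l. \<Prod>k<6. 2 * XX - pair_sum l - TT k) \<in> gen_alg"
    by (intro gen_alg_prod gen_alg_diff gen_alg_pair_sum gen_alg.const HBT.mult HBT_numeral HBT_XX HBT_TT) simp
  then show ?thesis unfolding prodA_def[abs_def] .
qed

lemma gen_alg_lift_c2: "lift_c2 \<in> gen_alg"
proof -
  have "(\<lambda>l. prodA l - omega l * (4 * XX ^ 2 - 6 * XX * pair_sum l + 2 * pair_sum l ^ 2)) \<in> gen_alg"
    by (intro gen_alg_diff gen_alg.add gen_alg_mult gen_alg_power gen_alg_prodA gen_alg_omega gen_alg_pair_sum gen_alg.const HBT.mult HBT_power HBT_numeral HBT_XX)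
  then show ?thesis unfolding lift_c2_def[abs_def] .
qed

lemma gen_alg_coeffs:
  assumes "c \<in> gen_alg" "z \<in> gen_alg"
  shows "(\<lambda>l. quad_lin (c l) (z l) (esym_t 1) (esym_t 2)) \<in> gen_alg"
    "(\<lambda>l. quad_const (c l) (z l) (esym_t 1) (esym_t 2) (esym_t 3) (esym_t 4)) \<in> gen_alg"
    "(\<lambda>l. rel5_sq (c l) (esym_t 1)) \<in> gen_alg"
    "(\<lambda>l. rel5_lin (c l) (esym_t 1) (esym_t 2) (esym_t 3)) \<in> gen_alg"
    "(\<lambda>l. rel5_const (c l) (esym_t 1) (esym_t 2) (esym_t 3) (esym_t 4) (esym_t 5)) \<in> gen_alg"
    "(\<lambda>l. rel6_sq (c l) (esym_t 1) (esym_t 2)) \<in> gen_alg"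
    "(\<lambda>l. rel6_lin (c l) (esym_t 1) (esym_t 2) (esym_t 3) (esym_t 4)) \<in> gen_alg"
    "(\<lambda>l. rel6_const (c l) (esym_t 1) (esym_t 2) (esym_t 3) (esym_t 4) (esym_t 5) (esym_t 6)) \<in> gen_alg"
  unfolding quad_lin_def quad_const_def rel5_sq_def rel5_lin_def rel5_const_def rel6_sq_def rel6_lin_def rel6_const_def
  by (intro gen_alg_diff gen_alg.add gen_alg_mult gen_alg_power gen_alg_uminus assms gen_alg.const HBT_esym_t HBT_numeral HBT_uminus HBT_intros)+

lemma gen_alg_lift_c2_sq: "lift_c2_sq \<in> gen_alg"
proof -
  have z: "(\<lambda>l. 2 * XX - pair_sum l) \<in> gen_alg"
    by (intro gen_alg_diff gen_alg_pair_sum gen_alg.const HBT.mult HBT_numeral HBT_XX)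
  have "(\<lambda>l. omega l ^ 2 - quad_lin (pair_sum l) (2 * XX - pair_sum l) (esym_t 1) (esym_t 2) * lift_c2 l
    - quad_const (pair_sum l) (2 * XX - pair_sum l) (esym_t 1) (esym_t 2) (esym_t 3) (esym_t 4) * omega l) \<in> gen_alg"
    by (intro gen_alg_diff gen_alg_mult gen_alg_power gen_alg_lift_c2 gen_alg_omega gen_alg_coeffs[OF gen_alg_pair_sum z])
  then show ?thesis unfolding lift_c2_sq_def[abs_def] .
qed

lemma gen_alg_top_class: "top_class \<in> gen_alg"
proof -
  note c = gen_alg_coeffs[OF gen_alg_pair_sum gen_alg_pair_sum]
  have "top_class = (\<lambda>l. rel5_sq (pair_sum l) (esym_t 1) * (rel6_sq (pair_sum l) (esym_t 1) (esym_t 2) * lift_c2_sq l +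
      rel6_lin (pair_sum l) (esym_t 1) (esym_t 2) (esym_t 3) (esym_t 4) * lift_c2 l +
      rel6_const (pair_sum l) (esym_t 1) (esym_t 2) (esym_t 3) (esym_t 4) (esym_t 5) (esym_t 6) * omega l) +
      rel5_lin (pair_sum l) (esym_t 1) (esym_t 2) (esym_t 3) * lift_c2_sq l + rel5_const (pair_sum l) (esym_t 1) (esym_t 2) (esym_t 3) (esym_t 4) (esym_t 5) * lift_c2 l)"
    unfolding top_class_def[abs_def] top_poly_def ..
  also have "\<dots> \<in> gen_alg"
    by (intro gen_alg.add gen_alg_mult gen_alg_lift_c2_sq gen_alg_lift_c2 gen_alg_omega c)
  finally show ?thesis .
qed

lemma pair_sum_verts: "pair_sum (vA i) = 2 * XX - TT i" "pair_sum (vC p q) = TT p + TT q" "pair_sum (vB i) = XX - TT i"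
  unfolding pair_sum_def v_defs lin_linear by simp_all

lemma vanish_vA:
  assumes "i < 6"
  shows "lift_c2 (vA i) = 0" "lift_c2_sq (vA i) = 0" "top_class (vA i) = 0"
proof -
  have "prodA (vA i) = 0" unfolding prodA_def pair_sum_verts using assms by (intro prod_zero) auto
  then show t: "lift_c2 (vA i) = 0" unfolding lift_c2_def omega_vA[OF assms] by simp
  then show p: "lift_c2_sq (vA i) = 0" unfolding lift_c2_sq_def omega_vA[OF assms] by simp
  show "top_class (vA i) = 0" unfolding top_class_def top_poly_def t p omega_vA[OF assms] by simp
qed

lemma pair_list:
  fixes p q :: nat
  assumes "p < 6" "q < 6" "p \<noteq> q"
  obtains a b c d where "distinct [p, q, a, b, c, d]" "set [p, q, a, b, c, d] = {..<6}"
proof -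
  obtain ys where ys: "length ys = 6 - length [p, q]" "distinct ([p, q] @ ys)" "set ([p, q] @ ys) = {..<6}"
    using six_indices[of "[p, q]"] assms by auto
  then obtain a b c d where "ys = [a, b, c, d]" by (auto simp: length_Suc_conv eval_nat_numeral)
  then show ?thesis using that[of a b c d] ys by simp
qed

lemma values_vC:
  assumes "p < 6" "q < 6" "p \<noteq> q"
  shows "lift_c2 (vC p q) = omega (vC p q) * (TT p * TT q)"
    and "lift_c2_sq (vC p q) = omega (vC p q) * (TT p * TT q) ^ 2"
    and "(TT p * TT q) ^ 3 = rel6_sq (pair_sum (vC p q)) (esym_t 1) (esym_t 2) * (TT p * TT q) ^ 2 +
       rel6_lin (pair_sum (vC p q)) (esym_t 1) (esym_t 2) (esym_t 3) (esym_t 4) * (TT p * TT q) +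
       rel6_const (pair_sum (vC p q)) (esym_t 1) (esym_t 2) (esym_t 3) (esym_t 4) (esym_t 5) (esym_t 6)"
    and "top_class (vC p q) = 0"
proof -
  obtain a b c d where L: "distinct [p, q, a, b, c, d]" "set [p, q, a, b, c, d] = {..<6}"
    using pair_list[OF assms] .
  let ?z = "2 * XX - (TT p + TT q)"
  let ?w = "omega (vC p q)"
  have E: "esym_t n = esym_list n [TT p, TT q, TT a, TT b, TT c, TT d]" for n
    using esym_t_eq[OF L, of n] by simp
  have "{..<6} - {p, q} = {a, b, c, d}" using L(1) unfolding L(2)[symmetric] by auto
  then have w: "?w = (?z - TT a) * ((?z - TT b) * ((?z - TT c) * (?z - TT d)))"
    using L(1) unfolding omega_vC[OF assms] by (simp add: algebra_simps)
  have "prodA (vC p q) = (\<Prod>k\<in>set [p, q, a, b, c, d]. ?z - TT k)"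
    unfolding prodA_def pair_sum_verts L(2) ..
  also have "\<dots> = (?z - TT p) * ((?z - TT q) * ?w)"
    unfolding w using L(1) by simp
  finally have P: "prodA (vC p q) = (?z - TT p) * ((?z - TT q) * ?w)" .
  show th: "lift_c2 (vC p q) = ?w * (TT p * TT q)"
    unfolding lift_c2_def P pair_sum_verts by algebra
  have quad: "?w = (TT p * TT q) ^ 2 + quad_lin (TT p + TT q) ?z (esym_t 1) (esym_t 2) * (TT p * TT q) +
      quad_const (TT p + TT q) ?z (esym_t 1) (esym_t 2) (esym_t 3) (esym_t 4)"
    unfolding w E by (rule quad_identity)
  have "lift_c2_sq (vC p q) = ?w * (?w - quad_lin (TT p + TT q) ?z (esym_t 1) (esym_t 2) * (TT p * TT q)
      - quad_const (TT p + TT q) ?z (esym_t 1) (esym_t 2) (esym_t 3) (esym_t 4))"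
    unfolding lift_c2_sq_def th pair_sum_verts by algebra
  also have "\<dots> = ?w * (TT p * TT q) ^ 2" using quad by algebra
  finally show ps: "lift_c2_sq (vC p q) = ?w * (TT p * TT q) ^ 2" .
  show s: "(TT p * TT q) ^ 3 = rel6_sq (pair_sum (vC p q)) (esym_t 1) (esym_t 2) * (TT p * TT q) ^ 2 +
       rel6_lin (pair_sum (vC p q)) (esym_t 1) (esym_t 2) (esym_t 3) (esym_t 4) * (TT p * TT q) +
       rel6_const (pair_sum (vC p q)) (esym_t 1) (esym_t 2) (esym_t 3) (esym_t 4) (esym_t 5) (esym_t 6)"
    unfolding pair_sum_verts E by (rule rel6_identity[OF refl])
  have r: "rel5_sq (pair_sum (vC p q)) (esym_t 1) * (TT p * TT q) ^ 2 + rel5_lin (pair_sum (vC p q)) (esym_t 1) (esym_t 2) (esym_t 3) * (TT p * TT q) +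
      rel5_const (pair_sum (vC p q)) (esym_t 1) (esym_t 2) (esym_t 3) (esym_t 4) (esym_t 5) = 0"
    unfolding pair_sum_verts E by (rule rel5_identity[OF refl])
  show "top_class (vC p q) = 0"
    unfolding top_class_def top_poly_def th ps using s r by algebra
qed

text \<open>The factor - x is the form of b_i - a_i, so this is the full product of the eleven forms
  b_i - m, oriented as \<open>spans_step\<close> requires. The index y is any one of the other
  five.\<close>

lemma top_class_vB:
  assumes L: "distinct [i, y, a, b, c, d]" "set [i, y, a, b, c, d] = {..<6}"
  shows "top_class (vB i) = - (XX * prod_list (map (\<lambda>m. lin (vB i - m))
    [vC y a, vC y b, vC y c, vC y d, vC a b, vC a c, vC a d, vC b c, vC b d, vC c d]))"
proof -
  have i: "i < 6" using L(2) by auto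
  have E: "esym_t n = esym_list n [TT i, TT y, TT a, TT b, TT c, TT d]" for n
    using esym_t_eq[OF L, of n] by simp
  have z: "2 * XX - (XX - TT i) = XX + TT i" by simp
  have d: "TT d = 3 * XX - TT i - TT y - TT a - TT b - TT c" using sum_TT[OF L] by simp
  have "prodA (vB i) = (\<Prod>k\<in>set [i, y, a, b, c, d]. XX + TT i - TT k)"
    unfolding prodA_def pair_sum_verts L(2) z ..
  also have "\<dots> = (XX + TT i - TT i) * ((XX + TT i - TT y) * ((XX + TT i - TT a) * ((XX + TT i - TT b) *
     ((XX + TT i - TT c) * (XX + TT i - TT d)))))"
    using L(1) by simp
  finally have P: "prodA (vB i) = \<dots>" .
  have l: "lin (vB i - vC j k) = XX - TT i - TT j - TT k" for j k
    unfolding v_defs lin_linear by simp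
  show ?thesis
    unfolding list.map l top_class_def pair_sum_verts E
    by (rule top_poly_list_identity[OF d refl _ P])
      (simp_all only: omega_vB[OF i] lift_c2_def lift_c2_sq_def pair_sum_verts z E)
qed

text \<open>On the vertices c_pq, multiplication of omega by any polynomial in t_p + t_q and t_p t_q stays in the
  generated algebra: t_p + t_q is lin + x, while omega * t_p t_q and omega * (t_p t_q)^2 are the
  restrictions of lift_c2 and lift_c2_sq, and higher powers reduce by rel6.\<close>

definition liftable :: "(nat \<Rightarrow> nat \<Rightarrow> pol) \<Rightarrow> bool" where
  "liftable g \<longleftrightarrow> (\<exists>G\<in>gen_alg. (\<forall>i<6. G (vA i) = 0) \<and>
    (\<forall>p q. p < 6 \<longrightarrow> q < 6 \<longrightarrow> p \<noteq> q \<longrightarrow> G (vC p q) = omega (vC p q) * g p q))"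

lemma liftableI:
  assumes "G \<in> gen_alg" "\<And>i. i < 6 \<Longrightarrow> G (vA i) = 0"
    "\<And>p q. p < 6 \<Longrightarrow> q < 6 \<Longrightarrow> p \<noteq> q \<Longrightarrow> G (vC p q) = omega (vC p q) * g p q"
  shows "liftable g"
  unfolding liftable_def using assms by blast

lemma liftable_cong:
  assumes "liftable g" "\<And>p q. p < 6 \<Longrightarrow> q < 6 \<Longrightarrow> p \<noteq> q \<Longrightarrow> g p q = h p q"
  shows "liftable h"
proof -
  obtain G where G: "G \<in> gen_alg" "\<And>i. i < 6 \<Longrightarrow> G (vA i) = 0"
    "\<And>p q. p < 6 \<Longrightarrow> q < 6 \<Longrightarrow> p \<noteq> q \<Longrightarrow> G (vC p q) = omega (vC p q) * g p q"
    using assms(1) unfolding liftable_def by blast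
  show ?thesis by (rule liftableI[OF G(1,2)]) (simp_all add: G(3) assms(2))
qed

lemma liftable_add:
  assumes "liftable g" "liftable h"
  shows "liftable (\<lambda>p q. g p q + h p q)"
proof -
  obtain G where G: "G \<in> gen_alg" "\<And>i. i < 6 \<Longrightarrow> G (vA i) = 0"
    "\<And>p q. p < 6 \<Longrightarrow> q < 6 \<Longrightarrow> p \<noteq> q \<Longrightarrow> G (vC p q) = omega (vC p q) * g p q"
    using assms(1) unfolding liftable_def by blast
  obtain H where H: "H \<in> gen_alg" "\<And>i. i < 6 \<Longrightarrow> H (vA i) = 0"
    "\<And>p q. p < 6 \<Longrightarrow> q < 6 \<Longrightarrow> p \<noteq> q \<Longrightarrow> H (vC p q) = omega (vC p q) * h p q"
    using assms(2) unfolding liftable_def by blast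
  show ?thesis
    by (rule liftableI[of "\<lambda>l. G l + H l"]) (use G H in \<open>auto intro: gen_alg.add simp: distrib_left\<close>)
qed

lemma liftable_mult:
  assumes "r \<in> gen_alg" "liftable g"
  shows "liftable (\<lambda>p q. r (vC p q) * g p q)"
proof -
  obtain G where G: "G \<in> gen_alg" "\<And>i. i < 6 \<Longrightarrow> G (vA i) = 0"
    "\<And>p q. p < 6 \<Longrightarrow> q < 6 \<Longrightarrow> p \<noteq> q \<Longrightarrow> G (vC p q) = omega (vC p q) * g p q"
    using assms(2) unfolding liftable_def by blast
  show ?thesis
    by (rule liftableI[OF gen_alg_mult[OF assms(1) G(1)]]) (simp_all add: G(2,3) mult_ac)
qed

text \<open>The lifts at hand are omega * (t_p t_q)^k for k = 0, 1, 2. Carrying all three multiples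
  of g makes multiplication of g by t_p t_q an invariant operation.\<close>

definition liftable3 :: "(nat \<Rightarrow> nat \<Rightarrow> pol) \<Rightarrow> bool" where
  "liftable3 g \<longleftrightarrow> liftable g \<and> liftable (\<lambda>p q. TT p * TT q * g p q) \<and>
    liftable (\<lambda>p q. (TT p * TT q) ^ 2 * g p q)"

lemma liftable3_one: "liftable3 (\<lambda>p q. 1)"
  unfolding liftable3_def
proof (intro conjI)
  show "liftable (\<lambda>p q. 1)"
    by (rule liftableI[OF gen_alg_omega]) (auto simp: omega_vA)
  show "liftable (\<lambda>p q. TT p * TT q * 1)"
    by (rule liftableI[OF gen_alg_lift_c2]) (auto simp: vanish_vA values_vC)
  show "liftable (\<lambda>p q. (TT p * TT q) ^ 2 * 1)"
    by (rule liftableI[OF gen_alg_lift_c2_sq]) (auto simp: vanish_vA values_vC)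
qed

lemma liftable3_add: "liftable3 g \<Longrightarrow> liftable3 h \<Longrightarrow> liftable3 (\<lambda>p q. g p q + h p q)"
  unfolding liftable3_def distrib_left by (intro conjI liftable_add) blast+

lemma liftable3_mult:
  assumes "r \<in> gen_alg" "liftable3 g"
  shows "liftable3 (\<lambda>p q. r (vC p q) * g p q)"
proof -
  have g: "liftable g" "liftable (\<lambda>p q. TT p * TT q * g p q)" "liftable (\<lambda>p q. (TT p * TT q) ^ 2 * g p q)"
    using assms(2) unfolding liftable3_def by blast+
  have "liftable (\<lambda>p q. TT p * TT q * (r (vC p q) * g p q))"
    using liftable_mult[OF assms(1) g(2)] by (rule liftable_cong) (simp only: mult_ac)
  moreover have "liftable (\<lambda>p q. (TT p * TT q) ^ 2 * (r (vC p q) * g p q))"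
    using liftable_mult[OF assms(1) g(3)] by (rule liftable_cong) (simp only: mult_ac)
  ultimately show ?thesis unfolding liftable3_def using liftable_mult[OF assms(1) g(1)] by blast
qed

text \<open>The three powers shift up by one; the new third power is rewritten by the monic cubic
  relation with coefficients in t_p + t_q.\<close>

lemma liftable3_c2:
  assumes "liftable3 g"
  shows "liftable3 (\<lambda>p q. TT p * TT q * g p q)"
proof -
  have g0: "liftable g" and g1: "liftable (\<lambda>p q. TT p * TT q * g p q)"
    and g2: "liftable (\<lambda>p q. (TT p * TT q) ^ 2 * g p q)"
    using assms unfolding liftable3_def by blast+
  note c = gen_alg_coeffs[OF gen_alg_pair_sum gen_alg_pair_sum]
  have "liftable (\<lambda>p q. (rel6_sq (pair_sum (vC p q)) (esym_t 1) (esym_t 2) * ((TT p * TT q) ^ 2 * g p q) +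
      rel6_lin (pair_sum (vC p q)) (esym_t 1) (esym_t 2) (esym_t 3) (esym_t 4) * (TT p * TT q * g p q)) +
      rel6_const (pair_sum (vC p q)) (esym_t 1) (esym_t 2) (esym_t 3) (esym_t 4) (esym_t 5) (esym_t 6) * g p q)"
    by (intro liftable_add liftable_mult[OF c(6) g2] liftable_mult[OF c(7) g1] liftable_mult[OF c(8) g0])
  then have g3: "liftable (\<lambda>p q. (TT p * TT q) ^ 3 * g p q)"
  proof (rule liftable_cong)
    fix p q :: nat assume "p < 6" "q < 6" "p \<noteq> q"
    note e = values_vC(3)[OF this]
    show "rel6_sq (pair_sum (vC p q)) (esym_t 1) (esym_t 2) * ((TT p * TT q) ^ 2 * g p q) +
      rel6_lin (pair_sum (vC p q)) (esym_t 1) (esym_t 2) (esym_t 3) (esym_t 4) * (TT p * TT q * g p q) +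
      rel6_const (pair_sum (vC p q)) (esym_t 1) (esym_t 2) (esym_t 3) (esym_t 4) (esym_t 5) (esym_t 6) * g p q = (TT p * TT q) ^ 3 * g p q"
      unfolding e by (simp only: distrib_right mult.assoc)
  qed
  have h2: "liftable (\<lambda>p q. TT p * TT q * (TT p * TT q * g p q))"
    using g2 by (rule liftable_cong) (simp add: power2_eq_square mult_ac)
  have h3: "liftable (\<lambda>p q. (TT p * TT q) ^ 2 * (TT p * TT q * g p q))"
    using g3 by (rule liftable_cong) (simp add: power2_eq_square power3_eq_cube mult_ac)
  show ?thesis unfolding liftable3_def using g1 h2 h3 by blast
qed

text \<open>The second product vanishes at c_pq as soon as p < i, the first one at c_im for i < m <
  j: these are the pairs lexicographically before i, j.\<close>

lemma liftable_flow_up: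
  assumes "i < 6" "j \<le> 6"
  shows "liftable (\<lambda>p q. (\<Prod>m\<in>{i<..<j}. TT p + TT q - TT i - TT m) *
    (\<Prod>m<i. (TT m - TT p) * (TT m - TT q)))"
proof -
  have "liftable3 (\<lambda>p q. \<Prod>m<i. (TT m - TT p) * (TT m - TT q))" using assms(1)
  proof (induction i)
    case 0
    then show ?case using liftable3_one by simp
  next
    case (Suc i)
    let ?g = "\<lambda>p q. \<Prod>m<i. (TT m - TT p) * (TT m - TT q)"
    have g: "liftable3 ?g" using Suc by simp
    \<comment> \<open>(t_i - t_p)(t_i - t_q) = t_i^2 - t_i (t_p + t_q) + t_p t_q: the first two
      terms lie in the algebra, the last one is handled by \<open>liftable3_c2\<close>.\<close>
    have "(\<lambda>l. TT i ^ 2 - TT i * pair_sum l) \<in> gen_alg"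
      using Suc.prems by (intro gen_alg_diff gen_alg_mult gen_alg_power gen_alg_pair_sum gen_alg.const HBT_TT HBT_power) auto
    from liftable3_add[OF liftable3_mult[OF this g] liftable3_c2[OF g]]
    have "liftable3 (\<lambda>p q. (TT i ^ 2 - TT i * pair_sum (vC p q)) * ?g p q + TT p * TT q * ?g p q)" .
    moreover have "(TT i ^ 2 - TT i * pair_sum (vC p q)) * ?g p q + TT p * TT q * ?g p q =
        (\<Prod>m<Suc i. (TT m - TT p) * (TT m - TT q))" for p q
      unfolding pair_sum_verts prod.lessThan_Suc by (simp add: algebra_simps power2_eq_square)
    ultimately show ?case by simp
  qed
  then have g: "liftable (\<lambda>p q. \<Prod>m<i. (TT m - TT p) * (TT m - TT q))" unfolding liftable3_def by blast
  have "(\<lambda>l. \<Prod>m\<in>{i<..<j}. pair_sum l - TT i - TT m) \<in> gen_alg"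
    using assms by (intro gen_alg_prod gen_alg_diff gen_alg_pair_sum gen_alg.const HBT_TT) auto
  from liftable_mult[OF this g] show ?thesis unfolding pair_sum_verts .
qed

section \<open>Flow-up classes vertex by vertex\<close>

lemma inj_on_vA: "inj_on vA {..<6}" and inj_on_vB: "inj_on vB {..<6}"
  by (auto simp: inj_on_def vA_eq_iff vB_eq_iff)

lemma spans_vA_step:
  assumes "i < 6" "spans (vA ` {..<Suc i})"
  shows "spans (vA ` {..<i})"
proof (rule spans_step)
  show "spans (insert (vA i) (vA ` {..<i}))" using assms(2) by (simp add: lessThan_Suc)
  show "(\<lambda>l. \<Prod>m<i. lin l - lin (vA m)) \<in> gen_alg"
    using assms(1) by (intro gen_alg_prod gen_alg_diff gen_alg_lin gen_alg.const HBT.gen verts_Lat vertsI) auto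
  show "(\<Prod>m<i. lin l - lin (vA m)) = 0" if "l \<in> vA ` {..<i}" for l
    using that by (auto intro!: prod_zero)
  have "inj_on vA {..<i}" using inj_on_subset[OF inj_on_vA] assms(1) by auto
  then show "(\<Prod>m<i. lin (vA i) - lin (vA m)) = (\<Prod>m\<in>vA ` {..<i}. lin (vA i - m))"
    by (subst prod.reindex) (simp_all add: lin_diff)
qed (use assms in \<open>auto simp: ip_verts intro: vertsI\<close>)

text \<open>The lexicographic order is allowed to run to j = 6, where row i is complete and the set
  coincides with the start of row i + 1.\<close>

definition before_vC :: "nat \<Rightarrow> nat \<Rightarrow> vec set" where
  "before_vC i j = vA ` {..<6} \<union> {vC p q |p q. p < q \<and> q < 6 \<and> (p < i \<or> p = i \<and> q < j)}"

text \<open>Reversing the four roots changes the product by (-1)^4 = 1.\<close>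

lemma omega_vC_roots:
  assumes "i < 6" "j < 6" "i \<noteq> j"
  shows "omega (vC i j) = (\<Prod>k\<in>{..<6} - {i, j}. lin (vC i j - vA k))"
proof -
  have "(\<Prod>k\<in>{..<6} - {i, j}. lin (vC i j - vA k)) = (\<Prod>k\<in>{..<6} - {i, j}. (- 1) * lin (vA k - vC i j))"
    by (intro prod.cong refl) (simp add: lin_diff)
  also have "\<dots> = (- 1) ^ 4 * (\<Prod>k\<in>{..<6} - {i, j}. lin (vA k - vC i j))"
    unfolding prod.distrib using assms by (simp add: card_Diff_subset)
  finally show ?thesis unfolding omega_vC[OF assms] lin_vA_minus_vC by simp
qed

lemma spans_vC_step:
  assumes "i < j" "j < 6" "spans (before_vC i (Suc j))"
  shows "spans (before_vC i j)"
proof -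
  let ?g = "\<lambda>p q. (\<Prod>m\<in>{i<..<j}. TT p + TT q - TT i - TT m) * (\<Prod>m<i. (TT m - TT p) * (TT m - TT q))"
  have ij: "i < 6" "j \<le> 6" "j < 6" "i \<noteq> j" using assms by auto
  obtain G where G: "G \<in> gen_alg" "\<And>k. k < 6 \<Longrightarrow> G (vA k) = 0"
    "\<And>p q. p < 6 \<Longrightarrow> q < 6 \<Longrightarrow> p \<noteq> q \<Longrightarrow> G (vC p q) = omega (vC p q) * ?g p q"
    using liftable_flow_up[OF ij(1,2)] unfolding liftable_def by blast
  \<comment> \<open>The earlier neighbours of c_ij: the four a_k, then c_mi and c_mj for m < i, with
    roots t_j - t_m and t_i - t_m, and c_im for i < m < j, with root t_j - t_m. \<open>omega\<close>
    accounts for the first kind, the flow-up factors for the rest.\<close>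
  let ?A = "vA ` ({..<6} - {i, j})" and ?B = "(\<lambda>m. vC m i) ` {..<i}" and ?C = "(\<lambda>m. vC m j) ` {..<i}"
    and ?E = "(\<lambda>m. vC i m) ` {i<..<j}"
  let ?r = "\<lambda>m. lin (vC i j - m)"
  show ?thesis
  proof (rule spans_step[where D = "?A \<union> (?B \<union> (?C \<union> ?E))"])
    have "before_vC i (Suc j) = insert (vC i j) (before_vC i j)"
      unfolding before_vC_def using assms(1,2) by (auto simp: less_Suc_eq)
    then show "spans (insert (vC i j) (before_vC i j))" using assms(3) by simp
    show "vC i j \<in> verts" using ij by (intro vertsI)
    show "before_vC i j \<subseteq> verts" unfolding before_vC_def by (auto intro!: vertsI)
    show "G \<in> gen_alg" by fact
    show "G m = 0" if "m \<in> before_vC i j" for m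
      using that unfolding before_vC_def
    proof (elim UnE)
      assume "m \<in> {vC p q |p q. p < q \<and> q < 6 \<and> (p < i \<or> p = i \<and> q < j)}"
      then obtain p q where m: "m = vC p q" and pq: "p < q" "q < 6" "p < i \<or> p = i \<and> q < j" by blast
      from pq(3) have "?g p q = 0"
      proof
        assume "p < i"
        then have "(\<Prod>m<i. (TT m - TT p) * (TT m - TT q)) = 0" by (intro prod_zero) auto
        then show ?thesis by simp
      next
        assume "p = i \<and> q < j"
        then have "(\<Prod>m\<in>{i<..<j}. TT p + TT q - TT i - TT m) = 0"
          using pq(1) by (intro prod_zero bexI[of _ q]) auto
        then show ?thesis by simp
      qed
      then show ?thesis unfolding m using G(3)[of p q] pq by simp
    qed (auto simp: G(2))
    show "finite (?A \<union> (?B \<union> (?C \<union> ?E)))" by simp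
    show "?A \<union> (?B \<union> (?C \<union> ?E)) \<subseteq> before_vC i j"
      unfolding before_vC_def using ij assms(1) by fastforce
    show "ip (vC i j) m = 1/3" if "m \<in> ?A \<union> (?B \<union> (?C \<union> ?E))" for m
      using that ij assms(1) by (auto simp: ip_vC ip_vC_vC doubleton_eq_iff split: if_splits)
    have inj: "inj_on vA ({..<6} - {i, j})" "inj_on (\<lambda>m. vC m i) {..<i}" "inj_on (\<lambda>m. vC m j) {..<i}"
      "inj_on (\<lambda>m. vC i m) {i<..<j}"
      using ij assms(1) by (auto simp: inj_on_def vA_eq_iff vC_eq_iff doubleton_eq_iff)
    have disj: "?A \<inter> (?B \<union> (?C \<union> ?E)) = {}" "?B \<inter> (?C \<union> ?E) = {}" "?C \<inter> ?E = {}"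
      using ij assms(1) vA_neq_vC by (auto simp: vC_eq_iff doubleton_eq_iff)
    have r: "?r (vC m i) = TT j - TT m" "?r (vC m j) = TT i - TT m" "?r (vC i m) = TT j - TT m" for m
      unfolding v_defs lin_linear by simp_all
    have "(\<Prod>m\<in>?A \<union> (?B \<union> (?C \<union> ?E)). ?r m) =
        (\<Prod>m\<in>?A. ?r m) * ((\<Prod>m\<in>?B. ?r m) * ((\<Prod>m\<in>?C. ?r m) * (\<Prod>m\<in>?E. ?r m)))"
      using disj by (simp add: prod.union_disjoint)
    also have "\<dots> = omega (vC i j) * ((\<Prod>m<i. TT j - TT m) * ((\<Prod>m<i. TT i - TT m) * (\<Prod>m\<in>{i<..<j}. TT j - TT m)))"
      unfolding omega_vC_roots[OF ij(1,3,4)] prod.reindex[OF inj(1)] prod.reindex[OF inj(2)]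
        prod.reindex[OF inj(3)] prod.reindex[OF inj(4)] comp_def r ..
    also have "\<dots> = omega (vC i j) * ?g i j"
    proof -
      have "(\<Prod>m<i. (TT m - TT i) * (TT m - TT j)) = (\<Prod>m<i. (TT j - TT m) * (TT i - TT m))"
        by (intro prod.cong refl) (simp add: algebra_simps)
      then show ?thesis by (simp add: prod.distrib mult_ac)
    qed
    finally show "G (vC i j) = (\<Prod>m\<in>?A \<union> (?B \<union> (?C \<union> ?E)). ?r m)"
      using G(3)[OF ij(1,3,4)] by simp
  qed
qed

definition before_vB :: "nat \<Rightarrow> vec set" where
  "before_vB i = vA ` {..<6} \<union> {vC p q |p q. p < q \<and> q < 6} \<union> vB ` {..<i}"

lemma spans_vB_step:
  assumes "i < 6" "spans (before_vB (Suc i))"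
  shows "spans (before_vB i)"
proof -
  obtain ys where ys: "length ys = 6 - length [i]" "distinct ([i] @ ys)" "set ([i] @ ys) = {..<6}"
    using six_indices[of "[i]"] assms(1) by auto
  then obtain y a b c d where "ys = [y, a, b, c, d]" by (auto simp: length_Suc_conv eval_nat_numeral)
  then have L: "distinct [i, y, a, b, c, d]" "set [i, y, a, b, c, d] = {..<6}" using ys by simp_all
  have lt: "y < 6" "a < 6" "b < 6" "c < 6" "d < 6" using L(2) by auto
  \<comment> \<open>The ten c_jk avoiding i; together with a_i they are the eleven neighbours
    handled by \<open>top_class\<close>. The factors \<open>lin l - lin (vB m)\<close> take care of
    the earlier b_m.\<close>
  let ?ms = "[vC y a, vC y b, vC y c, vC y d, vC a b, vC a c, vC a d, vC b c, vC b d, vC c d]"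
  let ?r = "\<lambda>m. lin (vB i - m)"
  let ?G = "\<lambda>l. top_class l * (\<Prod>m<i. lin l - lin (vB m))"
  have dist: "distinct ?ms" using L(1) lt by (simp add: vC_eq_iff doubleton_eq_iff)
  show ?thesis
  proof (rule spans_step[where D = "insert (vA i) (set ?ms \<union> vB ` {..<i})"])
    have "before_vB (Suc i) = insert (vB i) (before_vB i)" unfolding before_vB_def by (auto simp: lessThan_Suc)
    then show "spans (insert (vB i) (before_vB i))" using assms(2) by simp
    show "vB i \<in> verts" using assms(1) by (rule vertsI)
    show "before_vB i \<subseteq> verts" unfolding before_vB_def using assms(1) by (auto intro!: vertsI)
    show "?G \<in> gen_alg"
      using assms(1) by (intro gen_alg_mult gen_alg_top_class gen_alg_prod gen_alg_diff gen_alg_lin gen_alg.const HBT.gen verts_Lat vertsI) auto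
    show "?G m = 0" if "m \<in> before_vB i" for m
      using that unfolding before_vB_def by (auto simp: vanish_vA values_vC intro!: prod_zero)
    show "finite (insert (vA i) (set ?ms \<union> vB ` {..<i}))" by simp
    have "vC p q \<in> {vC p q |p q. p < q \<and> q < 6}" if "p < 6" "q < 6" "p \<noteq> q" for p q
    proof (cases "p < q")
      case False
      then have "vC p q = vC q p \<and> q < p \<and> p < 6" using that vC_commute[of p q] by linarith
      then show ?thesis by blast
    qed (use that in blast)
    then show "insert (vA i) (set ?ms \<union> vB ` {..<i}) \<subseteq> before_vB i"
      unfolding before_vB_def using assms(1) lt L(1) by simp
    show "ip (vB i) m = 1/3" if "m \<in> insert (vA i) (set ?ms \<union> vB ` {..<i})" for m
      using that assms(1) lt L(1) by (auto simp: ip_verts ip_vC)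
    have inj: "inj_on vB {..<i}" using inj_on_subset[OF inj_on_vB] assms(1) by auto
    have n: "vA i \<notin> set ?ms \<union> vB ` {..<i}"
      using assms(1) lt L(1) vA_neq_vC vA_neq_vB by auto
    have disj: "set ?ms \<inter> vB ` {..<i} = {}"
      using assms(1) lt L(1) vB_neq_vC by fastforce
    have x: "?r (vA i) = - XX" unfolding v_defs lin_linear by simp
    have "(\<Prod>m\<in>insert (vA i) (set ?ms \<union> vB ` {..<i}). ?r m) =
        ?r (vA i) * ((\<Prod>m\<in>set ?ms. ?r m) * (\<Prod>m\<in>vB ` {..<i}. ?r m))"
      unfolding prod.insert[OF finite_UnI[OF finite_set finite_imageI[OF finite_lessThan]] n]
        prod.union_disjoint[OF finite_set finite_imageI[OF finite_lessThan] disj] ..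
    also have "(\<Prod>m\<in>set ?ms. ?r m) = prod_list (map ?r ?ms)"
      by (rule prod.distinct_set_conv_list[OF dist])
    also have "(\<Prod>m\<in>vB ` {..<i}. ?r m) = (\<Prod>m<i. lin (vB i) - lin (vB m))"
      unfolding prod.reindex[OF inj] comp_def lin_diff ..
    finally show "?G (vB i) = (\<Prod>m\<in>insert (vA i) (set ?ms \<union> vB ` {..<i}). ?r m)"
      unfolding top_class_vB[OF L] x by (simp only: mult_minus_left mult.assoc)
  qed
qed

lemma downward_induct: "P (n::nat) \<Longrightarrow> (\<And>i. k \<le> i \<Longrightarrow> i < n \<Longrightarrow> P (Suc i) \<Longrightarrow> P i) \<Longrightarrow> k \<le> n \<Longrightarrow> P k"
  using inc_induct[of k n P] by blast

lemma spans_empty: "spans {}"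
proof -
  have "before_vB 6 = verts" unfolding before_vB_def verts_def by auto
  then have "spans (before_vB 6)" using spans_verts by simp
  then have "spans (before_vB 0)" by (rule downward_induct) (auto intro: spans_vB_step)
  moreover have "before_vB 0 = before_vC 5 6" unfolding before_vB_def before_vC_def by auto
  ultimately have C5: "spans (before_vC 5 (Suc 5))" by simp
  have "spans (before_vC 0 (Suc 0))"
  proof (rule downward_induct[where P = "\<lambda>i. spans (before_vC i (Suc i))", OF C5])
    fix i :: nat assume i: "i < 5" and S: "spans (before_vC (Suc i) (Suc (Suc i)))"
    \<comment> \<open>The first pair of row i + 1 is c_{i+1,i+2}, so before it lie exactly the
      complete rows up to i.\<close>
    have "before_vC (Suc i) (Suc (Suc i)) = before_vC i 6" unfolding before_vC_def by (auto simp: less_Suc_eq)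
    then have "spans (before_vC i 6)" using S by simp
    then show "spans (before_vC i (Suc i))"
      by (rule downward_induct[where P = "\<lambda>j. spans (before_vC i j)"]) (use i in \<open>auto intro: spans_vC_step\<close>)
  qed simp
  moreover have "before_vC 0 (Suc 0) = vA ` {..<6}" unfolding before_vC_def by auto
  ultimately have "spans (vA ` {..<6})" by simp
  then have "spans (vA ` {..<0})"
    by (rule downward_induct[where P = "\<lambda>i. spans (vA ` {..<i})"]) (auto intro: spans_vA_step)
  then show ?thesis by simp
qed

theorem theorem4p2:
  shows "GKM tau \<and> GKM omega \<and>
    (\<forall>f. GKM f \<longrightarrow>
       (\<exists>(N::nat) (c :: nat \<Rightarrow> nat \<Rightarrow> pol). (\<forall>i j. c i j \<in> HBT) \<and>
          (\<forall>l\<in>Lambda. f l = (\<Sum>i<N. \<Sum>j<N. c i j * tau l ^ i * omega l ^ j))))"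
proof (intro conjI GKM_tau GKM_omega allI impI)
  fix f assume "GKM f"
  then obtain g where g: "g \<in> gen_alg" "\<forall>l\<in>verts. f l = g l"
    using spans_empty unfolding spans_def by blast
  from gen_alg_representation[OF g(1)] obtain N c where c: "\<forall>i j. c i j \<in> HBT"
    "\<forall>l. \<forall>M\<ge>N. g l = (\<Sum>i<M. \<Sum>j<M. c i j * tau l ^ i * omega l ^ j)" by blast
  then show "\<exists>(N::nat) (c :: nat \<Rightarrow> nat \<Rightarrow> pol). (\<forall>i j. c i j \<in> HBT) \<and>
      (\<forall>l\<in>Lambda. f l = (\<Sum>i<N. \<Sum>j<N. c i j * tau l ^ i * omega l ^ j))"
    unfolding Lambda_eq using g(2) by (intro exI[of _ N] exI[of _ c]) simp
qed

end
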